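(* Let $r>0$, $S\in W^1_r$, and for each odd $n\ge 3$ let $\Lambda=\Lambda_n$ be any finite set in $[0,1]^n$, with $\nu=\nu_n$ elements. Let $\widehat S_*$ be the model selection estimator built with the variance estimator $\widehat\varsigma_n=\sum_{j=d_n+1}^n\widehat\theta_{j,n}^2$, where the integers $1\le d_n\le n-1$ satisfy $d_n/\sqrt n\to0$ and $d_n^2/\sqrt n\to\infty$ as $n\to\infty$. Then for every odd $n\ge3$ and every $0<\rho<1/3$, $$ \mathbf{E}_S\|\widehat S_*-S\|_n^2\le\frac{1+3\rho-2\rho^2}{1-3\rho}\,\min_{\lambda\in\Lambda}\mathbf{E}_S\|\widehat S_\lambda-S\|_n^2+\frac1n\,\mathcal{D}_n(\rho,r), $$ where $$ \mathcal{D}_n(\rho,r)=\Psi_n(\rho)+\kappa(\rho)\Bigl(2\bigl(\sqrt{\xi^*}+\sqrt2\bigr)\sigma_*+\varsigma_n^*(r)\Bigr)\frac{v_n}{\sqrt n}. $$ Moreover, if $\limsup_{n\to\infty}v_n/\sqrt n<\infty$ and, for every $\gamma>0$, $\lim_{n\to\infty}u_{1,n}/n^\gamma=0$ and $\lim_{n\to\infty}u_{2,n}/n^\gamma=0$, then for every $\gamma>0$ $$ \lim_{n\to\infty}\ \sup_{\varrho_n\le\rho\le1/6}\mathcal{D}_n(\rho,r)/n^\gamma=0, $$ where $(\varrho_n)$ is any slowly decreasing sequence, i.e. $\lim_{n\to\infty}\varrho_n=0$ and $\lim_{n\to\infty}n^{\gamma}\varrho_n=+\infty$ for every $\gamma>0$.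 (All limits are along odd $n$.)
   Context: Model. Observations are $y_j=S(x_j)+\sigma_j\xi_j$, $1\le j\le n$, with $x_j=j/n$, $n$ odd, and $S$ an unknown function. The $(\xi_j)$ are i.i.d. with $\mathbf{E}\xi_1=0$, $\mathbf{E}\xi_1^2=1$, $\mathbf{E}\xi_1^4=\xi^*<\infty$. The $(\sigma_l)_{1\le l\le n}$ are positive random variables (possibly depending on the design points and on $S$), independent of $(\xi_j)$, with $\max_{1\le l\le n}\sigma_l^2\le\sigma_*$ for some nonrandom unknown constant $\sigma_*>0$. $\mathbf{E}_S$ is expectation under this model. Function class. $W^1_r$ is the set of differentiable 1-periodic functions $S:\mathbb{R}\to\mathbb{R}$ with $\|S\|^2+\|S'\|^2\le r$, where $\|f\|^2=\int_0^1f^2(t)\,dt$. Inner product and basis. $(f,g)_n=\frac1n\sum_{l=1}^n f(x_l)g(x_l)$, $\|f\|_n^2=(f,f)_n$. $\phi_1=1$ and, for $j\ge2$, $\phi_j(x)=\sqrt2\cos(2\pi[j/2]x)$ for $j$ even, $\phi_j(x)=\sqrt2\sin(2\pi[j/2]x)$ for $j$ odd, $[\cdot]$ being the integer part. Estimators. $\widehat\theta_{j,n}=(Y,\phi_j)_n=\frac1n\sum_{l=1}^n y_l\phi_j(x_l)$. For a weight vector $\lambda=(\lambda(1),\ldots,\lambda(n))'\in\Lambda$, $\widehat S_\lambda(x)=\sum_{j=1}^n\lambda(j)\widehat\theta_{j,n}\phi_j(x)$. With $\widetilde\theta_{j,n}=\widehat\theta_{j,n}^2-\frac1n\widehat\varsigma_n$,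 $|\lambda|^2=\sum_{j=1}^n\lambda^2(j)$, $\widehat P_n(\lambda)=|\lambda|^2\widehat\varsigma_n/n$, put $$J_n(\lambda)=\sum_{j=1}^n\lambda^2(j)\widehat\theta_{j,n}^2-2\sum_{j=1}^n\lambda(j)\widetilde\theta_{j,n}+\rho\,\widehat P_n(\lambda).$$ Let $\widehat\lambda$ be a minimizer of $J_n$ over $\Lambda$ (any one of them if not unique), and $\widehat S_*=\widehat S_{\widehat\lambda}$. Constants. $\nu$ is the number of elements of $\Lambda$; $v_n=\max_{\lambda\in\Lambda}\sum_{j=1}^n\lambda(j)$; for $i=1,2$, $u_{i,n}=\max_{\lambda\in\Lambda}\sup_{1\le l\le n}\bigl|\sum_{j=1}^n\lambda^i(j)(\phi_j^2(x_l)-1)\bigr|$, where $\lambda^i(j)=(\lambda(j))^i$; $$\Upsilon_n^*(\rho)=\frac{16\nu}{\rho}+4u_{1,n}\Bigl(1+\nu\frac{\sqrt{\xi^*}}{\sqrt n}\Bigr)+4\nu v_n\frac{\sqrt{\xi^*}}{\sqrt n},$$ $$\Psi_n(\rho)=\frac{\rho(1-\rho)\Upsilon^*_n(\rho)+2\nu+2\rho^2(1-\rho)u_{2,n}}{\rho(1-3\rho)}\,\sigma_*,\qquad \kappa(\rho)=\frac{4(1-\rho^2)}{1-3\rho},$$ $$\varsigma_n^*(r)=\frac{4r\sqrt n}{d_n^2}+4\sqrt{r\sigma_*}\,\frac1{d_n}+\frac{(2+d_n)\sigma_*}{\sqrt n}.$$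
   Formalization: In the "Moreover" part the formal theorem also assumes that ν_n/n^γ tends to 0 for every γ>0; without it the claim fails (e.g. Λ_n = {(k/n,0,…,0): 1≤k≤n}), and the condition is necessary since D_n(1/6,r) ≥ 160 ν_n σ_*. *)

theory Defs
  imports "HOL-Probability.Probability"
begin

text \<open>The ball \<open>W\<^sup>1\<^sub>r\<close>. Integrability of \<open>S'\<^sup>2\<close> is required separately because the
  Bochner integral of a non-integrable function is \<open>0\<close>.\<close>

definition sobolev_ball :: "real \<Rightarrow> (real \<Rightarrow> real) set" where
  "sobolev_ball r = {S. (\<forall>x. S differentiable at x) \<and> (\<forall>x. S (x + 1) = S x) \<and>
     set_integrable lborel {0..1} (\<lambda>t. (deriv S t)\<^sup>2) \<and>
     (LINT t:{0..1}|lborel. (S t)\<^sup>2) + (LINT t:{0..1}|lborel. (deriv S t)\<^sup>2) \<le> r}"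

definition design :: "nat \<Rightarrow> nat \<Rightarrow> real" where
  "design n l = real l / real n"

definition empirical_inner :: "nat \<Rightarrow> (real \<Rightarrow> real) \<Rightarrow> (real \<Rightarrow> real) \<Rightarrow> real" where
  "empirical_inner n f g = (1 / real n) * (\<Sum>l=1..n. f (design n l) * g (design n l))"

definition empirical_norm_sq :: "nat \<Rightarrow> (real \<Rightarrow> real) \<Rightarrow> real" where
  "empirical_norm_sq n f = empirical_inner n f f"

text \<open>The trigonometric basis, indexed from \<open>1\<close>.\<close>

definition trig_basis :: "nat \<Rightarrow> real \<Rightarrow> real" where
  "trig_basis j x =
     (if j = 1 then 1
      else if even j then sqrt 2 * cos (2 * pi * real (j div 2) * x)
      else sqrt 2 * sin (2 * pi * real (j div 2) * x))"

definition observations ::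
  "nat \<Rightarrow> (real \<Rightarrow> real) \<Rightarrow> (nat \<Rightarrow> 'a \<Rightarrow> real) \<Rightarrow> (nat \<Rightarrow> 'a \<Rightarrow> real) \<Rightarrow> 'a \<Rightarrow> nat \<Rightarrow> real" where
  "observations n S \<sigma> \<xi> \<omega> l = S (design n l) + \<sigma> l \<omega> * \<xi> l \<omega>"

text \<open>In what follows \<open>y\<close> is a data vector \<open>(y\<^sub>1, \<dots>, y\<^sub>n)\<close>, \<open>w\<close> a weight vector (written
  \<open>\<lambda>\<close> in the mathematics), \<open>L\<close> a finite set of weight vectors, and \<open>d\<close> the cut-off of the
  variance estimator.\<close>

definition theta_hat :: "nat \<Rightarrow> (nat \<Rightarrow> real) \<Rightarrow> nat \<Rightarrow> real" where
  "theta_hat n y j = (1 / real n) * (\<Sum>l=1..n. y l * trig_basis j (design n l))"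

definition S_hat :: "nat \<Rightarrow> (nat \<Rightarrow> real) \<Rightarrow> (nat \<Rightarrow> real) \<Rightarrow> real \<Rightarrow> real" where
  "S_hat n y w x = (\<Sum>j=1..n. w j * theta_hat n y j * trig_basis j x)"

definition var_hat :: "nat \<Rightarrow> nat \<Rightarrow> (nat \<Rightarrow> real) \<Rightarrow> real" where
  "var_hat n d y = (\<Sum>j=d+1..n. (theta_hat n y j)\<^sup>2)"

definition theta_tilde :: "nat \<Rightarrow> nat \<Rightarrow> (nat \<Rightarrow> real) \<Rightarrow> nat \<Rightarrow> real" where
  "theta_tilde n d y j = (theta_hat n y j)\<^sup>2 - (1 / real n) * var_hat n d y"

definition penalty_hat :: "nat \<Rightarrow> nat \<Rightarrow> (nat \<Rightarrow> real) \<Rightarrow> (nat \<Rightarrow> real) \<Rightarrow> real" where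
  "penalty_hat n d y w = (\<Sum>j=1..n. (w j)\<^sup>2) * var_hat n d y / real n"

definition cost :: "nat \<Rightarrow> nat \<Rightarrow> real \<Rightarrow> (nat \<Rightarrow> real) \<Rightarrow> (nat \<Rightarrow> real) \<Rightarrow> real" where
  "cost n d \<rho> y w =
     (\<Sum>j=1..n. (w j)\<^sup>2 * (theta_hat n y j)\<^sup>2)
     - 2 * (\<Sum>j=1..n. w j * theta_tilde n d y j)
     + \<rho> * penalty_hat n d y w"

definition v_const :: "nat \<Rightarrow> (nat \<Rightarrow> real) set \<Rightarrow> real" where
  "v_const n L = (MAX w\<in>L. \<Sum>j=1..n. w j)"

definition u_const :: "nat \<Rightarrow> nat \<Rightarrow> (nat \<Rightarrow> real) set \<Rightarrow> real" where
  "u_const i n L =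
     (MAX w\<in>L. MAX l\<in>{1..n}. \<bar>\<Sum>j=1..n. (w j) ^ i * ((trig_basis j (design n l))\<^sup>2 - 1)\<bar>)"

definition Upsilon_star :: "nat \<Rightarrow> (nat \<Rightarrow> real) set \<Rightarrow> real \<Rightarrow> real \<Rightarrow> real" where
  "Upsilon_star n L \<xi>s \<rho> =
     16 * real (card L) / \<rho>
     + 4 * u_const 1 n L * (1 + real (card L) * (sqrt \<xi>s / sqrt (real n)))
     + 4 * real (card L) * v_const n L * (sqrt \<xi>s / sqrt (real n))"

definition Psi_const :: "nat \<Rightarrow> (nat \<Rightarrow> real) set \<Rightarrow> real \<Rightarrow> real \<Rightarrow> real \<Rightarrow> real" where
  "Psi_const n L \<xi>s \<sigma>s \<rho> =
     (\<rho> * (1 - \<rho>) * Upsilon_star n L \<xi>s \<rho> + 2 * real (card L)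
        + 2 * \<rho>\<^sup>2 * (1 - \<rho>) * u_const 2 n L)
     / (\<rho> * (1 - 3 * \<rho>)) * \<sigma>s"

definition kappa :: "real \<Rightarrow> real" where
  "kappa \<rho> = 4 * (1 - \<rho>\<^sup>2) / (1 - 3 * \<rho>)"

definition var_star :: "nat \<Rightarrow> nat \<Rightarrow> real \<Rightarrow> real \<Rightarrow> real" where
  "var_star n d \<sigma>s r =
     4 * r * sqrt (real n) / (real d)\<^sup>2 + 4 * sqrt (r * \<sigma>s) * (1 / real d)
     + (2 + real d) * \<sigma>s / sqrt (real n)"

definition D_const ::
  "nat \<Rightarrow> nat \<Rightarrow> (nat \<Rightarrow> real) set \<Rightarrow> real \<Rightarrow> real \<Rightarrow> real \<Rightarrow> real \<Rightarrow> real" where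
  "D_const n d L \<xi>s \<sigma>s \<rho> r =
     Psi_const n L \<xi>s \<sigma>s \<rho>
     + kappa \<rho> * (2 * (sqrt \<xi>s + sqrt 2) * \<sigma>s + var_star n d \<sigma>s r)
       * (v_const n L / sqrt (real n))"

text \<open>The filter for limits as \<open>n \<rightarrow> \<infinity>\<close> along odd \<open>n\<close>.\<close>

definition odd_sequentially :: "nat filter" where
  "odd_sequentially = inf sequentially (principal {n. odd n})"

end

theory Submission
  imports Defs "HOL-Real_Asymp.Real_Asymp"
begin

text \<open>Conditionally on the noise levels, the empirical loss of a weighted estimator differs from its
  penalized cost by a linear, a centered diagonal and an off-diagonal form in the noise, a
  basis-dependent bias, and the error of the variance estimator. By AM-GM the
  linear and off-diagonal forms are absorbed into a fraction \<open>\<rho>\<close> of the losses and of the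
  penalty, at the price of their squares normalized by their variance proxies. Each normalized
  square has expectation \<open>O(\<sigma>\<^sub>*/n)\<close>, so the supremum over the weights costs only a factor \<open>\<nu>\<close>.
  Independence of noise levels and noise then gives the unconditional bound by Fubini.\<close>

section \<open>Discrete trigonometric basis\<close>

text \<open>The obstacle is that the selected weight \<open>w\<close> depends on the noise, and that
  the linear form at \<open>z = w - w0\<close> cannot be charged directly to the losses: its
  variance proxy \<open>signal_sq z\<close> is built from the true coefficients, while the losses
  see the estimated ones. Passing from one to the other costs a second linear form, with weights
  \<open>z^2\<close>, and after multiplication by \<open>1 - \<rho>\<close> leaves
  \<open>2 * \<rho>\<close> times both losses. This is the origin of \<open>1 - 3 * \<rho>\<close>
  on the left and of \<open>1 + \<rho>\<close> on the right. The off-diagonal form at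
  \<open>w\<close> is charged to \<open>\<rho>\<close> times the penalty of \<open>w\<close>, which
  the penalty inside the cost cancels up to the error of the variance estimator. What survives is
  the penalty of \<open>w0\<close>, twice; it is comparable with the variance part of the risk of
  \<open>w0\<close>, and \<open>(1 + \<rho>) + 2 * \<rho> * (1 - \<rho>) = 1 + 3 * \<rho> - 2 *
  \<rho>^2\<close> is the leading constant. The variance proxies depend on the noise levels but not
  on the noise, so freezing the levels makes every normalization deterministic.\<close>

lemma dirichlet_kernel:
  "sin (a / 2) * (1 + 2 * (\<Sum>k=1..m. cos (real k * a))) = sin ((2 * real m + 1) * a / 2)"
proof (induction m)
  case (Suc m)
  have "((2 * real (Suc m) + 1) * a / 2 - (2 * real m + 1) * a / 2) / 2 = a / 2"
    "((2 * real (Suc m) + 1) * a / 2 + (2 * real m + 1) * a / 2) / 2 = real (Suc m) * a"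
    by (simp_all add: field_simps)
  then have "sin ((2 * real (Suc m) + 1) * a / 2) - sin ((2 * real m + 1) * a / 2)
      = 2 * sin (a / 2) * cos (real (Suc m) * a)"
    by (simp only: sin_diff_sin)
  with Suc show ?case by (simp add: algebra_simps)
qed auto

text \<open>The cosine addition formula merges each cosine-sine pair, so the sum depends on
  \<open>x - y\<close> only. With an odd number of terms no cosine is left unpaired.\<close>

lemma trig_sum_eq_dirichlet:
  "(\<Sum>j=1..2*m+1. trig_basis j x * trig_basis j y)
    = 1 + 2 * (\<Sum>k=1..m. cos (real k * (2 * pi * (x - y))))"
proof (induction m)
  case 0
  show ?case by (simp add: trig_basis_def)
next
  case (Suc m)
  have "(\<Sum>j=1..2*Suc m+1. trig_basis j x * trig_basis j y)
      = (\<Sum>j=1..2*m+1. trig_basis j x * trig_basis j y)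
        + trig_basis (2*Suc m) x * trig_basis (2*Suc m) y
        + trig_basis (2*Suc m+1) x * trig_basis (2*Suc m+1) y"
    by simp
  moreover have sqrt2: "sqrt 2 * (sqrt 2 * t) = 2 * t" for t
    by (simp flip: mult.assoc)
  have "trig_basis (2*Suc m) x * trig_basis (2*Suc m) y
        + trig_basis (2*Suc m+1) x * trig_basis (2*Suc m+1) y
      = 2 * cos (real (Suc m) * (2 * pi * (x - y)))"
    using cos_diff[of "2 * pi * real (Suc m) * x" "2 * pi * real (Suc m) * y"]
    by (simp add: trig_basis_def algebra_simps sqrt2)
  ultimately show ?case using Suc by simp
qed

text \<open>At the half angle \<open>pi * (l - k) / n\<close> the numerator of the Dirichlet kernel
  is the sine of an integer multiple of \<open>pi\<close>, while its denominator cannot vanish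
  because \<open>0 < |l - k| < n\<close>.\<close>

lemma trig_basis_complete:
  assumes "odd n" "l \<in> {1..n}" "k \<in> {1..n}"
  shows "(\<Sum>j=1..n. trig_basis j (design n l) * trig_basis j (design n k))
    = (if l = k then real n else 0)"
proof -
  obtain m where n: "n = 2 * m + 1" using assms(1) oddE by blast
  define a where "a = 2 * pi * (design n l - design n k)"
  have eq: "(\<Sum>j=1..n. trig_basis j (design n l) * trig_basis j (design n k))
      = 1 + 2 * (\<Sum>i=1..m. cos (real i * a))"
    unfolding n a_def by (rule trig_sum_eq_dirichlet)
  show ?thesis
  proof (cases "l = k")
    case True
    then show ?thesis unfolding eq by (simp add: a_def n)
  next
    case False
    have npos: "real n > 0" using assms by auto
    have a2: "a / 2 = pi * (real l - real k) / real n"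
      using npos by (simp add: a_def design_def field_simps)
    have "(2 * real m + 1) * a / 2 = real n * (a / 2)" by (simp add: n)
    also have "\<dots> = (real l - real k) * pi" unfolding a2 using npos by simp
    also have "\<dots> = real_of_int (int l - int k) * pi" by simp
    finally have "sin ((2 * real m + 1) * a / 2) = 0" by (metis sin_zero_iff_int2)
    moreover have "sin (a / 2) \<noteq> 0"
    proof
      assume "sin (a / 2) = 0"
      then obtain i :: int where "a / 2 = of_int i * pi" by (auto simp: sin_zero_iff_int2)
      then have "pi * (real l - real k) = pi * (real_of_int i * real n)"
        using npos by (simp add: a2 field_simps)
      then have "real l - real k = real_of_int i * real n" by simp
      then have "int l - int k = i * int n" by (metis (mono_tags, lifting) of_int_diff of_int_eq_iff of_int_mult of_int_of_nat_eq)
      moreover have "\<bar>int l - int k\<bar> < int n" using assms by auto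
      moreover have "i \<noteq> 0" using calculation False by auto
      moreover have "int n \<le> \<bar>i\<bar> * int n" using \<open>i \<noteq> 0\<close> by (intro mult_le_cancel_right1[THEN iffD2]) auto
      ultimately show False by (simp add: abs_mult)
    qed
    ultimately have "1 + 2 * (\<Sum>i=1..m. cos (real i * a)) = 0"
      using dirichlet_kernel[of a m] by simp
    then show ?thesis using False eq by simp
  qed
qed

lemma sum_rotate3:
  "(\<Sum>i\<in>A. \<Sum>j\<in>B. \<Sum>k\<in>C. h i j k) = (\<Sum>k\<in>C. \<Sum>i\<in>A. \<Sum>j\<in>B. h i j k)"
proof -
  have "(\<Sum>j\<in>B. \<Sum>k\<in>C. h i j k) = (\<Sum>k\<in>C. \<Sum>j\<in>B. h i j k)" for i
    by (rule sum.swap)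
  then show ?thesis by (simp only:) (rule sum.swap)
qed

text \<open>By completeness, \<open>1/n\<close> times the Gram matrix is a projection of trace \<open>n\<close>, so its
  Frobenius distance to the identity vanishes.\<close>

lemma trig_basis_orthogonal:
  assumes n: "odd n" and ij: "i \<in> {1..n}" "j \<in> {1..n}"
  shows "(\<Sum>l=1..n. trig_basis i (design n l) * trig_basis j (design n l))
    = (if i = j then real n else 0)"
proof -
  define f where "f i l = trig_basis i (design n l)" for i l
  define G where "G i j = (\<Sum>l=1..n. f i l * f j l)" for i j
  define D where "D i j = (if i = j then real n else 0)" for i j :: nat
  let ?I = "{1..n}"
  have compl: "(\<Sum>j\<in>?I. f j l * f j k) = D l k" if "l \<in> ?I" "k \<in> ?I" for l k
    using trig_basis_complete[OF n that] by (simp add: f_def D_def)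
  have "(\<Sum>i\<in>?I. \<Sum>j\<in>?I. (G i j)\<^sup>2)
      = (\<Sum>i\<in>?I. \<Sum>j\<in>?I. \<Sum>l\<in>?I. \<Sum>k\<in>?I. (f i l * f i k) * (f j l * f j k))"
    unfolding G_def power2_eq_square sum_product by (simp add: mult_ac)
  also have "\<dots> = (\<Sum>l\<in>?I. \<Sum>k\<in>?I. \<Sum>i\<in>?I. \<Sum>j\<in>?I. (f i l * f i k) * (f j l * f j k))"
    by (subst sum_rotate3) (rule sum.cong[OF refl], rule sum_rotate3)
  also have "\<dots> = (\<Sum>l\<in>?I. \<Sum>k\<in>?I. D l k * D l k)"
    by (intro sum.cong refl) (simp only: compl flip: sum_distrib_left sum_distrib_right)
  also have "\<dots> = real n ^ 3"
    by (simp add: D_def if_distrib sum.If_cases power3_eq_cube cong: if_cong)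
  finally have 1: "(\<Sum>i\<in>?I. \<Sum>j\<in>?I. (G i j)\<^sup>2) = real n ^ 3" .
  have "(\<Sum>i\<in>?I. \<Sum>j\<in>?I. G i j * D i j) = (\<Sum>i\<in>?I. real n * G i i)"
    by (simp add: D_def if_distrib mult.commute cong: if_cong)
  also have "\<dots> = real n * (\<Sum>l\<in>?I. \<Sum>i\<in>?I. f i l * f i l)"
    unfolding G_def by (subst sum.swap) (simp add: sum_distrib_left)
  also have "\<dots> = real n ^ 3"
    by (simp only: compl cong: sum.cong) (simp add: D_def power3_eq_cube)
  finally have 2: "(\<Sum>i\<in>?I. \<Sum>j\<in>?I. G i j * D i j) = real n ^ 3" .
  have 3: "(\<Sum>i\<in>?I. \<Sum>j\<in>?I. (D i j)\<^sup>2) = real n ^ 3"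
    unfolding power2_eq_square by (simp add: D_def if_distrib power3_eq_cube cong: if_cong)
  \<comment> \<open>The squared norms of \<open>G\<close> and \<open>D\<close> and their inner
    product all equal \<open>n^3\<close>, so the square expands to
    \<open>n^3 - 2 * n^3 + n^3\<close>.\<close>
  have "(\<Sum>i\<in>?I. \<Sum>j\<in>?I. (G i j - D i j)\<^sup>2) = 0"
    using 1 2 3 by (simp add: power2_diff sum.distrib sum_subtractf mult.assoc flip: sum_distrib_left)
  then have "(\<Sum>j\<in>?I. (G i j - D i j)\<^sup>2) = 0"
    using ij by (subst (asm) sum_nonneg_eq_0_iff) (auto intro: sum_nonneg)
  then have "(G i j - D i j)\<^sup>2 = 0"
    using ij by (subst (asm) sum_nonneg_eq_0_iff) auto
  then show ?thesis by (simp add: G_def D_def f_def)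
qed

section \<open>Synthesis and Parseval identity for the discrete coefficients\<close>

lemma theta_hat_add: "theta_hat n (\<lambda>l. f l + g l) j = theta_hat n f j + theta_hat n g j"
  by (simp add: theta_hat_def sum.distrib algebra_simps)

lemma theta_hat_diff: "theta_hat n (\<lambda>l. f l - g l) j = theta_hat n f j - theta_hat n g j"
  by (simp add: theta_hat_def sum_subtractf algebra_simps)

lemma theta_hat_cong:
  "(\<And>l. l \<in> {1..n} \<Longrightarrow> f l = g l) \<Longrightarrow> theta_hat n f j = theta_hat n g j"
  by (simp add: theta_hat_def)

lemma theta_hat_synthesis:
  assumes "odd n" "i \<in> {1..n}"
  shows "theta_hat n (\<lambda>l. \<Sum>j=1..n. c j * trig_basis j (design n l)) i = c i"
proof -
  have n0: "real n > 0" using assms by auto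
  have "theta_hat n (\<lambda>l. \<Sum>j=1..n. c j * trig_basis j (design n l)) i
      = (1 / real n) * (\<Sum>l=1..n. \<Sum>j=1..n. c j * (trig_basis j (design n l) * trig_basis i (design n l)))"
    by (simp add: theta_hat_def sum_distrib_right mult.assoc)
  also have "\<dots> = (1 / real n) * (\<Sum>j=1..n. c j * (if j = i then real n else 0))"
    by (subst sum.swap)
      (simp only: sum_distrib_left[symmetric] trig_basis_orthogonal[OF assms(1) _ assms(2)] cong: sum.cong)
  also have "\<dots> = c i" using assms n0 by (simp add: if_distrib cong: if_cong)
  finally show ?thesis .
qed

lemma discrete_parseval:
  assumes "odd n"
  shows "(\<Sum>j=1..n. (theta_hat n f j)\<^sup>2) = (1 / real n) * (\<Sum>l=1..n. (f l)\<^sup>2)"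
proof -
  let ?I = "{1..n}"
  have n0: "real n > 0" using assms by (auto intro: Nat.gr0I)
  have "(\<Sum>j=1..n. (theta_hat n f j)\<^sup>2)
    = (1 / (real n)\<^sup>2) * (\<Sum>j\<in>?I. \<Sum>l\<in>?I. \<Sum>k\<in>?I. f l * f k * (trig_basis j (design n l) * trig_basis j (design n k)))"
    unfolding theta_hat_def power_mult_distrib power_one_over power2_eq_square[of "sum _ _"] sum_product
    by (simp add: mult_ac flip: sum_divide_distrib)
  also have "(\<Sum>j\<in>?I. \<Sum>l\<in>?I. \<Sum>k\<in>?I. f l * f k * (trig_basis j (design n l) * trig_basis j (design n k)))
    = (\<Sum>l\<in>?I. \<Sum>k\<in>?I. f l * f k * (\<Sum>j\<in>?I. trig_basis j (design n l) * trig_basis j (design n k)))"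
    unfolding sum_distrib_left by (subst sum.swap) (rule sum.cong[OF refl], rule sum.swap)
  also have "\<dots> = (\<Sum>l\<in>?I. \<Sum>k\<in>?I. f l * f k * (if l = k then real n else 0))"
    by (intro sum.cong refl) (simp only: trig_basis_complete[OF assms])
  also have "\<dots> = real n * (\<Sum>l\<in>?I. (f l)\<^sup>2)"
    by (simp add: if_distrib power2_eq_square sum_distrib_left mult_ac cong: if_cong)
  finally show ?thesis using n0 by (simp add: power2_eq_square)
qed

text \<open>Evaluates the sums of squared noise weights met below: as functions of the design point
  those weights are trigonometric polynomials with known coefficients.\<close>

lemma discrete_parseval_synthesis:
  assumes "odd n"
  shows "(1 / real n) * (\<Sum>l=1..n. (\<Sum>j=1..n. c j * trig_basis j (design n l))\<^sup>2) = (\<Sum>j=1..n. (c j)\<^sup>2)"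
  using discrete_parseval[OF assms, of "\<lambda>l. \<Sum>j=1..n. c j * trig_basis j (design n l)"] assms
  by (simp only: theta_hat_synthesis[OF assms] cong: sum.cong)

lemma trig_basis_sq_le: "(trig_basis j x)\<^sup>2 \<le> 2"
  by (auto simp: trig_basis_def power_mult_distrib abs_square_le_1)

section \<open>Decay of the discrete Fourier coefficients\<close>

text \<open>A weak form of Jordan's inequality. Up to \<open>pi / 3\<close> the difference increases
  because the cosine is at least 1/2; beyond, the sine is at least \<open>sqrt 3 / 2\<close>, which
  exceeds \<open>pi / 4\<close>.\<close>

lemma sin_ge_half:
  assumes "0 \<le> x" "x \<le> pi / 2"
  shows "x / 2 \<le> sin x"
proof (cases "x \<le> pi / 3")
  case True
  have "sin 0 - 0 / 2 \<le> sin x - x / 2"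
  proof (rule DERIV_nonneg_imp_nondecreasing[OF assms(1)])
    fix t assume t: "0 \<le> t" "t \<le> x"
    have "1 / 2 \<le> cos t"
      using cos_monotone_0_pi_le[of t "pi / 3"] t True pi_ge_zero by (simp add: cos_60)
    moreover have "((\<lambda>t. sin t - t / 2) has_real_derivative cos t - 1 / 2) (at t)"
      by (auto intro!: derivative_eq_intros)
    ultimately show "\<exists>y. ((\<lambda>t. sin t - t / 2) has_real_derivative y) (at t) \<and> 0 \<le> y"
      by fastforce
  qed
  then show ?thesis by simp
next
  case False
  have "sqrt 3 / 2 \<le> sin x"
    using sin_monotone_2pi_le[of "pi / 3" x] False assms by (simp add: sin_60)
  moreover have "1.7 \<le> sqrt 3" by (rule real_le_rsqrt) (simp add: power2_eq_square)
  ultimately show ?thesis using assms pi_approx by simp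
qed

text \<open>Cauchy-Schwarz in the gauge integral. \<open>deriv S\<close> need not be continuous, but
  as a derivative it is gauge integrable by the fundamental theorem. Integrating
  \<open>(deriv S t - c)^2 \<ge> 0\<close> with \<open>c\<close> the mean slope then gives the bound
  without integrating any other product.\<close>

lemma sobolev_increment_bound:
  assumes S: "S \<in> sobolev_ball r" and ab: "0 \<le> a" "a < b" "b \<le> 1"
  shows "(\<lambda>t. (deriv S t)\<^sup>2) integrable_on {a..b}"
    and "(S b - S a)\<^sup>2 \<le> (b - a) * integral {a..b} (\<lambda>t. (deriv S t)\<^sup>2)"
proof -
  let ?q = "\<lambda>t. (deriv S t)\<^sup>2"
  have "?q integrable_on {0..1}"
    using S by (auto simp: sobolev_ball_def dest: set_borel_integral_eq_integral)
  then show q: "?q integrable_on {a..b}"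
    using ab by (rule_tac integrable_on_subinterval) auto
  have "(S has_real_derivative deriv S t) (at t)" for t
    using S by (simp add: sobolev_ball_def DERIV_deriv_iff_real_differentiable)
  then have ftc: "(deriv S has_integral S b - S a) {a..b}"
    using ab by (intro fundamental_theorem_of_calculus)
      (auto simp flip: has_real_derivative_iff_has_vector_derivative intro: DERIV_subset)
  define c where "c = (S b - S a) / (b - a)"
  have "((\<lambda>t. ?q t - 2 * c * deriv S t + c\<^sup>2) has_integral
      integral {a..b} ?q - 2 * c * (S b - S a) + c\<^sup>2 * (b - a)) {a..b}"
    using q ab has_integral_const_real[of "c\<^sup>2" a b]
    by (intro has_integral_add has_integral_diff has_integral_mult_right ftc integrable_integral)
       (auto simp: mult.commute)
  then have "((\<lambda>t. (deriv S t - c)\<^sup>2) has_integral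
      integral {a..b} ?q - 2 * c * (S b - S a) + c\<^sup>2 * (b - a)) {a..b}"
    by (simp add: power2_diff algebra_simps)
  then have "0 \<le> integral {a..b} ?q - 2 * c * (S b - S a) + c\<^sup>2 * (b - a)"
    by (rule has_integral_nonneg) simp
  moreover have "- 2 * (v / u) * v + (v / u)\<^sup>2 * u = - v\<^sup>2 / u" if "u > 0" for u v :: real
    using that by (simp add: power2_eq_square)
  then have "- 2 * c * (S b - S a) + c\<^sup>2 * (b - a) = - (S b - S a)\<^sup>2 / (b - a)"
    unfolding c_def using ab by (metis diff_gt_0_iff_gt)
  ultimately have "(S b - S a)\<^sup>2 / (b - a) \<le> integral {a..b} ?q" by simp
  then show "(S b - S a)\<^sup>2 \<le> (b - a) * integral {a..b} ?q"
    using ab by (simp add: field_simps)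
qed

text \<open>Each cell of length \<open>1 / n\<close> obeys the increment bound, and the integrals of
  the squared derivative over the cells add up to at most \<open>r\<close>.\<close>

lemma sobolev_discrete_energy:
  assumes S: "S \<in> sobolev_ball r" and n: "n > 0"
  shows "(\<Sum>l=1..n. (S (design n (Suc l)) - S (design n l))\<^sup>2) \<le> r / real n"
proof -
  let ?q = "\<lambda>t. (deriv S t)\<^sup>2"
  define h where "h l = (S (design n (Suc l)) - S (design n l))\<^sup>2" for l
  have per: "S (x + 1) = S x" for x using S by (simp add: sobolev_ball_def)
  have dstep: "design n (Suc l) = design n l + 1 / n" for l
    using n by (simp add: design_def field_simps)
  have int01: "?q integrable_on {0..1}"
    using S by (auto simp: sobolev_ball_def dest: set_borel_integral_eq_integral)
  have part: "m \<le> n \<Longrightarrow> (\<Sum>l<m. h l) \<le> (1 / real n) * integral {0..design n m} ?q" for m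
  proof (induction m)
    case 0
    show ?case by (simp add: design_def)
  next
    case (Suc m)
    have le: "0 \<le> design n m" "design n m < design n (Suc m)" "design n (Suc m) \<le> 1"
      using Suc.prems n by (auto simp: design_def divide_simps)
    have "h m \<le> (1 / real n) * integral {design n m..design n (Suc m)} ?q"
      using sobolev_increment_bound(2)[OF S le] by (simp add: h_def dstep)
    moreover have "integral {0..design n (Suc m)} ?q
        = integral {0..design n m} ?q + integral {design n m..design n (Suc m)} ?q"
      using le by (intro sym[OF Henstock_Kurzweil_Integration.integral_combine])
        (auto intro: integrable_on_subinterval[OF int01])
    ultimately show ?case using Suc by (simp add: distrib_left add_divide_distrib)
  qed
  \<comment> \<open>The increment with index \<open>n\<close> starts at 1 and leaves the unit
    interval; periodicity trades it for the one over the first cell.\<close>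
  have "h n = h 0"
    using per[of 0] per[of "1 / n"] n by (simp add: h_def design_def field_simps)
  then have "(\<Sum>l=1..n. h l) = (\<Sum>l<n. h l)"
    using n sum.lessThan_Suc[of h n] sum.lessThan_Suc_shift[of h n]
    by (simp add: sum.atLeast1_atMost_eq)
  also have "\<dots> \<le> (1 / real n) * integral {0..1} ?q"
    using part[of n] n by (simp add: design_def)
  also have "integral {0..1} ?q \<le> r"
  proof -
    have "0 \<le> (LINT t:{0..1}|lborel. (S t)\<^sup>2)"
      unfolding set_lebesgue_integral_def by (intro integral_nonneg_AE) auto
    moreover have "(LINT t:{0..1}|lborel. ?q t) = integral {0..1} ?q"
      using S by (intro set_borel_integral_eq_integral) (auto simp: sobolev_ball_def)
    ultimately show ?thesis using S by (simp add: sobolev_ball_def)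
  qed
  finally show ?thesis using n by (simp add: h_def divide_right_mono)
qed

text \<open>On each frequency pair, a cyclic shift of the data rotates the coefficients by the angle
  \<open>2 \<pi> k / n\<close>.\<close>

lemma theta_hat_difference_pair:
  fixes f :: "nat \<Rightarrow> real"
  assumes n: "n > 0" and k: "k > 0" and per: "f (Suc n) = f 1"
  shows "(theta_hat n (\<lambda>l. f (Suc l) - f l) (2 * k))\<^sup>2 + (theta_hat n (\<lambda>l. f (Suc l) - f l) (2 * k + 1))\<^sup>2
    = 4 * (sin (pi * real k / real n))\<^sup>2 * ((theta_hat n f (2 * k))\<^sup>2 + (theta_hat n f (2 * k + 1))\<^sup>2)"
proof -
  define a where "a = 2 * pi * real k / real n"
  define A where "A = theta_hat n f (2 * k)"
  define B where "B = theta_hat n f (2 * k + 1)"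
  have a: "2 * pi * real k * design n l = real l * a" for l
    by (simp add: design_def a_def)
  have ang: "real n * a = of_int (int k) * (2 * pi)" using n by (simp add: a_def)
  have shift: "(\<Sum>l=1..n. f (Suc l) * g (Suc l)) = (\<Sum>l=1..n. f l * g l)" if "g (Suc n) = g 1" for g :: "nat \<Rightarrow> real"
    using n per that sum.lessThan_Suc_shift[of "\<lambda>l. f (Suc l) * g (Suc l)" n]
    by (simp add: sum.atLeast1_atMost_eq)
  have phi: "trig_basis (2 * k) (design n l) = sqrt 2 * cos (real l * a)"
    "trig_basis (2 * k + 1) (design n l) = sqrt 2 * sin (real l * a)" for l
    using k by (simp_all add: trig_basis_def a)
  have unshift: "real (Suc l) * a - a = real l * a" for l by (simp add: algebra_simps)
  have A: "A = (sqrt 2 / real n) * (\<Sum>l=1..n. f l * cos (real l * a))"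
    and B: "B = (sqrt 2 / real n) * (\<Sum>l=1..n. f l * sin (real l * a))"
    unfolding A_def B_def theta_hat_def phi by (simp_all add: sum_distrib_left mult_ac)
  have "cos (real (Suc n) * a) = cos (real 1 * a)" "sin (real (Suc n) * a) = sin (real 1 * a)"
  proof -
    have "real (Suc n) * a = real 1 * a + 2 * pi * of_int (int k)"
      using ang by (simp add: algebra_simps)
    then show "cos (real (Suc n) * a) = cos (real 1 * a)" "sin (real (Suc n) * a) = sin (real 1 * a)"
      using sin_cos_eq_iff[of "real (Suc n) * a" "real 1 * a"] by blast+
  qed
  note sh = shift[of "\<lambda>l. cos (real l * a)", OF this(1)] shift[of "\<lambda>l. sin (real l * a)", OF this(2)]
  have "theta_hat n (\<lambda>l. f (Suc l)) (2 * k)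
      = (sqrt 2 / real n) * (\<Sum>l=1..n. f (Suc l) * cos (real (Suc l) * a - a))"
    unfolding theta_hat_def phi unshift by (simp add: sum_distrib_left mult_ac)
  also have "\<dots> = (sqrt 2 / real n) * (cos a * (\<Sum>l=1..n. f (Suc l) * cos (real (Suc l) * a))
      + sin a * (\<Sum>l=1..n. f (Suc l) * sin (real (Suc l) * a)))"
    unfolding cos_diff by (simp add: sum_distrib_left algebra_simps sum.distrib)
  also have "\<dots> = cos a * A + sin a * B"
    unfolding sh A B by (simp add: algebra_simps)
  finally have 1: "theta_hat n (\<lambda>l. f (Suc l) - f l) (2 * k) = (cos a - 1) * A + sin a * B"
    by (simp add: theta_hat_diff A_def algebra_simps)
  have "theta_hat n (\<lambda>l. f (Suc l)) (2 * k + 1)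
      = (sqrt 2 / real n) * (\<Sum>l=1..n. f (Suc l) * sin (real (Suc l) * a - a))"
    unfolding theta_hat_def phi unshift by (simp add: sum_distrib_left mult_ac)
  also have "\<dots> = (sqrt 2 / real n) * (cos a * (\<Sum>l=1..n. f (Suc l) * sin (real (Suc l) * a))
      - sin a * (\<Sum>l=1..n. f (Suc l) * cos (real (Suc l) * a)))"
    unfolding sin_diff by (simp add: sum_distrib_left algebra_simps sum_subtractf)
  also have "\<dots> = cos a * B - sin a * A"
    unfolding sh A B by (simp add: algebra_simps)
  finally have 2: "theta_hat n (\<lambda>l. f (Suc l) - f l) (2 * k + 1) = (cos a - 1) * B - sin a * A"
    by (simp add: theta_hat_diff B_def algebra_simps)
  \<comment> \<open>Differencing is the rotation minus the identity, which multiplies the squared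
    length of the pair by \<open>|exp(i a) - 1|^2 = 2 - 2 * cos a\<close>.\<close>
  have c: "4 * (sin (pi * real k / real n))\<^sup>2 = 2 - 2 * cos a"
    using cos_double_sin[of "pi * real k / real n"] by (simp add: a_def mult.assoc)
  have "(sin a)\<^sup>2 = 1 - (cos a)\<^sup>2" by (simp add: sin_squared_eq)
  then show ?thesis unfolding 1 2 c A_def[symmetric] B_def[symmetric] by algebra
qed

lemma sum_odd_pairs:
  "(\<Sum>j=1..2*m+1. g j) = g 1 + (\<Sum>k=1..m. g (2*k) + g (2*k+1))" for g :: "nat \<Rightarrow> real"
  by (induction m) auto

text \<open>Differencing multiplies the energy at frequency \<open>k\<close> by
  \<open>4 * sin^2 (pi * k / n)\<close>, which is at least \<open>d^2 / (4 * n^2)\<close> once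
  \<open>d \<le> 2 * k\<close>. By Parseval the differences have total energy at most
  \<open>r / n^2\<close>; the quotient is \<open>4 * r / d^2\<close>.\<close>

lemma fourier_tail_bound:
  assumes S: "S \<in> sobolev_ball r" and n: "odd n" and d: "1 \<le> d"
  shows "(\<Sum>j=d+1..n. (theta_hat n (\<lambda>l. S (design n l)) j)\<^sup>2) \<le> 4 * r / (real d)\<^sup>2"
proof -
  obtain m where m: "n = 2 * m + 1" using n oddE by blast
  define f where "f l = S (design n l)" for l
  define D where "D l = f (Suc l) - f l" for l
  define t where "t j = (theta_hat n f j)\<^sup>2" for j
  \<comment> \<open>Truncation instead of a shorter sum: for even \<open>d\<close> the cut-off falls
    between the two members of a pair, and zeroing the cosine member keeps all pairs whole.\<close>
  define b where "b j = (if d < j then t j else 0)" for j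
  have n0: "n > 0" using m by simp
  have "S (x + 1) = S x" for x using S by (simp add: sobolev_ball_def)
  from this[of "1 / n"] have per: "f (Suc n) = f 1" using n0 by (simp add: f_def design_def field_simps)
  have pair: "(real d)\<^sup>2 / (4 * (real n)\<^sup>2) * (b (2*k) + b (2*k+1))
      \<le> (theta_hat n D (2*k))\<^sup>2 + (theta_hat n D (2*k+1))\<^sup>2" if k: "k \<in> {1..m}" for k
  proof (cases "d < 2 * k + 1")
    case False
    then show ?thesis by (simp add: b_def)
  next
    case True
    then have dk: "real d \<le> 2 * real k" by linarith
    have kn: "2 * real k \<le> real n" using k m by auto
    have "pi * real k / real n \<le> pi / 2" using kn n0 by (simp add: field_simps)
    then have "(pi * real k / real n) / 2 \<le> sin (pi * real k / real n)"
      by (intro sin_ge_half) auto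
    moreover have "real d / (4 * real n) \<le> (pi * real k / real n) / 2"
    proof -
      have "real d \<le> pi * real k * 2"
        using dk mult_right_mono[of 1 pi "real k"] pi_gt3 by simp
      then show ?thesis using n0 by (simp add: field_simps)
    qed
    ultimately have "(real d / (4 * real n))\<^sup>2 \<le> (sin (pi * real k / real n))\<^sup>2"
      by (intro power_mono) auto
    then have s: "(real d)\<^sup>2 / (4 * (real n)\<^sup>2) \<le> 4 * (sin (pi * real k / real n))\<^sup>2"
      by (simp add: power_divide power_mult_distrib)
    have "(real d)\<^sup>2 / (4 * (real n)\<^sup>2) * (b (2*k) + b (2*k+1))
        \<le> 4 * (sin (pi * real k / real n))\<^sup>2 * (t (2*k) + t (2*k+1))"
      by (intro mult_mono s) (auto simp: b_def t_def)
    also have "\<dots> = (theta_hat n D (2*k))\<^sup>2 + (theta_hat n D (2*k+1))\<^sup>2"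
      using theta_hat_difference_pair[OF n0 _ per, of k] k by (simp add: D_def[abs_def] t_def)
    finally show ?thesis .
  qed
  have "(\<Sum>j=d+1..n. t j) = (\<Sum>j=1..n. b j)"
    unfolding b_def sum.inter_filter[symmetric, OF finite_atLeastAtMost] by (rule sum.cong) auto
  also have "\<dots> = (\<Sum>k=1..m. b (2*k) + b (2*k+1))"
    unfolding m using d sum_odd_pairs[of b m] by (simp add: b_def)
  finally have "(real d)\<^sup>2 / (4 * (real n)\<^sup>2) * (\<Sum>j=d+1..n. t j)
      = (\<Sum>k=1..m. (real d)\<^sup>2 / (4 * (real n)\<^sup>2) * (b (2*k) + b (2*k+1)))"
    by (simp add: sum_distrib_left)
  also have "\<dots> \<le> (\<Sum>k=1..m. (theta_hat n D (2*k))\<^sup>2 + (theta_hat n D (2*k+1))\<^sup>2)"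
    by (intro sum_mono pair)
  also have "\<dots> \<le> (\<Sum>j=1..n. (theta_hat n D j)\<^sup>2)"
    unfolding m using sum_odd_pairs[of "\<lambda>j. (theta_hat (2*m+1) D j)\<^sup>2" m] by simp
  also have "\<dots> = (1 / real n) * (\<Sum>l=1..n. (D l)\<^sup>2)" by (rule discrete_parseval[OF n])
  also have "\<dots> \<le> (1 / real n) * (r / real n)"
    using sobolev_discrete_energy[OF S n0] by (intro mult_left_mono) (auto simp: D_def f_def)
  finally have "(real d)\<^sup>2 * (\<Sum>j=d+1..n. t j) \<le> 4 * r"
    using n0 by (simp add: power2_eq_square field_simps)
  then show ?thesis using d by (simp add: t_def f_def[abs_def] field_simps)
qed

section \<open>Quadratic forms in independent noise\<close>

text \<open>Jensen's inequality, read off from the nonnegative variance of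
  \<open>|Z|\<close>.\<close>

lemma (in prob_space) expectation_abs_le_sqrt:
  fixes Z :: "'a \<Rightarrow> real"
  assumes [measurable]: "random_variable borel Z" and int: "integrable M (\<lambda>\<omega>. (Z \<omega>)\<^sup>2)"
    and le: "expectation (\<lambda>\<omega>. (Z \<omega>)\<^sup>2) \<le> c"
  shows "integrable M (\<lambda>\<omega>. \<bar>Z \<omega>\<bar>)" "expectation (\<lambda>\<omega>. \<bar>Z \<omega>\<bar>) \<le> sqrt c"
proof -
  have i: "integrable M Z" using square_integrable_imp_integrable[OF assms(1) int] .
  then show i': "integrable M (\<lambda>\<omega>. \<bar>Z \<omega>\<bar>)" by simp
  have "0 \<le> variance (\<lambda>\<omega>. \<bar>Z \<omega>\<bar>)" by (rule variance_positive)
  also have "\<dots> = expectation (\<lambda>\<omega>. (Z \<omega>)\<^sup>2) - (expectation (\<lambda>\<omega>. \<bar>Z \<omega>\<bar>))\<^sup>2"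
    using variance_eq[OF i'] int by simp
  finally show "expectation (\<lambda>\<omega>. \<bar>Z \<omega>\<bar>) \<le> sqrt c"
    using le by (intro real_le_rsqrt) linarith
qed

lemma expectation_square_sum:
  fixes X :: "'b \<Rightarrow> 'a \<Rightarrow> real"
  assumes "\<And>p q. p \<in> P \<Longrightarrow> q \<in> P \<Longrightarrow> integrable M (\<lambda>\<omega>. X p \<omega> * X q \<omega>)"
  shows "integrable M (\<lambda>\<omega>. (\<Sum>p\<in>P. a p * X p \<omega>)\<^sup>2)"
    and "(\<integral>\<omega>. (\<Sum>p\<in>P. a p * X p \<omega>)\<^sup>2 \<partial>M) = (\<Sum>p\<in>P. \<Sum>q\<in>P. a p * a q * (\<integral>\<omega>. X p \<omega> * X q \<omega> \<partial>M))"
proof -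
  have eq: "(\<Sum>p\<in>P. a p * X p \<omega>)\<^sup>2 = (\<Sum>p\<in>P. \<Sum>q\<in>P. a p * a q * (X p \<omega> * X q \<omega>))" for \<omega>
    unfolding power2_eq_square sum_product by (simp add: mult_ac)
  show "integrable M (\<lambda>\<omega>. (\<Sum>p\<in>P. a p * X p \<omega>)\<^sup>2)"
    unfolding eq by (intro Bochner_Integration.integrable_sum integrable_mult_right assms)
  show "(\<integral>\<omega>. (\<Sum>p\<in>P. a p * X p \<omega>)\<^sup>2 \<partial>M) = (\<Sum>p\<in>P. \<Sum>q\<in>P. a p * a q * (\<integral>\<omega>. X p \<omega> * X q \<omega> \<partial>M))"
    unfolding eq
    by (subst Bochner_Integration.integral_sum, intro Bochner_Integration.integrable_sum integrable_mult_right assms)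
      (auto intro!: sum.cong simp: assms)
qed

section \<open>Second moments of linear and quadratic forms in the noise\<close>

locale noise = prob_space M for M :: "'a measure" +
  fixes I :: "nat set" and \<epsilon> :: "nat \<Rightarrow> 'a \<Rightarrow> real" and \<mu>4 :: real
  assumes fin: "finite I"
    and indep: "indep_vars (\<lambda>_. borel) \<epsilon> I"
    and fourth_integrable: "\<And>i. i \<in> I \<Longrightarrow> integrable M (\<lambda>\<omega>. \<epsilon> i \<omega> ^ 4)"
    and mean: "\<And>i. i \<in> I \<Longrightarrow> expectation (\<epsilon> i) = 0"
    and var: "\<And>i. i \<in> I \<Longrightarrow> expectation (\<lambda>\<omega>. (\<epsilon> i \<omega>)\<^sup>2) = 1"
    and fourth: "\<And>i. i \<in> I \<Longrightarrow> expectation (\<lambda>\<omega>. \<epsilon> i \<omega> ^ 4) = \<mu>4"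
begin

lemma noise_measurable[measurable]: "i \<in> I \<Longrightarrow> random_variable borel (\<epsilon> i)"
  using indep by (simp add: indep_vars_def)

lemma integrable_noise_power:
  assumes "i \<in> I" "m \<le> 4"
  shows "integrable M (\<lambda>\<omega>. \<epsilon> i \<omega> ^ m)"
proof (rule Bochner_Integration.integrable_bound)
  show "integrable M (\<lambda>\<omega>. 1 + \<epsilon> i \<omega> ^ 4)" using assms fourth_integrable by simp
  have "\<bar>x\<bar> ^ m \<le> 1 + \<bar>x\<bar> ^ 4" for x :: real
  proof (cases "\<bar>x\<bar> \<le> 1")
    case True
    then have "\<bar>x\<bar> ^ m \<le> 1" by (intro power_le_one) auto
    then show ?thesis by (simp add: add_increasing2)
  next
    case False
    then have "\<bar>x\<bar> ^ m \<le> \<bar>x\<bar> ^ 4" using assms by (intro power_increasing) auto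
    then show ?thesis by simp
  qed
  then show "AE \<omega> in M. norm (\<epsilon> i \<omega> ^ m) \<le> norm (1 + \<epsilon> i \<omega> ^ 4)"
    by (auto simp: power_abs)
qed (use assms in measurable)

lemma noise_monomial:
  assumes m: "\<And>i. i \<in> I \<Longrightarrow> m i \<le> 4"
  shows "integrable M (\<lambda>\<omega>. \<Prod>i\<in>I. \<epsilon> i \<omega> ^ m i)"
    and "expectation (\<lambda>\<omega>. \<Prod>i\<in>I. \<epsilon> i \<omega> ^ m i) = (\<Prod>i\<in>I. expectation (\<lambda>\<omega>. \<epsilon> i \<omega> ^ m i))"
proof -
  have "indep_vars (\<lambda>_. borel) (\<lambda>i \<omega>. \<epsilon> i \<omega> ^ m i) I"
    using indep by (rule indep_vars_compose2) auto
  then show "integrable M (\<lambda>\<omega>. \<Prod>i\<in>I. \<epsilon> i \<omega> ^ m i)"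
    and "expectation (\<lambda>\<omega>. \<Prod>i\<in>I. \<epsilon> i \<omega> ^ m i) = (\<Prod>i\<in>I. expectation (\<lambda>\<omega>. \<epsilon> i \<omega> ^ m i))"
    using fin integrable_noise_power m
    by (auto intro: indep_vars_integrable indep_vars_lebesgue_integral)
qed

lemma prod_power_indicator: "i \<in> I \<Longrightarrow> (\<Prod>t\<in>I. f t ^ of_bool (t = i)) = f i" for f :: "nat \<Rightarrow> real"
proof -
  assume "i \<in> I"
  have "(\<Prod>t\<in>I. f t ^ of_bool (t = i)) = (\<Prod>t\<in>I. if t = i then f t else 1)"
    by (intro prod.cong) auto
  with \<open>i \<in> I\<close> fin show ?thesis by simp
qed

text \<open>The indices may coincide, so independence does not apply to the four factors as they
  stand. Collecting the multiplicities \<open>m t\<close> turns the product into a monomial over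
  distinct variables, whose expectation factors; an exponent 1 contributes the mean zero, an
  exponent 2 the unit variance.\<close>

lemma noise_product4:
  assumes I: "i \<in> I" "j \<in> I" "k \<in> I" "l \<in> I"
  defines "m \<equiv> \<lambda>t. of_bool (t = i) + of_bool (t = j) + of_bool (t = k) + (of_bool (t = l) :: nat)"
  shows "integrable M (\<lambda>\<omega>. \<epsilon> i \<omega> * \<epsilon> j \<omega> * \<epsilon> k \<omega> * \<epsilon> l \<omega>)"
    and "(\<And>t. t \<in> I \<Longrightarrow> m t = 0 \<or> m t = 2) \<Longrightarrow> expectation (\<lambda>\<omega>. \<epsilon> i \<omega> * \<epsilon> j \<omega> * \<epsilon> k \<omega> * \<epsilon> l \<omega>) = 1"
    and "\<exists>t\<in>I. m t = 1 \<Longrightarrow> expectation (\<lambda>\<omega>. \<epsilon> i \<omega> * \<epsilon> j \<omega> * \<epsilon> k \<omega> * \<epsilon> l \<omega>) = 0"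
proof -
  have eq: "\<epsilon> i \<omega> * \<epsilon> j \<omega> * \<epsilon> k \<omega> * \<epsilon> l \<omega> = (\<Prod>t\<in>I. \<epsilon> t \<omega> ^ m t)" for \<omega>
    using I by (simp add: m_def power_add prod.distrib prod_power_indicator)
  have m4: "m t \<le> 4" for t by (simp add: m_def)
  note mono = noise_monomial[of m, OF m4]
  show "integrable M (\<lambda>\<omega>. \<epsilon> i \<omega> * \<epsilon> j \<omega> * \<epsilon> k \<omega> * \<epsilon> l \<omega>)"
    unfolding eq by (rule mono)
  show "expectation (\<lambda>\<omega>. \<epsilon> i \<omega> * \<epsilon> j \<omega> * \<epsilon> k \<omega> * \<epsilon> l \<omega>) = 1" if "\<And>t. t \<in> I \<Longrightarrow> m t = 0 \<or> m t = 2"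
    unfolding eq mono(2)
  proof (intro prod.neutral ballI)
    fix t assume "t \<in> I"
    with that[of t] var[of t] show "expectation (\<lambda>\<omega>. \<epsilon> t \<omega> ^ m t) = 1" by (auto simp: prob_space)
  qed
  show "expectation (\<lambda>\<omega>. \<epsilon> i \<omega> * \<epsilon> j \<omega> * \<epsilon> k \<omega> * \<epsilon> l \<omega>) = 0" if "\<exists>t\<in>I. m t = 1"
  proof -
    from that obtain t where "t \<in> I" "m t = 1" by blast
    then have "expectation (\<lambda>\<omega>. \<epsilon> t \<omega> ^ m t) = 0" by (simp add: mean)
    with \<open>t \<in> I\<close> fin show ?thesis unfolding eq mono(2) by (intro prod_zero) auto
  qed
qed

lemma noise_product2:
  assumes "i \<in> I" "j \<in> I"
  shows "integrable M (\<lambda>\<omega>. \<epsilon> i \<omega> * \<epsilon> j \<omega>)"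
    and "expectation (\<lambda>\<omega>. \<epsilon> i \<omega> * \<epsilon> j \<omega>) = (if i = j then 1 else 0)"
proof -
  define m where "m = (\<lambda>t. of_bool (t = i) + (of_bool (t = j) :: nat))"
  have eq: "\<epsilon> i \<omega> * \<epsilon> j \<omega> = (\<Prod>t\<in>I. \<epsilon> t \<omega> ^ m t)" for \<omega>
    using assms by (simp add: m_def power_add prod.distrib prod_power_indicator)
  have m4: "m t \<le> 4" for t by (simp add: m_def)
  note mono = noise_monomial[of m, OF m4]
  show "integrable M (\<lambda>\<omega>. \<epsilon> i \<omega> * \<epsilon> j \<omega>)"
    unfolding eq by (rule mono)
  show "expectation (\<lambda>\<omega>. \<epsilon> i \<omega> * \<epsilon> j \<omega>) = (if i = j then 1 else 0)"
  proof (cases "i = j")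
    case True
    then show ?thesis using var[OF assms(1)] by (simp add: power2_eq_square)
  next
    case False
    have "\<exists>t\<in>I. expectation (\<lambda>\<omega>. \<epsilon> t \<omega> ^ m t) = 0"
      using assms mean[of i] False by (intro bexI[of _ i]) (auto simp: m_def)
    then show ?thesis unfolding eq mono(2) using fin False prod_zero by auto
  qed
qed

lemma expectation_linear_sq:
  shows "integrable M (\<lambda>\<omega>. (\<Sum>i\<in>I. a i * \<epsilon> i \<omega>)\<^sup>2)"
    and "expectation (\<lambda>\<omega>. (\<Sum>i\<in>I. a i * \<epsilon> i \<omega>)\<^sup>2) = (\<Sum>i\<in>I. (a i)\<^sup>2)"
proof -
  show "integrable M (\<lambda>\<omega>. (\<Sum>i\<in>I. a i * \<epsilon> i \<omega>)\<^sup>2)"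
    by (rule expectation_square_sum) (rule noise_product2)
  have "expectation (\<lambda>\<omega>. (\<Sum>i\<in>I. a i * \<epsilon> i \<omega>)\<^sup>2) = (\<Sum>i\<in>I. \<Sum>j\<in>I. a i * a j * (if i = j then 1 else 0))"
    by (subst expectation_square_sum) (auto simp: noise_product2 intro!: sum.cong)
  then show "expectation (\<lambda>\<omega>. (\<Sum>i\<in>I. a i * \<epsilon> i \<omega>)\<^sup>2) = (\<Sum>i\<in>I. (a i)\<^sup>2)"
    using fin by (simp add: if_distrib power2_eq_square cong: if_cong)
qed

text \<open>The centered squares are uncorrelated with variance \<open>\<mu>4 - 1\<close>. Dropping
  the \<open>- 1\<close> gives the form in which the fourth moment enters the constants.\<close>

lemma expectation_diagonal_sq:
  shows "integrable M (\<lambda>\<omega>. (\<Sum>i\<in>I. a i * ((\<epsilon> i \<omega>)\<^sup>2 - 1))\<^sup>2)"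
    and "expectation (\<lambda>\<omega>. (\<Sum>i\<in>I. a i * ((\<epsilon> i \<omega>)\<^sup>2 - 1))\<^sup>2) \<le> \<mu>4 * (\<Sum>i\<in>I. (a i)\<^sup>2)"
proof -
  have eq: "((\<epsilon> i \<omega>)\<^sup>2 - 1) * ((\<epsilon> j \<omega>)\<^sup>2 - 1)
      = \<epsilon> i \<omega> * \<epsilon> i \<omega> * \<epsilon> j \<omega> * \<epsilon> j \<omega> - (\<epsilon> i \<omega>)\<^sup>2 - (\<epsilon> j \<omega>)\<^sup>2 + 1" for i j \<omega>
    by (simp add: power2_eq_square algebra_simps)
  have sq: "i \<in> I \<Longrightarrow> integrable M (\<lambda>\<omega>. (\<epsilon> i \<omega>)\<^sup>2)" for i
    by (rule integrable_noise_power) auto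
  have int: "integrable M (\<lambda>\<omega>. ((\<epsilon> i \<omega>)\<^sup>2 - 1) * ((\<epsilon> j \<omega>)\<^sup>2 - 1))" if "i \<in> I" "j \<in> I" for i j
    unfolding eq using that noise_product4(1)[of i i j j] sq by auto
  have E: "expectation (\<lambda>\<omega>. ((\<epsilon> i \<omega>)\<^sup>2 - 1) * ((\<epsilon> j \<omega>)\<^sup>2 - 1)) = (if i = j then \<mu>4 - 1 else 0)"
    if "i \<in> I" "j \<in> I" for i j
  proof -
    have "expectation (\<lambda>\<omega>. ((\<epsilon> i \<omega>)\<^sup>2 - 1) * ((\<epsilon> j \<omega>)\<^sup>2 - 1))
        = expectation (\<lambda>\<omega>. \<epsilon> i \<omega> * \<epsilon> i \<omega> * \<epsilon> j \<omega> * \<epsilon> j \<omega>) - 1"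
      unfolding eq using that noise_product4(1)[of i i j j] sq var by (simp add: prob_space)
    moreover have "expectation (\<lambda>\<omega>. \<epsilon> i \<omega> * \<epsilon> i \<omega> * \<epsilon> j \<omega> * \<epsilon> j \<omega>) = (if i = j then \<mu>4 else 1)"
    proof (cases "i = j")
      case True
      then show ?thesis using fourth[OF that(1)] by (simp add: power4_eq_xxxx)
    next
      case False
      then show ?thesis using noise_product4(2)[of i i j j] that by auto
    qed
    ultimately show ?thesis by simp
  qed
  show "integrable M (\<lambda>\<omega>. (\<Sum>i\<in>I. a i * ((\<epsilon> i \<omega>)\<^sup>2 - 1))\<^sup>2)"
    by (rule expectation_square_sum) (rule int)
  have "expectation (\<lambda>\<omega>. (\<Sum>i\<in>I. a i * ((\<epsilon> i \<omega>)\<^sup>2 - 1))\<^sup>2)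
      = (\<Sum>i\<in>I. \<Sum>j\<in>I. a i * a j * (if i = j then \<mu>4 - 1 else 0))"
    by (subst expectation_square_sum) (auto simp: int E intro!: sum.cong)
  also have "\<dots> = (\<mu>4 - 1) * (\<Sum>i\<in>I. (a i)\<^sup>2)"
    using fin by (simp add: if_distrib power2_eq_square sum_distrib_left mult_ac cong: if_cong)
  also have "\<dots> \<le> \<mu>4 * (\<Sum>i\<in>I. (a i)\<^sup>2)"
    by (intro mult_right_mono sum_nonneg) auto
  finally show "expectation (\<lambda>\<omega>. (\<Sum>i\<in>I. a i * ((\<epsilon> i \<omega>)\<^sup>2 - 1))\<^sup>2) \<le> \<mu>4 * (\<Sum>i\<in>I. (a i)\<^sup>2)" .
qed

text \<open>Products over ordered pairs of distinct indices are orthonormal except that a pair and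
  its swap are the same variable. With symmetric coefficients each square is therefore counted
  twice.\<close>

lemma expectation_offdiagonal_sq:
  assumes sym: "\<And>i k. i \<in> I \<Longrightarrow> k \<in> I \<Longrightarrow> b i k = b k i"
  shows "integrable M (\<lambda>\<omega>. (\<Sum>i\<in>I. \<Sum>k\<in>I-{i}. b i k * (\<epsilon> i \<omega> * \<epsilon> k \<omega>))\<^sup>2)"
    and "expectation (\<lambda>\<omega>. (\<Sum>i\<in>I. \<Sum>k\<in>I-{i}. b i k * (\<epsilon> i \<omega> * \<epsilon> k \<omega>))\<^sup>2)
      = 2 * (\<Sum>i\<in>I. \<Sum>k\<in>I-{i}. (b i k)\<^sup>2)"
proof -
  define P where "P = Sigma I (\<lambda>i. I - {i})"
  define X where "X p \<omega> = \<epsilon> (fst p) \<omega> * \<epsilon> (snd p) \<omega>" for p \<omega>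
  define c where "c p = b (fst p) (snd p)" for p
  have finP: "finite P" using fin by (simp add: P_def)
  have eq: "(\<Sum>i\<in>I. \<Sum>k\<in>I-{i}. b i k * (\<epsilon> i \<omega> * \<epsilon> k \<omega>)) = (\<Sum>p\<in>P. c p * X p \<omega>)" for \<omega>
    using fin by (simp add: P_def X_def c_def sum.Sigma case_prod_unfold)
  have int: "integrable M (\<lambda>\<omega>. X p \<omega> * X q \<omega>)" if "p \<in> P" "q \<in> P" for p q
    using noise_product4(1)[of "fst p" "snd p" "fst q" "snd q"] that
    by (auto simp: P_def X_def mult.assoc)
  have E: "expectation (\<lambda>\<omega>. X p \<omega> * X q \<omega>)
      = (if q = p then 1 else 0) + (if q = prod.swap p then 1 else 0)" if "p \<in> P" "q \<in> P" for p q
  proof -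
    obtain i j k l where pq: "p = (i, j)" "q = (k, l)" by (metis surj_pair)
    then have I: "i \<in> I" "j \<in> I" "k \<in> I" "l \<in> I" and ne: "i \<noteq> j" "k \<noteq> l"
      using that by (auto simp: P_def)
    note p4 = noise_product4[OF I]
    have X: "X p \<omega> * X q \<omega> = \<epsilon> i \<omega> * \<epsilon> j \<omega> * \<epsilon> k \<omega> * \<epsilon> l \<omega>" for \<omega>
      by (simp add: X_def pq)
    show ?thesis
    proof (cases "q = p \<or> q = prod.swap p")
      case True
      then show ?thesis unfolding X by (subst p4(2)) (use ne pq in auto)
    next
      case False
      \<comment> \<open>The unordered pairs differ, so some index of the first is missing from the
        second; it occurs exactly once in the product, and its mean zero kills the
        expectation.\<close>
      have "\<exists>t\<in>{i,j}. t \<noteq> k \<and> t \<noteq> l" using False ne pq by auto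
      then show ?thesis unfolding X by (subst p4(3)) (use False ne pq I in auto)
    qed
  qed
  show "integrable M (\<lambda>\<omega>. (\<Sum>i\<in>I. \<Sum>k\<in>I-{i}. b i k * (\<epsilon> i \<omega> * \<epsilon> k \<omega>))\<^sup>2)"
    unfolding eq by (rule expectation_square_sum) (rule int)
  have "expectation (\<lambda>\<omega>. (\<Sum>i\<in>I. \<Sum>k\<in>I-{i}. b i k * (\<epsilon> i \<omega> * \<epsilon> k \<omega>))\<^sup>2)
      = (\<Sum>p\<in>P. \<Sum>q\<in>P. c p * c q * ((if q = p then 1 else 0) + (if q = prod.swap p then 1 else 0)))"
    unfolding eq by (subst expectation_square_sum) (auto simp: int E intro!: sum.cong)
  also have "\<dots> = (\<Sum>p\<in>P. c p * c p + c p * c (prod.swap p))"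
  proof (rule sum.cong[OF refl])
    fix p assume "p \<in> P"
    then have "prod.swap p \<in> P" by (auto simp: P_def)
    moreover have "c p * c q * ((if q = p then 1 else 0) + (if q = prod.swap p then 1 else 0))
        = (if q = p then c p * c q else 0) + (if q = prod.swap p then c p * c q else 0)" for q
      by simp
    ultimately show "(\<Sum>q\<in>P. c p * c q * ((if q = p then 1 else 0) + (if q = prod.swap p then 1 else 0)))
        = c p * c p + c p * c (prod.swap p)"
      using \<open>p \<in> P\<close> finP by (simp only: sum.distrib) simp
  qed
  also have "\<dots> = (\<Sum>p\<in>P. 2 * (c p)\<^sup>2)"
    by (rule sum.cong) (auto simp: c_def P_def power2_eq_square sym)
  also have "\<dots> = 2 * (\<Sum>i\<in>I. \<Sum>k\<in>I-{i}. (b i k)\<^sup>2)"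
    using fin by (simp add: P_def c_def sum.Sigma case_prod_unfold sum_distrib_left)
  finally show "expectation (\<lambda>\<omega>. (\<Sum>i\<in>I. \<Sum>k\<in>I-{i}. b i k * (\<epsilon> i \<omega> * \<epsilon> k \<omega>))\<^sup>2)
      = 2 * (\<Sum>i\<in>I. \<Sum>k\<in>I-{i}. (b i k)\<^sup>2)" .
qed

end

text \<open>Replaces conditioning on \<open>X\<close>: the joint law is a product, so
  \<open>Y\<close> may be averaged separately with \<open>X\<close> frozen. The nonnegative integral
  presupposes no integrability, which for the loss and the remainder is itself derived from this
  identity.\<close>

lemma (in prob_space) nn_integral_indep_var:
  assumes indep: "indep_var A X B Y" and f[measurable]: "f \<in> borel_measurable (A \<Otimes>\<^sub>M B)"
  shows "(\<integral>\<^sup>+\<omega>. f (X \<omega>, Y \<omega>) \<partial>M) = (\<integral>\<^sup>+\<omega>. \<integral>\<^sup>+\<omega>'. f (X \<omega>, Y \<omega>') \<partial>M \<partial>M)"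
proof -
  have [measurable]: "random_variable A X" "random_variable B Y"
    and eq: "distr M A X \<Otimes>\<^sub>M distr M B Y = distr M (A \<Otimes>\<^sub>M B) (\<lambda>\<omega>. (X \<omega>, Y \<omega>))"
    using indep by (auto simp: indep_var_distribution_eq)
  interpret Y: prob_space "distr M B Y" by (rule prob_space_distr) measurable
  have "(\<integral>\<^sup>+\<omega>. f (X \<omega>, Y \<omega>) \<partial>M) = (\<integral>\<^sup>+z. f z \<partial>(distr M A X \<Otimes>\<^sub>M distr M B Y))"
    unfolding eq by (subst nn_integral_distr) auto
  also have "\<dots> = (\<integral>\<^sup>+x. \<integral>\<^sup>+y. f (x, y) \<partial>distr M B Y \<partial>distr M A X)"
    by (rule Y.nn_integral_fst[symmetric]) (simp add: measurable_def space_pair_measure)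
  also have "\<dots> = (\<integral>\<^sup>+\<omega>. \<integral>\<^sup>+y. f (X \<omega>, y) \<partial>distr M B Y \<partial>M)"
    by (subst nn_integral_distr) auto
  also have "\<dots> = (\<integral>\<^sup>+\<omega>. \<integral>\<^sup>+\<omega>'. f (X \<omega>, Y \<omega>') \<partial>M \<partial>M)"
    by (intro nn_integral_cong) (subst nn_integral_distr, auto dest: measurable_space[OF \<open>random_variable A X\<close>])
  finally show ?thesis .
qed

section \<open>The loss and its penalized cost\<close>

lemma v_const_upper:
  assumes "finite L" "w \<in> L"
  shows "(\<Sum>j=1..n. w j) \<le> v_const n L"
  unfolding v_const_def using assms by (intro Max_ge) auto

lemma u_const_upper:
  assumes "finite L" "w \<in> L" "l \<in> {1..n}"
  shows "\<bar>\<Sum>j=1..n. w j ^ i * ((trig_basis j (design n l))\<^sup>2 - 1)\<bar> \<le> u_const i n L"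
proof -
  have "\<bar>\<Sum>j=1..n. w j ^ i * ((trig_basis j (design n l))\<^sup>2 - 1)\<bar>
      \<le> (MAX l\<in>{1..n}. \<bar>\<Sum>j=1..n. w j ^ i * ((trig_basis j (design n l))\<^sup>2 - 1)\<bar>)"
    using assms by (intro Max_ge) auto
  also have "\<dots> \<le> u_const i n L"
    unfolding u_const_def using assms by (intro Max_ge) auto
  finally show ?thesis .
qed

text \<open>The signal values at the \<open>n\<close> design points have exactly \<open>n\<close>
  discrete coefficients, so no approximation error separates the loss from its coefficient
  form.\<close>

lemma empirical_loss_eq:
  assumes n: "odd n"
  shows "empirical_norm_sq n (\<lambda>x. S_hat n y w x - S x)
    = (\<Sum>j=1..n. (w j * theta_hat n y j - theta_hat n (\<lambda>l. S (design n l)) j)\<^sup>2)"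
proof -
  have "empirical_norm_sq n (\<lambda>x. S_hat n y w x - S x)
    = (\<Sum>j=1..n. (theta_hat n (\<lambda>l. S_hat n y w (design n l) - S (design n l)) j)\<^sup>2)"
    by (simp only: discrete_parseval[OF n]) (simp add: empirical_norm_sq_def empirical_inner_def power2_eq_square)
  also have "\<dots> = (\<Sum>j=1..n. (w j * theta_hat n y j - theta_hat n (\<lambda>l. S (design n l)) j)\<^sup>2)"
    by (intro sum.cong refl) (simp only: theta_hat_diff S_hat_def theta_hat_synthesis[OF n])
  finally show ?thesis .
qed

text \<open>Division by \<open>t = 0\<close> yields \<open>0\<close>; then \<open>a = 0\<close> keeps the bound valid.\<close>

lemma two_abs_le:
  fixes a t \<rho> :: real
  assumes "0 < \<rho>" "0 \<le> t" "t = 0 \<Longrightarrow> a = 0"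
  shows "2 * \<bar>a\<bar> \<le> \<rho> * t + a\<^sup>2 / (\<rho> * t)"
proof (cases "t = 0")
  case False
  then have p: "\<rho> * t > 0" using assms by simp
  have "(u - b)\<^sup>2 / u = u + b\<^sup>2 / u - 2 * b" if "u > 0" for u b :: real
    using that by (simp add: power2_eq_square field_simps)
  from this[OF p, of "\<bar>a\<bar>"] have "\<rho> * t + a\<^sup>2 / (\<rho> * t) - 2 * \<bar>a\<bar> = (\<rho> * t - \<bar>a\<bar>)\<^sup>2 / (\<rho> * t)"
    by simp
  also have "\<dots> \<ge> 0" using p by simp
  finally show ?thesis by simp
qed (use assms in auto)

text \<open>Everything here is deterministic: \<open>f\<close> holds the signal values at the design
  points, and the arguments \<open>s\<close> and \<open>x\<close> below are single realizations of
  the noise levels and of the noise.\<close>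

locale regression =
  fixes n :: nat and f :: "nat \<Rightarrow> real"
  assumes odd: "odd n"
begin

definition \<phi> :: "nat \<Rightarrow> nat \<Rightarrow> real" where
  "\<phi> j l = trig_basis j (design n l)"

definition \<theta> :: "nat \<Rightarrow> real" where
  "\<theta> j = theta_hat n f j"

definition data :: "(nat \<Rightarrow> real) \<Rightarrow> (nat \<Rightarrow> real) \<Rightarrow> nat \<Rightarrow> real" where
  "data s x l = f l + s l * x l"

definition coeff_err :: "(nat \<Rightarrow> real) \<Rightarrow> (nat \<Rightarrow> real) \<Rightarrow> nat \<Rightarrow> real" where
  "coeff_err s x j = theta_hat n (\<lambda>l. s l * x l) j"

definition loss :: "(nat \<Rightarrow> real) \<Rightarrow> (nat \<Rightarrow> real) \<Rightarrow> (nat \<Rightarrow> real) \<Rightarrow> real" where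
  "loss s x w = (\<Sum>j=1..n. (w j * theta_hat n (data s x) j - \<theta> j)\<^sup>2)"

definition mean_var :: "(nat \<Rightarrow> real) \<Rightarrow> real" where
  "mean_var s = (1 / real n) * (\<Sum>l=1..n. (s l)\<^sup>2)"

text \<open>\<open>n\<close> times the variance of \<open>coeff_err s x j\<close> when
  \<open>x\<close> is white noise of unit variance.\<close>

definition coeff_var :: "(nat \<Rightarrow> real) \<Rightarrow> nat \<Rightarrow> real" where
  "coeff_var s j = (1 / real n) * (\<Sum>l=1..n. (s l)\<^sup>2 * (\<phi> j l)\<^sup>2)"

text \<open>\<open>n\<close> times the smoothing matrix: the estimate with weights \<open>w\<close>
  at design point \<open>l\<close> is the average over \<open>k\<close> of
  \<open>kernel w l k\<close> times the data.\<close>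

definition kernel :: "(nat \<Rightarrow> real) \<Rightarrow> nat \<Rightarrow> nat \<Rightarrow> real" where
  "kernel w l k = (\<Sum>j=1..n. w j * (\<phi> j l * \<phi> j k))"

definition lin_part :: "(nat \<Rightarrow> real) \<Rightarrow> (nat \<Rightarrow> real) \<Rightarrow> (nat \<Rightarrow> real) \<Rightarrow> real" where
  "lin_part s x z = (\<Sum>j=1..n. z j * \<theta> j * coeff_err s x j)"

definition diag_part :: "(nat \<Rightarrow> real) \<Rightarrow> (nat \<Rightarrow> real) \<Rightarrow> (nat \<Rightarrow> real) \<Rightarrow> real" where
  "diag_part s x w = (\<Sum>l=1..n. ((s l)\<^sup>2 * kernel w l l / real n) * ((x l)\<^sup>2 - 1))"

definition offdiag_part :: "(nat \<Rightarrow> real) \<Rightarrow> (nat \<Rightarrow> real) \<Rightarrow> (nat \<Rightarrow> real) \<Rightarrow> real" where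
  "offdiag_part s x w =
    (\<Sum>l=1..n. \<Sum>k\<in>{1..n}-{l}. (s l * s k * kernel w l k / real n) * (x l * x k))"

text \<open>Up to the factor \<open>B / n\<close>, a bound for the variance of
  \<open>lin_part\<close> with the same weights; it is the normalizer of the linear forms.\<close>

definition signal_sq :: "(nat \<Rightarrow> real) \<Rightarrow> real" where
  "signal_sq z = (\<Sum>j=1..n. (z j)\<^sup>2 * (\<theta> j)\<^sup>2)"

text \<open>\<open>penalty_hat\<close> with the estimated variance replaced by the mean variance. It
  also normalizes the square of the off-diagonal form.\<close>

definition penalty :: "(nat \<Rightarrow> real) \<Rightarrow> (nat \<Rightarrow> real) \<Rightarrow> real" where
  "penalty s w = (\<Sum>j=1..n. (w j)\<^sup>2) * mean_var s / real n"

lemma n_pos: "real n > 0"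
  using odd by (auto intro: Nat.gr0I)

lemma theta_hat_data: "theta_hat n (data s x) j = \<theta> j + coeff_err s x j"
  unfolding data_def \<theta>_def coeff_err_def by (rule theta_hat_add)

lemma phi_sq_le: "(\<phi> j l)\<^sup>2 \<le> 2"
  by (simp add: \<phi>_def trig_basis_sq_le)

lemma phi_sq_sum: "l \<in> {1..n} \<Longrightarrow> (\<Sum>j=1..n. (\<phi> j l)\<^sup>2) = real n"
  using trig_basis_complete[OF odd, of l l] by (simp add: \<phi>_def power2_eq_square)

lemma kernel_sym: "kernel w l k = kernel w k l"
  by (simp add: kernel_def mult.commute)

text \<open>A row of the kernel is a trigonometric polynomial with coefficients
  \<open>w j * \<phi> j l\<close>; Parseval applies, and the factor 2 bounds the squared basis
  functions.\<close>

lemma kernel_sq_sum: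
  "(\<Sum>k=1..n. (kernel w l k)\<^sup>2) \<le> 2 * real n * (\<Sum>j=1..n. (w j)\<^sup>2)"
proof -
  have "(1 / real n) * (\<Sum>k=1..n. (kernel w l k)\<^sup>2) = (\<Sum>j=1..n. (w j * \<phi> j l)\<^sup>2)"
    using discrete_parseval_synthesis[OF odd, of "\<lambda>j. w j * \<phi> j l"]
    by (simp add: kernel_def \<phi>_def mult.assoc)
  also have "\<dots> \<le> (\<Sum>j=1..n. (w j)\<^sup>2 * 2)"
    unfolding power_mult_distrib by (intro sum_mono mult_left_mono phi_sq_le) auto
  finally show ?thesis using n_pos unfolding sum_distrib_right[symmetric] by (simp add: field_simps)
qed

text \<open>At every design point the squared basis functions add up to \<open>n\<close>, by
  completeness on the diagonal. Hence the coefficient variances average to the mean variance even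
  when the levels are unequal.\<close>

lemma coeff_var_sum: "(\<Sum>j=1..n. coeff_var s j) = real n * mean_var s"
proof -
  have "(\<Sum>j=1..n. coeff_var s j) = (1 / real n) * (\<Sum>l=1..n. (s l)\<^sup>2 * (\<Sum>j=1..n. (\<phi> j l)\<^sup>2))"
    unfolding coeff_var_def sum_distrib_left[symmetric] by (subst sum.swap) (simp add: sum_distrib_left)
  also have "\<dots> = (\<Sum>l=1..n. (s l)\<^sup>2)"
    using n_pos by (simp only: phi_sq_sum cong: sum.cong) (simp flip: sum_distrib_right)
  finally show ?thesis using n_pos by (simp add: mean_var_def)
qed

lemma weighted_coeff_var:
  "(\<Sum>j=1..n. w j * coeff_var s j) = (1 / real n) * (\<Sum>l=1..n. (s l)\<^sup>2 * kernel w l l)"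
proof -
  have "(\<Sum>j=1..n. w j * coeff_var s j) = (\<Sum>j=1..n. \<Sum>l=1..n. (1 / real n) * ((s l)\<^sup>2 * (w j * (\<phi> j l * \<phi> j l))))"
    unfolding coeff_var_def sum_distrib_left by (simp add: power2_eq_square mult_ac)
  also have "\<dots> = (1 / real n) * (\<Sum>l=1..n. (s l)\<^sup>2 * kernel w l l)"
    by (subst sum.swap) (simp only: kernel_def sum_distrib_left)
  finally show ?thesis .
qed

text \<open>The double sum over design points splits into its diagonal and the rest, and the
  diagonal into its mean and a centered form. The two noise forms need different treatment: the
  diagonal one is estimated in mean, the off-diagonal one is absorbed by the penalty.\<close>

lemma coeff_err_sq_decomp:
  "real n * (\<Sum>j=1..n. w j * (coeff_err s x j)\<^sup>2)
    = (\<Sum>j=1..n. w j * coeff_var s j) + diag_part s x w + offdiag_part s x w"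
proof -
  let ?I = "{1..n}"
  let ?h = "\<lambda>l k. (s l * s k * kernel w l k / real n) * (x l * x k)"
  have "real n * (w j * (coeff_err s x j)\<^sup>2)
      = (\<Sum>l\<in>?I. \<Sum>k\<in>?I. (s l * s k * (w j * (\<phi> j l * \<phi> j k)) / real n) * (x l * x k))" for j
  proof -
    have "real n * (w j * (coeff_err s x j)\<^sup>2)
        = (w j / real n) * ((\<Sum>l\<in>?I. s l * x l * \<phi> j l) * (\<Sum>k\<in>?I. s k * x k * \<phi> j k))"
      using n_pos by (simp add: coeff_err_def theta_hat_def \<phi>_def power2_eq_square)
    also have "\<dots> = (\<Sum>l\<in>?I. \<Sum>k\<in>?I. (s l * s k * (w j * (\<phi> j l * \<phi> j k)) / real n) * (x l * x k))"
      by (simp only: sum_product) (simp add: sum_distrib_left mult_ac)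
    finally show ?thesis .
  qed
  then have "real n * (\<Sum>j=1..n. w j * (coeff_err s x j)\<^sup>2)
      = (\<Sum>j\<in>?I. \<Sum>l\<in>?I. \<Sum>k\<in>?I. (s l * s k * (w j * (\<phi> j l * \<phi> j k)) / real n) * (x l * x k))"
    by (simp only: sum_distrib_left)
  also have "\<dots> = (\<Sum>l\<in>?I. \<Sum>k\<in>?I. \<Sum>j\<in>?I. (s l * s k * (w j * (\<phi> j l * \<phi> j k)) / real n) * (x l * x k))"
    by (subst sum.swap) (rule sum.cong[OF refl], rule sum.swap)
  also have "\<dots> = (\<Sum>l\<in>?I. \<Sum>k\<in>?I. ?h l k)"
    by (simp only: kernel_def sum_distrib_left sum_distrib_right sum_divide_distrib)
  also have "\<dots> = (\<Sum>l\<in>?I. ?h l l + (\<Sum>k\<in>?I-{l}. ?h l k))"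
    by (intro sum.cong refl sum.remove) auto
  also have "\<dots> = (\<Sum>l\<in>?I. (s l)\<^sup>2 * kernel w l l / real n * (x l)\<^sup>2) + offdiag_part s x w"
    by (simp add: sum.distrib offdiag_part_def power2_eq_square mult_ac)
  also have "(\<Sum>l\<in>?I. (s l)\<^sup>2 * kernel w l l / real n * (x l)\<^sup>2)
      = (\<Sum>j=1..n. w j * coeff_var s j) + diag_part s x w"
    unfolding weighted_coeff_var diag_part_def
    by (simp add: right_diff_distrib sum_subtractf sum_divide_distrib)
  finally show ?thesis .
qed

lemma mean_var_bounds:
  assumes "\<And>l. l \<in> {1..n} \<Longrightarrow> (s l)\<^sup>2 \<le> B"
  shows "0 \<le> mean_var s" "mean_var s \<le> B"
proof -
  show "0 \<le> mean_var s" by (simp add: mean_var_def sum_nonneg)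
  have "(\<Sum>l=1..n. (s l)\<^sup>2) \<le> (\<Sum>l=1..n. B)" by (intro sum_mono assms)
  then show "mean_var s \<le> B" using n_pos by (simp add: mean_var_def field_simps)
qed

lemma coeff_var_bounds:
  assumes "\<And>l. l \<in> {1..n} \<Longrightarrow> (s l)\<^sup>2 \<le> B"
  shows "0 \<le> coeff_var s j" "coeff_var s j \<le> 2 * B"
proof -
  show "0 \<le> coeff_var s j" by (simp add: coeff_var_def sum_nonneg)
  have "(\<Sum>l=1..n. (s l)\<^sup>2 * (\<phi> j l)\<^sup>2) \<le> (\<Sum>l=1..n. B * 2)"
    by (intro sum_mono mult_mono assms phi_sq_le) (auto intro: order_trans[OF _ assms])
  then show "coeff_var s j \<le> 2 * B" using n_pos by (simp add: coeff_var_def field_simps)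
qed

text \<open>With unequal levels the basis functions do not average out; the diagonal of the kernel
  differs from the sum of the weights by at most \<open>u\<close> at every design point. This is how
  \<open>u_const\<close> enters the bounds.\<close>

lemma coeff_var_centered:
  assumes s: "\<And>l. l \<in> {1..n} \<Longrightarrow> (s l)\<^sup>2 \<le> B"
    and u: "\<And>l. l \<in> {1..n} \<Longrightarrow> \<bar>\<Sum>j=1..n. w j * ((\<phi> j l)\<^sup>2 - 1)\<bar> \<le> u"
  shows "\<bar>(\<Sum>j=1..n. w j * coeff_var s j) - mean_var s * (\<Sum>j=1..n. w j)\<bar> \<le> B * u"
proof -
  have eq: "(\<Sum>j=1..n. w j * ((\<phi> j l)\<^sup>2 - 1)) = kernel w l l - (\<Sum>j=1..n. w j)" for l
    by (simp add: kernel_def power2_eq_square right_diff_distrib sum_subtractf)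
  have "(\<Sum>j=1..n. w j * coeff_var s j) - mean_var s * (\<Sum>j=1..n. w j)
      = (1 / real n) * (\<Sum>l=1..n. (s l)\<^sup>2 * (\<Sum>j=1..n. w j * ((\<phi> j l)\<^sup>2 - 1)))"
    unfolding weighted_coeff_var mean_var_def eq right_diff_distrib sum_subtractf
    by (simp add: sum_distrib_right kernel_def power2_eq_square)
  also have "\<bar>\<dots>\<bar> \<le> (1 / real n) * (\<Sum>l=1..n. B * u)"
    unfolding abs_mult
    by (intro mult_mono order_trans[OF sum_abs] sum_mono)
      (auto simp: abs_mult simp del: One_nat_def intro!: mult_mono s u intro: order_trans[OF _ s])
  also have "\<dots> = B * u" using n_pos by simp
  finally show ?thesis .
qed

end

section \<open>Pathwise oracle inequality\<close>

context regression
begin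

text \<open>Free of the selected weight: each sum over \<open>L\<close> of nonnegative terms
  dominates the term at the unknown minimizer. The denominators do not involve the noise
  \<open>x\<close>. The factor \<open>1 / (1 - \<rho>)\<close> undoes the multiplication by
  \<open>1 - \<rho>\<close> in \<open>lin_part_oracle_bound\<close>.\<close>

definition remainder ::
  "nat \<Rightarrow> (nat \<Rightarrow> real) set \<Rightarrow> real \<Rightarrow> real \<Rightarrow> (nat \<Rightarrow> real) \<Rightarrow> (nat \<Rightarrow> real) \<Rightarrow> (nat \<Rightarrow> real) \<Rightarrow> real" where
  "remainder d L B \<rho> w0 s x =
     (\<Sum>v\<in>L. (lin_part s x (\<lambda>j. v j - w0 j))\<^sup>2 / signal_sq (\<lambda>j. v j - w0 j)) / \<rho>
   + (\<Sum>v\<in>L. (lin_part s x (\<lambda>j. (v j - w0 j)\<^sup>2))\<^sup>2 / signal_sq (\<lambda>j. v j - w0 j)) / (1 - \<rho>)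
   + 4 * B * u_const 1 n L / real n
   + 4 / real n * (\<Sum>v\<in>L. \<bar>diag_part s x v\<bar>)
   + 2 / (\<rho> * (real n)\<^sup>2) * (\<Sum>v\<in>L. (offdiag_part s x v)\<^sup>2 / penalty s v)
   + 2 * (1 + \<rho>) * v_const n L / real n * \<bar>var_hat n d (data s x) - mean_var s\<bar>"

text \<open>The loss contains the unobservable product of \<open>theta_hat\<close> with
  \<open>\<theta>\<close>, which the cost replaces by \<open>theta_tilde\<close>. Since
  \<open>theta_hat * (theta_hat - \<theta>)\<close> is
  \<open>\<theta> * coeff_err + coeff_err^2\<close>, the gap consists of a linear form, the
  quadratic form of \<open>coeff_err_sq_decomp\<close> and the variance correction.\<close>

lemma cost_loss:
  fixes v s x :: "nat \<Rightarrow> real" and d :: nat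
  defines "vh \<equiv> var_hat n d (data s x)"
  shows "loss s x v = cost n d \<rho> (data s x) v + 2 * lin_part s x v
    + (2 / real n) * ((\<Sum>j=1..n. v j * coeff_var s j) + diag_part s x v + offdiag_part s x v)
    - (2 / real n) * (vh * (\<Sum>j=1..n. v j)) - \<rho> * ((\<Sum>j=1..n. (v j)\<^sup>2) * vh / real n)
    + (\<Sum>j=1..n. (\<theta> j)\<^sup>2)"
proof -
  let ?t = "theta_hat n (data s x)"
  have "loss s x v = (\<Sum>j=1..n. (v j)\<^sup>2 * (?t j)\<^sup>2) - 2 * (\<Sum>j=1..n. v j * ?t j * \<theta> j) + (\<Sum>j=1..n. (\<theta> j)\<^sup>2)"
    unfolding loss_def power2_diff power_mult_distrib by (simp add: sum.distrib sum_subtractf sum_distrib_left mult.assoc)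
  moreover have "cost n d \<rho> (data s x) v = (\<Sum>j=1..n. (v j)\<^sup>2 * (?t j)\<^sup>2) - 2 * (\<Sum>j=1..n. v j * (?t j)\<^sup>2)
      + (2 / real n) * (vh * (\<Sum>j=1..n. v j)) + \<rho> * ((\<Sum>j=1..n. (v j)\<^sup>2) * vh / real n)"
    unfolding cost_def theta_tilde_def penalty_hat_def vh_def[symmetric]
    by (simp add: right_diff_distrib sum_subtractf sum_divide_distrib sum_distrib_left sum_distrib_right mult_ac)
  moreover have "(\<Sum>j=1..n. v j * (?t j)\<^sup>2) - (\<Sum>j=1..n. v j * ?t j * \<theta> j)
      = lin_part s x v + (\<Sum>j=1..n. v j * (coeff_err s x j)\<^sup>2)"
    unfolding lin_part_def theta_hat_data sum.distrib[symmetric] sum_subtractf[symmetric]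
    by (intro sum.cong refl) algebra
  moreover have "(\<Sum>j=1..n. v j * (coeff_err s x j)\<^sup>2)
      = (1 / real n) * ((\<Sum>j=1..n. v j * coeff_var s j) + diag_part s x v + offdiag_part s x v)"
    using coeff_err_sq_decomp[of v s x] n_pos by (simp add: field_simps)
  ultimately show ?thesis by (simp add: algebra_simps)
qed

lemma lin_part_diff: "lin_part s x (\<lambda>j. v j - w j) = lin_part s x v - lin_part s x w"
  by (simp add: lin_part_def left_diff_distrib sum_subtractf)

lemma signal_sq_nonneg: "0 \<le> signal_sq z"
  by (simp add: signal_sq_def sum_nonneg)

lemma signal_sq_eq_0: "signal_sq z = 0 \<longleftrightarrow> (\<forall>j\<in>{1..n}. z j * \<theta> j = 0)"
  unfolding signal_sq_def by (subst sum_nonneg_eq_0_iff) auto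

lemma lin_part_two_abs_le:
  assumes \<rho>: "0 < \<rho>" and z: "signal_sq z = 0 \<Longrightarrow> lin_part s x y = 0"
  shows "2 * \<bar>lin_part s x y\<bar> \<le> \<rho> * signal_sq z + (lin_part s x y)\<^sup>2 / signal_sq z / \<rho>"
  using two_abs_le[OF \<rho> signal_sq_nonneg z] by (simp add: mult.commute)

text \<open>AM-GM charges the linear form to \<open>\<rho> * signal_sq z\<close>, which must then be
  returned to the losses. In estimated coefficients this is the squared distance of two estimators,
  at most twice the sum of their losses, up to the cross term \<open>lin_part\<close> with weights
  \<open>z^2\<close>. That cross term is absorbed by AM-GM again, which leaves
  \<open>1 - \<rho>\<close> on the left; multiplying through avoids the division.\<close>

lemma lin_part_oracle_bound:
  fixes w w0 :: "nat \<Rightarrow> real"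
  assumes \<rho>: "0 < \<rho>" "\<rho> < 1"
  defines "z \<equiv> (\<lambda>j. w j - w0 j)"
  shows "(1 - \<rho>) * (2 * lin_part s x z) \<le> 2 * \<rho> * (loss s x w + loss s x w0)
    + (1 - \<rho>) * ((lin_part s x z)\<^sup>2 / signal_sq z / \<rho>)
    + (lin_part s x (\<lambda>j. (z j)\<^sup>2))\<^sup>2 / signal_sq z"
proof -
  let ?t = "theta_hat n (data s x)"
  define T where "T = signal_sq z"
  define a where "a = lin_part s x z"
  define b where "b = lin_part s x (\<lambda>j. (z j)\<^sup>2)"
  \<comment> \<open>A vanishing normalizer makes every \<open>z j * \<theta> j\<close> zero, so both
    forms vanish and the quotients by \<open>T\<close> are harmless.\<close>
  have zero: "a = 0" "b = 0" if "T = 0"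
    using that signal_sq_eq_0[of z] by (auto simp: T_def a_def b_def lin_part_def power2_eq_square mult.assoc intro!: sum.neutral)
  have a: "2 * \<bar>a\<bar> \<le> \<rho> * T + a\<^sup>2 / T / \<rho>"
    unfolding a_def T_def by (rule lin_part_two_abs_le) (use \<rho> zero in \<open>auto simp: a_def T_def\<close>)
  have b: "2 * \<bar>b\<bar> \<le> \<rho> * T + b\<^sup>2 / T / \<rho>"
    unfolding b_def T_def by (rule lin_part_two_abs_le) (use \<rho> zero in \<open>auto simp: b_def T_def\<close>)
  \<comment> \<open>Expansion of \<open>theta_hat = \<theta> + coeff_err\<close>; the square of the
    noise part has the favourable sign and is dropped.\<close>
  have "T = (\<Sum>j=1..n. (z j * ?t j)\<^sup>2) - 2 * b - (\<Sum>j=1..n. (z j * coeff_err s x j)\<^sup>2)"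
    unfolding T_def signal_sq_def b_def lin_part_def theta_hat_data sum_distrib_left sum_subtractf[symmetric]
    by (intro sum.cong refl) algebra
  also have "\<dots> \<le> (\<Sum>j=1..n. (z j * ?t j)\<^sup>2) + 2 * \<bar>b\<bar>"
    using sum_nonneg[of "{1..n}" "\<lambda>j. (z j * coeff_err s x j)\<^sup>2"] by simp
  also have "(\<Sum>j=1..n. (z j * ?t j)\<^sup>2) \<le> (\<Sum>j=1..n. 2 * (w j * ?t j - \<theta> j)\<^sup>2 + 2 * (w0 j * ?t j - \<theta> j)\<^sup>2)"
  proof (intro sum_mono)
    fix j
    have "(u - v)\<^sup>2 \<le> 2 * u\<^sup>2 + 2 * v\<^sup>2" for u v :: real
      using sum_squares_bound[of u "- v"] by (simp add: power2_diff)
    from this[of "w j * ?t j - \<theta> j" "w0 j * ?t j - \<theta> j"]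
    show "(z j * ?t j)\<^sup>2 \<le> 2 * (w j * ?t j - \<theta> j)\<^sup>2 + 2 * (w0 j * ?t j - \<theta> j)\<^sup>2"
      by (simp add: z_def left_diff_distrib)
  qed
  also have "\<dots> = 2 * (loss s x w + loss s x w0)"
    unfolding loss_def by (simp add: sum.distrib sum_distrib_left)
  finally have "(1 - \<rho>) * T \<le> 2 * (loss s x w + loss s x w0) + b\<^sup>2 / T / \<rho>"
    using b by (simp add: algebra_simps)
  then have "\<rho> * ((1 - \<rho>) * T) \<le> \<rho> * (2 * (loss s x w + loss s x w0) + b\<^sup>2 / T / \<rho>)"
    using \<rho> by (intro mult_left_mono) auto
  also have "\<dots> = 2 * \<rho> * (loss s x w + loss s x w0) + b\<^sup>2 / T"
    using \<rho> by (simp add: algebra_simps)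
  finally have T: "(1 - \<rho>) * (\<rho> * T) \<le> 2 * \<rho> * (loss s x w + loss s x w0) + b\<^sup>2 / T"
    by (simp add: mult_ac)
  have "(1 - \<rho>) * (2 * a) \<le> (1 - \<rho>) * (\<rho> * T + a\<^sup>2 / T / \<rho>)"
    using a \<rho> by (intro mult_left_mono) auto
  with T show ?thesis unfolding a_def b_def T_def by (simp add: distrib_left)
qed

lemma weight_sums:
  fixes w :: "nat \<Rightarrow> real"
  assumes "\<And>j. j \<in> {1..n} \<Longrightarrow> w j \<in> {0..1}"
  shows "0 \<le> (\<Sum>j=1..n. w j)" "0 \<le> (\<Sum>j=1..n. (w j)\<^sup>2)" "(\<Sum>j=1..n. (w j)\<^sup>2) \<le> (\<Sum>j=1..n. w j)"
proof -
  have "0 \<le> w j" "(w j)\<^sup>2 \<le> w j" if "j \<in> {1..n}" for j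
    using assms[OF that] mult_left_le[of "w j" "w j"] by (auto simp: power2_eq_square)
  then show "0 \<le> (\<Sum>j=1..n. w j)" "0 \<le> (\<Sum>j=1..n. (w j)\<^sup>2)" "(\<Sum>j=1..n. (w j)\<^sup>2) \<le> (\<Sum>j=1..n. w j)"
    by (intro sum_nonneg sum_mono zero_le_power2; blast)+
qed

text \<open>The identity \<open>cost_loss\<close> at \<open>w\<close> minus the one at
  \<open>w0\<close> removes the term common to both losses, and the difference of the costs has the
  right sign. The noise terms at the selected \<open>w\<close> are bounded uniformly over
  \<open>L\<close>; of the two penalties only that of the fixed comparator survives.\<close>

lemma oracle_pathwise:
  assumes L: "finite L" "\<And>v j. v \<in> L \<Longrightarrow> j \<in> {1..n} \<Longrightarrow> v j \<in> {0..1}"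
    and w: "w \<in> L" "w0 \<in> L" and \<rho>: "0 < \<rho>" "\<rho> < 1"
    and cost: "cost n d \<rho> (data s x) w \<le> cost n d \<rho> (data s x) w0"
    and s: "\<And>l. l \<in> {1..n} \<Longrightarrow> (s l)\<^sup>2 \<le> B" and mv: "0 < mean_var s"
  shows "(1 - 3 * \<rho>) * loss s x w
    \<le> (1 + \<rho>) * loss s x w0 + (1 - \<rho>) * (2 * \<rho> * penalty s w0 + remainder d L B \<rho> w0 s x)"
proof -
  define vh where "vh = var_hat n d (data s x)"
  define V where "V = \<bar>vh - mean_var s\<bar>"
  define vm where "vm = v_const n L"
  define z where "z = (\<lambda>j. w j - w0 j)"
  define i where "i = 1 / real n"
  define cen where "cen v = (\<Sum>j=1..n. v j * coeff_var s j) - mean_var s * (\<Sum>j=1..n. v j)" for v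
  have i: "0 < i" using n_pos by (simp add: i_def)
  note in_unit = L(2)
  have Sle: "0 \<le> (\<Sum>j=1..n. v j)" "(\<Sum>j=1..n. v j) \<le> vm"
    "0 \<le> (\<Sum>j=1..n. (v j)\<^sup>2)" "(\<Sum>j=1..n. (v j)\<^sup>2) \<le> vm" if "v \<in> L" for v
    using weight_sums[of v, OF in_unit[OF that]] v_const_upper[OF L(1) that, of n] by (auto simp: vm_def)
  have cen: "\<bar>cen v\<bar> \<le> B * u_const 1 n L" if "v \<in> L" for v
    unfolding cen_def using u_const_upper[OF L(1) that, of _ n 1]
    by (intro coeff_var_centered s) (auto simp: \<phi>_def)
  have D: "\<bar>diag_part s x v\<bar> \<le> (\<Sum>v\<in>L. \<bar>diag_part s x v\<bar>)" if "v \<in> L" for v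
    using that L by (intro member_le_sum) auto
  have pen_nonneg: "0 \<le> penalty s v" for v
    using mv by (simp add: penalty_def sum_nonneg)
  have U: "2 * i * \<bar>offdiag_part s x v\<bar> \<le> \<rho> * penalty s v
      + i\<^sup>2 / \<rho> * (\<Sum>v\<in>L. (offdiag_part s x v)\<^sup>2 / penalty s v)" if "v \<in> L" for v
  proof -
    \<comment> \<open>Positive mean variance is essential here: then a zero penalty forces zero
      weights and hence a zero kernel.\<close>
    have "offdiag_part s x v = 0" if "penalty s v = 0"
    proof -
      have "(\<Sum>j=1..n. (v j)\<^sup>2) = 0" using that mv n_pos by (simp add: penalty_def)
      then have "\<forall>j\<in>{1..n}. (v j)\<^sup>2 = 0" by (subst (asm) sum_nonneg_eq_0_iff) auto
      then show ?thesis by (simp add: offdiag_part_def kernel_def)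
    qed
    then have "2 * \<bar>i * offdiag_part s x v\<bar> \<le> \<rho> * penalty s v + (i * offdiag_part s x v)\<^sup>2 / (\<rho> * penalty s v)"
      using \<rho> pen_nonneg by (intro two_abs_le) auto
    also have "(i * offdiag_part s x v)\<^sup>2 / (\<rho> * penalty s v) = i\<^sup>2 / \<rho> * ((offdiag_part s x v)\<^sup>2 / penalty s v)"
      by (simp add: power_mult_distrib)
    also have "\<dots> \<le> i\<^sup>2 / \<rho> * (\<Sum>v\<in>L. (offdiag_part s x v)\<^sup>2 / penalty s v)"
      using that L \<rho> pen_nonneg by (intro mult_left_mono member_le_sum) auto
    finally show ?thesis using i by (simp add: abs_mult)
  qed
  have "loss s x w - loss s x w0 \<le> 2 * lin_part s x z
      + 2 * i * ((mean_var s - vh) * ((\<Sum>j=1..n. w j) - (\<Sum>j=1..n. w0 j)))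
      + 2 * i * (cen w - cen w0) + 2 * i * (diag_part s x w - diag_part s x w0)
      + 2 * i * (offdiag_part s x w - offdiag_part s x w0)
      + - (\<rho> * i * (((\<Sum>j=1..n. (w j)\<^sup>2) - (\<Sum>j=1..n. (w0 j)\<^sup>2)) * vh))"
    using cost_loss[of s x w d \<rho>] cost_loss[of s x w0 d \<rho>] cost
    unfolding vh_def[symmetric] z_def lin_part_diff cen_def i_def by (simp add: algebra_simps add_divide_distrib diff_divide_distrib)
  also have "(mean_var s - vh) * ((\<Sum>j=1..n. w j) - (\<Sum>j=1..n. w0 j)) \<le> V * vm"
  proof -
    have "(mean_var s - vh) * ((\<Sum>j=1..n. w j) - (\<Sum>j=1..n. w0 j))
        \<le> \<bar>mean_var s - vh\<bar> * \<bar>(\<Sum>j=1..n. w j) - (\<Sum>j=1..n. w0 j)\<bar>"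
      by (metis abs_ge_self abs_mult)
    also have "\<dots> \<le> V * vm"
      using Sle(1,2)[OF w(1)] Sle(1,2)[OF w(2)]
      by (intro mult_mono) (auto simp: V_def abs_le_iff)
    finally show ?thesis .
  qed
  also have "cen w - cen w0 \<le> 2 * (B * u_const 1 n L)"
    using cen[OF w(1)] cen[OF w(2)] by linarith
  also have "diag_part s x w - diag_part s x w0 \<le> 2 * (\<Sum>v\<in>L. \<bar>diag_part s x v\<bar>)"
    using D[OF w(1)] D[OF w(2)] by linarith
  also have "2 * i * (offdiag_part s x w - offdiag_part s x w0) \<le> \<rho> * (penalty s w + penalty s w0)
      + 2 * (i\<^sup>2 / \<rho> * (\<Sum>v\<in>L. (offdiag_part s x v)\<^sup>2 / penalty s v))"
  proof -
    have "2 * i * (offdiag_part s x w - offdiag_part s x w0)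
        \<le> 2 * i * \<bar>offdiag_part s x w\<bar> + 2 * i * \<bar>offdiag_part s x w0\<bar>"
      using i by (simp flip: distrib_left)
    then show ?thesis using U[OF w(1)] U[OF w(2)] by (simp add: distrib_left)
  qed
  \<comment> \<open>Written with the mean variance, the penalty of the cost supplies
    \<open>- \<rho> * penalty s w\<close>, which cancels the charge of the off-diagonal form at
    \<open>w\<close>. The exchange costs \<open>vm * V\<close>, since both sums of squared weights
    lie in \<open>{0..vm}\<close>.\<close>
  also have "- (\<rho> * i * (((\<Sum>j=1..n. (w j)\<^sup>2) - (\<Sum>j=1..n. (w0 j)\<^sup>2)) * vh))
      \<le> \<rho> * penalty s w0 - \<rho> * penalty s w + \<rho> * i * (vm * V)"
  proof -
    define c where "c = (\<Sum>j=1..n. (w0 j)\<^sup>2) - (\<Sum>j=1..n. (w j)\<^sup>2)"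
    have "c * (vh - mean_var s) \<le> \<bar>c\<bar> * \<bar>vh - mean_var s\<bar>"
      by (metis abs_ge_self abs_mult)
    also have "\<dots> \<le> vm * V"
      using Sle(3,4)[OF w(1)] Sle(3,4)[OF w(2)]
      by (intro mult_mono) (auto simp: V_def c_def abs_le_iff)
    finally have "\<rho> * i * (c * (vh - mean_var s)) \<le> \<rho> * i * (vm * V)"
      using \<rho> i by (intro mult_left_mono) auto
    then show ?thesis by (simp add: c_def penalty_def i_def algebra_simps diff_divide_distrib)
  qed
  finally have main: "loss s x w - loss s x w0 \<le> 2 * lin_part s x z + 2 * i * (V * vm)
      + 2 * i * (2 * (B * u_const 1 n L)) + 2 * i * (2 * (\<Sum>v\<in>L. \<bar>diag_part s x v\<bar>))
      + (\<rho> * (penalty s w + penalty s w0)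
      + 2 * (i\<^sup>2 / \<rho> * (\<Sum>v\<in>L. (offdiag_part s x v)\<^sup>2 / penalty s v)))
      + (\<rho> * penalty s w0 - \<rho> * penalty s w + \<rho> * i * (V * vm))"
    using i by (simp add: mult.commute[of vm])
  define A where "A = (\<Sum>v\<in>L. (lin_part s x (\<lambda>j. v j - w0 j))\<^sup>2 / signal_sq (\<lambda>j. v j - w0 j))"
  define A' where "A' = (\<Sum>v\<in>L. (lin_part s x (\<lambda>j. (v j - w0 j)\<^sup>2))\<^sup>2 / signal_sq (\<lambda>j. v j - w0 j))"
  have A: "(lin_part s x z)\<^sup>2 / signal_sq z \<le> A"
    unfolding A_def z_def using w L signal_sq_nonneg
    by (intro member_le_sum[where f = "\<lambda>v. (lin_part s x (\<lambda>j. v j - w0 j))\<^sup>2 / signal_sq (\<lambda>j. v j - w0 j)"]) auto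
  have A': "(lin_part s x (\<lambda>j. (z j)\<^sup>2))\<^sup>2 / signal_sq z \<le> A'"
    unfolding A'_def z_def using w L signal_sq_nonneg
    by (intro member_le_sum[where f = "\<lambda>v. (lin_part s x (\<lambda>j. (v j - w0 j)\<^sup>2))\<^sup>2 / signal_sq (\<lambda>j. v j - w0 j)"]) auto
  have lin: "(1 - \<rho>) * (2 * lin_part s x z) \<le> 2 * \<rho> * (loss s x w + loss s x w0)
      + (1 - \<rho>) * (A / \<rho> + A' / (1 - \<rho>))"
  proof -
    have "(1 - \<rho>) * ((lin_part s x z)\<^sup>2 / signal_sq z / \<rho>) \<le> (1 - \<rho>) * (A / \<rho>)"
      using A \<rho> by (intro mult_left_mono divide_right_mono) auto
    moreover have "(1 - \<rho>) * (A' / (1 - \<rho>)) = A'" using \<rho> by simp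
    ultimately show ?thesis
      using lin_part_oracle_bound[OF \<rho>, of s x w w0] A' unfolding z_def distrib_left by linarith
  qed
  have rem: "remainder d L B \<rho> w0 s x = A / \<rho> + A' / (1 - \<rho>) + 2 * i * (2 * (B * u_const 1 n L))
      + 2 * i * (2 * (\<Sum>v\<in>L. \<bar>diag_part s x v\<bar>))
      + 2 * (i\<^sup>2 / \<rho> * (\<Sum>v\<in>L. (offdiag_part s x v)\<^sup>2 / penalty s v))
      + (2 * i * (V * vm) + 2 * (\<rho> * i * (V * vm)))"
    unfolding remainder_def A_def[symmetric] A'_def[symmetric] vh_def[symmetric] V_def[symmetric] vm_def[symmetric]
    by (simp add: i_def algebra_simps power_divide add_divide_distrib)
  \<comment> \<open>Slack: the estimate has \<open>2 + \<rho>\<close> in front of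
    \<open>i * (V * vm)\<close>, the remainder \<open>2 + 2 * \<rho>\<close>, so that multiplying by
    \<open>1 - \<rho>\<close> gives the \<open>1 - \<rho>^2\<close> of \<open>kappa\<close>.\<close>
  have "0 \<le> \<rho> * i * (V * vm)" using \<rho> i Sle(1,2)[OF w(1)] by (simp add: V_def)
  with main have "loss s x w - loss s x w0 \<le> 2 * lin_part s x z
      + (2 * \<rho> * penalty s w0 + (remainder d L B \<rho> w0 s x - A / \<rho> - A' / (1 - \<rho>)))"
    unfolding rem distrib_left by linarith
  then have "(1 - \<rho>) * (loss s x w - loss s x w0) \<le> (1 - \<rho>) * (2 * lin_part s x z
      + (2 * \<rho> * penalty s w0 + (remainder d L B \<rho> w0 s x - A / \<rho> - A' / (1 - \<rho>))))"
    using \<rho> by (intro mult_left_mono) auto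
  with lin show ?thesis by (simp add: algebra_simps)
qed

end

section \<open>Expectations for fixed noise levels\<close>

text \<open>The model conditional on the noise levels: \<open>s\<close> is a fixed vector, to be
  instantiated at almost every realization of the levels.\<close>

locale noisy_regression = regression n f + noise M "{1..n}" \<epsilon> \<mu>4
  for n :: nat and f :: "nat \<Rightarrow> real" and M :: "'a measure" and \<epsilon> :: "nat \<Rightarrow> 'a \<Rightarrow> real" and \<mu>4 :: real +
  fixes s :: "nat \<Rightarrow> real" and B :: real
  assumes s_bounded: "\<And>l. l \<in> {1..n} \<Longrightarrow> (s l)\<^sup>2 \<le> B"
    and B_pos: "0 < B"
begin

abbreviation X :: "'a \<Rightarrow> nat \<Rightarrow> real" where
  "X \<omega> \<equiv> \<lambda>l. \<epsilon> l \<omega>"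

lemma \<mu>4_nonneg: "0 \<le> \<mu>4"
proof -
  have "1 \<in> {1..n}" using n_pos by simp
  have "0 \<le> expectation (\<lambda>\<omega>. \<epsilon> 1 \<omega> ^ 4)" by (rule integral_nonneg_AE) simp
  then show ?thesis using fourth[OF \<open>1 \<in> {1..n}\<close>] by linarith
qed

lemma measurable_coeff_err[measurable]: "(\<lambda>\<omega>. coeff_err s (X \<omega>) j) \<in> borel_measurable M"
  unfolding coeff_err_def theta_hat_def by measurable

lemma measurable_parts[measurable]:
  "(\<lambda>\<omega>. lin_part s (X \<omega>) z) \<in> borel_measurable M"
  "(\<lambda>\<omega>. diag_part s (X \<omega>) w) \<in> borel_measurable M"
  "(\<lambda>\<omega>. offdiag_part s (X \<omega>) w) \<in> borel_measurable M"
  "(\<lambda>\<omega>. var_hat n d (data s (X \<omega>))) \<in> borel_measurable M"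
  unfolding lin_part_def diag_part_def offdiag_part_def var_hat_def theta_hat_data by measurable

text \<open>After bounding the levels, the coefficients of the noise are values of the trigonometric
  polynomial with coefficients \<open>z j * \<theta> j\<close>, so Parseval returns exactly
  \<open>signal_sq z\<close>.\<close>

lemma lin_part_sq:
  shows "integrable M (\<lambda>\<omega>. (lin_part s (X \<omega>) z)\<^sup>2)"
    and "expectation (\<lambda>\<omega>. (lin_part s (X \<omega>) z)\<^sup>2) \<le> B / real n * signal_sq z"
proof -
  define a where "a l = s l * (\<Sum>j=1..n. z j * \<theta> j * \<phi> j l) / real n" for l
  have eq: "lin_part s x z = (\<Sum>l=1..n. a l * x l)" for x
  proof -
    have "lin_part s x z = (\<Sum>j=1..n. \<Sum>l=1..n. (z j * \<theta> j * \<phi> j l) * (s l * x l / real n))"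
      by (simp add: lin_part_def coeff_err_def theta_hat_def \<phi>_def sum_distrib_left mult_ac)
    also have "\<dots> = (\<Sum>l=1..n. a l * x l)"
      by (subst sum.swap) (simp only: sum_distrib_right[symmetric], simp add: a_def mult_ac)
    finally show ?thesis .
  qed
  show "integrable M (\<lambda>\<omega>. (lin_part s (X \<omega>) z)\<^sup>2)"
    unfolding eq by (rule expectation_linear_sq)
  have "expectation (\<lambda>\<omega>. (lin_part s (X \<omega>) z)\<^sup>2) = (\<Sum>l=1..n. (a l)\<^sup>2)"
    unfolding eq by (rule expectation_linear_sq)
  also have "\<dots> \<le> (\<Sum>l=1..n. B * (\<Sum>j=1..n. z j * \<theta> j * \<phi> j l)\<^sup>2 / (real n)\<^sup>2)"
    unfolding a_def power_divide power_mult_distrib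
    by (intro sum_mono divide_right_mono mult_right_mono s_bounded) auto
  also have "\<dots> = B / real n * ((1 / real n) * (\<Sum>l=1..n. (\<Sum>j=1..n. z j * \<theta> j * \<phi> j l)\<^sup>2))"
    by (simp add: power2_eq_square sum_divide_distrib sum_distrib_left)
  also have "(1 / real n) * (\<Sum>l=1..n. (\<Sum>j=1..n. z j * \<theta> j * \<phi> j l)\<^sup>2) = (\<Sum>j=1..n. (z j * \<theta> j)\<^sup>2)"
    unfolding \<phi>_def by (rule discrete_parseval_synthesis[OF odd])
  also have "\<dots> = signal_sq z" by (simp add: signal_sq_def power_mult_distrib)
  finally show "expectation (\<lambda>\<omega>. (lin_part s (X \<omega>) z)\<^sup>2) \<le> B / real n * signal_sq z" .
qed

text \<open>There are \<open>n\<close> uncorrelated terms with coefficients of size at most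
  \<open>B * c / n\<close>, so the root mean square already has the gain \<open>1 / sqrt n\<close>
  and no normalization is required.\<close>

lemma diag_part_abs:
  assumes k: "\<And>l. l \<in> {1..n} \<Longrightarrow> \<bar>kernel w l l\<bar> \<le> c" and c: "0 \<le> c"
  shows "integrable M (\<lambda>\<omega>. \<bar>diag_part s (X \<omega>) w\<bar>)"
    and "expectation (\<lambda>\<omega>. \<bar>diag_part s (X \<omega>) w\<bar>) \<le> c * B * (sqrt \<mu>4 / sqrt (real n))"
proof -
  let ?a = "\<lambda>l. (s l)\<^sup>2 * kernel w l l / real n"
  note sq = expectation_diagonal_sq[of ?a]
  have "(?a l)\<^sup>2 \<le> (B * c / real n)\<^sup>2" if "l \<in> {1..n}" for l
  proof -
    have "\<bar>?a l\<bar> \<le> B * c / real n"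
      unfolding abs_divide abs_mult using s_bounded[OF that] k[OF that] B_pos
      by (auto intro!: divide_right_mono mult_mono)
    then show ?thesis by (metis abs_ge_zero power2_abs power_mono)
  qed
  then have "(\<Sum>l=1..n. (?a l)\<^sup>2) \<le> (\<Sum>l=1..n. (B * c / real n)\<^sup>2)" by (intro sum_mono)
  also have "\<dots> = (B * c)\<^sup>2 / real n"
    using n_pos by (simp add: power_divide power2_eq_square)
  finally have "\<mu>4 * (\<Sum>l=1..n. (?a l)\<^sup>2) \<le> \<mu>4 * ((B * c)\<^sup>2 / real n)"
    using \<mu>4_nonneg by (rule mult_left_mono)
  then have le: "expectation (\<lambda>\<omega>. (diag_part s (X \<omega>) w)\<^sup>2) \<le> \<mu>4 * ((B * c)\<^sup>2 / real n)"
    using sq(2) unfolding diag_part_def by linarith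
  have int: "integrable M (\<lambda>\<omega>. (diag_part s (X \<omega>) w)\<^sup>2)"
    unfolding diag_part_def by (rule sq(1))
  have "sqrt (\<mu>4 * ((B * c)\<^sup>2 / real n)) = c * B * (sqrt \<mu>4 / sqrt (real n))"
    using B_pos c by (simp add: real_sqrt_mult real_sqrt_divide)
  then show "integrable M (\<lambda>\<omega>. \<bar>diag_part s (X \<omega>) w\<bar>)"
    and "expectation (\<lambda>\<omega>. \<bar>diag_part s (X \<omega>) w\<bar>) \<le> c * B * (sqrt \<mu>4 / sqrt (real n))"
    using expectation_abs_le_sqrt[OF _ int le] by simp_all
qed

text \<open>Of the factor 4, one 2 comes from the symmetric pairs and one from the bound on squared
  basis functions in \<open>kernel_sq_sum\<close>.\<close>

lemma offdiag_part_sq: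
  shows "integrable M (\<lambda>\<omega>. (offdiag_part s (X \<omega>) w)\<^sup>2)"
    and "expectation (\<lambda>\<omega>. (offdiag_part s (X \<omega>) w)\<^sup>2) \<le> 4 * B * real n * penalty s w"
proof -
  let ?b = "\<lambda>l k. s l * s k * kernel w l k / real n"
  have sym: "?b l k = ?b k l" for l k by (simp add: kernel_sym mult_ac)
  show "integrable M (\<lambda>\<omega>. (offdiag_part s (X \<omega>) w)\<^sup>2)"
    unfolding offdiag_part_def by (rule expectation_offdiagonal_sq) (rule sym)
  have "expectation (\<lambda>\<omega>. (offdiag_part s (X \<omega>) w)\<^sup>2) = 2 * (\<Sum>l=1..n. \<Sum>k\<in>{1..n}-{l}. (?b l k)\<^sup>2)"
    unfolding offdiag_part_def by (rule expectation_offdiagonal_sq) (rule sym)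
  also have "\<dots> \<le> 2 * (\<Sum>l=1..n. \<Sum>k=1..n. (?b l k)\<^sup>2)"
    by (intro mult_left_mono sum_mono sum_mono2) auto
  \<comment> \<open>Only one of the two levels is bounded by \<open>B\<close>. The other survives as
    the mean variance, which makes the bound proportional to the penalty.\<close>
  also have "(\<Sum>l=1..n. \<Sum>k=1..n. (?b l k)\<^sup>2)
      \<le> (\<Sum>l=1..n. \<Sum>k=1..n. (s l)\<^sup>2 * B / (real n)\<^sup>2 * (kernel w l k)\<^sup>2)"
    unfolding power_divide power_mult_distrib times_divide_eq_left
    by (intro sum_mono divide_right_mono mult_right_mono mult_left_mono s_bounded) auto
  also have "\<dots> = (\<Sum>l=1..n. (s l)\<^sup>2 * B / (real n)\<^sup>2 * (\<Sum>k=1..n. (kernel w l k)\<^sup>2))"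
    by (simp add: sum_distrib_left)
  also have "\<dots> \<le> (\<Sum>l=1..n. (s l)\<^sup>2 * B / (real n)\<^sup>2 * (2 * real n * (\<Sum>j=1..n. (w j)\<^sup>2)))"
    using B_pos by (intro sum_mono mult_left_mono kernel_sq_sum) auto
  also have "\<dots> = 2 * B * (\<Sum>j=1..n. (w j)\<^sup>2) * mean_var s"
    using n_pos by (simp add: mean_var_def power2_eq_square[of "real n"] flip: sum_distrib_right sum_divide_distrib)
  finally show "expectation (\<lambda>\<omega>. (offdiag_part s (X \<omega>) w)\<^sup>2) \<le> 4 * B * real n * penalty s w"
    using n_pos by (simp add: penalty_def mult_ac)
qed

lemma loss_expectation:
  shows "integrable M (\<lambda>\<omega>. loss s (X \<omega>) w)"
    and "expectation (\<lambda>\<omega>. loss s (X \<omega>) w)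
      = (\<Sum>j=1..n. (w j - 1)\<^sup>2 * (\<theta> j)\<^sup>2) + (1 / real n) * (\<Sum>j=1..n. (w j)\<^sup>2 * coeff_var s j)"
proof -
  have e: "coeff_err s x j = (\<Sum>l=1..n. (s l * \<phi> j l / real n) * x l)" for x j
    by (simp add: coeff_err_def theta_hat_def \<phi>_def sum_distrib_left mult_ac)
  have int2: "integrable M (\<lambda>\<omega>. (coeff_err s (X \<omega>) j)\<^sup>2)" for j
    unfolding e by (rule expectation_linear_sq)
  have int1: "integrable M (\<lambda>\<omega>. coeff_err s (X \<omega>) j)" for j
    by (rule square_integrable_imp_integrable[OF _ int2]) measurable
  have E2: "expectation (\<lambda>\<omega>. (coeff_err s (X \<omega>) j)\<^sup>2) = coeff_var s j / real n" for j
    unfolding e expectation_linear_sq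
    by (simp add: coeff_var_def power_divide power_mult_distrib power2_eq_square[of "real n"] sum_divide_distrib)
  have intX: "l \<in> {1..n} \<Longrightarrow> integrable M (\<epsilon> l)" for l
    using integrable_noise_power[of l 1] by simp
  have E1: "expectation (\<lambda>\<omega>. coeff_err s (X \<omega>) j) = 0" for j
    unfolding e by (subst Bochner_Integration.integral_sum) (auto simp: mean intX)
  have eq: "(w j * theta_hat n (data s x) j - \<theta> j)\<^sup>2
      = (w j - 1)\<^sup>2 * (\<theta> j)\<^sup>2 + 2 * w j * (w j - 1) * \<theta> j * coeff_err s x j + (w j)\<^sup>2 * (coeff_err s x j)\<^sup>2" for x j
    unfolding theta_hat_data by algebra
  show "integrable M (\<lambda>\<omega>. loss s (X \<omega>) w)"
    unfolding loss_def eq by (intro Bochner_Integration.integrable_sum Bochner_Integration.integrable_add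
        integrable_mult_right int1 int2) auto
  have "expectation (\<lambda>\<omega>. loss s (X \<omega>) w)
      = (\<Sum>j=1..n. (w j - 1)\<^sup>2 * (\<theta> j)\<^sup>2 + (w j)\<^sup>2 * (coeff_var s j / real n))"
    unfolding loss_def eq by (subst Bochner_Integration.integral_sum) (auto simp: int1 int2 E1 E2 prob_space)
  then show "expectation (\<lambda>\<omega>. loss s (X \<omega>) w)
      = (\<Sum>j=1..n. (w j - 1)\<^sup>2 * (\<theta> j)\<^sup>2) + (1 / real n) * (\<Sum>j=1..n. (w j)\<^sup>2 * coeff_var s j)"
    by (simp add: sum.distrib sum_divide_distrib)
qed

text \<open>The variance part of the risk is the penalty up to the centering error, and the squared
  bias is nonnegative. This lets the penalty of the comparator be charged to its own risk.\<close>

lemma penalty_le_loss: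
  assumes u: "\<And>l. l \<in> {1..n} \<Longrightarrow> \<bar>\<Sum>j=1..n. (w j)\<^sup>2 * ((\<phi> j l)\<^sup>2 - 1)\<bar> \<le> u"
  shows "penalty s w \<le> expectation (\<lambda>\<omega>. loss s (X \<omega>) w) + B * u / real n"
proof -
  have "mean_var s * (\<Sum>j=1..n. (w j)\<^sup>2) \<le> (\<Sum>j=1..n. (w j)\<^sup>2 * coeff_var s j) + B * u"
    using coeff_var_centered[of s B "\<lambda>j. (w j)\<^sup>2", OF s_bounded u] by (simp add: abs_le_iff)
  then have "penalty s w \<le> ((\<Sum>j=1..n. (w j)\<^sup>2 * coeff_var s j) + B * u) / real n"
    unfolding penalty_def by (intro divide_right_mono) (auto simp: mult.commute)
  moreover have "0 \<le> (\<Sum>j=1..n. (w j - 1)\<^sup>2 * (\<theta> j)\<^sup>2)" by (intro sum_nonneg) auto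
  ultimately show ?thesis unfolding loss_expectation by (simp add: add_divide_distrib)
qed

text \<open>The estimator is the same quadratic form with the indicator of the frequencies above
  \<open>d\<close> as weights. The error collects the tail energy \<open>t\<close> of the signal,
  its cross term with the noise, the variance of the \<open>d\<close> omitted coefficients, and the
  two noise forms.\<close>

lemma var_hat_error:
  assumes d: "d \<le> n" and tail: "(\<Sum>j=d+1..n. (\<theta> j)\<^sup>2) \<le> t"
  shows "integrable M (\<lambda>\<omega>. \<bar>var_hat n d (data s (X \<omega>)) - mean_var s\<bar>)"
    and "expectation (\<lambda>\<omega>. \<bar>var_hat n d (data s (X \<omega>)) - mean_var s\<bar>)
      \<le> t + 2 * sqrt (B * t / real n) + 2 * real d * B / real n
        + (sqrt \<mu>4 + 2) * B / sqrt (real n)"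
proof -
  define z where "z j = (of_bool (d < j) :: real)" for j
  have z: "(\<Sum>j=d+1..n. g j) = (\<Sum>j=1..n. z j * g j)" for g :: "nat \<Rightarrow> real"
  proof -
    have "(\<Sum>j=1..n. z j * g j) = (\<Sum>j=1..n. if d < j then g j else 0)"
      by (intro sum.cong) (auto simp: z_def)
    also have "\<dots> = (\<Sum>j=d+1..n. g j)"
      by (subst sum.inter_filter[symmetric]) (auto intro!: sum.cong)
    finally show ?thesis ..
  qed
  have z01: "z j \<in> {0..1}" "(z j)\<^sup>2 = z j" for j by (auto simp: z_def)
  have t: "signal_sq z \<le> t" using tail unfolding signal_sq_def z z01 .
  have t0: "0 \<le> t" using t signal_sq_nonneg[of z] by linarith
  have low: "0 \<le> (\<Sum>j=1..n. (1 - z j) * coeff_var s j)" "(\<Sum>j=1..n. (1 - z j) * coeff_var s j) \<le> 2 * real d * B"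
  proof -
    have cv: "0 \<le> coeff_var s j" "coeff_var s j \<le> 2 * B" for j
      using coeff_var_bounds[of s B, OF s_bounded] by auto
    show "0 \<le> (\<Sum>j=1..n. (1 - z j) * coeff_var s j)"
      using z01 cv by (intro sum_nonneg mult_nonneg_nonneg) auto
    have "(\<Sum>j=1..n. (1 - z j) * coeff_var s j) = (\<Sum>j=1..n. if j \<le> d then coeff_var s j else 0)"
      by (intro sum.cong) (auto simp: z_def)
    also have "\<dots> = (\<Sum>j=1..d. coeff_var s j)"
      using d by (subst sum.inter_filter[symmetric]) (auto intro!: sum.cong)
    also have "\<dots> \<le> (\<Sum>j=1..d. 2 * B)" by (intro sum_mono cv)
    finally show "(\<Sum>j=1..n. (1 - z j) * coeff_var s j) \<le> 2 * real d * B" by simp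
  qed
  have dec: "var_hat n d (data s x) - mean_var s = signal_sq z + 2 * lin_part s x z
      + (1 / real n) * (diag_part s x z + offdiag_part s x z - (\<Sum>j=1..n. (1 - z j) * coeff_var s j))" for x
  proof -
    have "var_hat n d (data s x) = signal_sq z + 2 * lin_part s x z + (\<Sum>j=1..n. z j * (coeff_err s x j)\<^sup>2)"
      unfolding var_hat_def z theta_hat_data signal_sq_def lin_part_def z01 sum_distrib_left sum.distrib[symmetric]
      by (intro sum.cong refl) algebra
    moreover have "(\<Sum>j=1..n. z j * (coeff_err s x j)\<^sup>2)
        = (1 / real n) * ((\<Sum>j=1..n. z j * coeff_var s j) + diag_part s x z + offdiag_part s x z)"
      using coeff_err_sq_decomp[of z s x] n_pos by (simp add: field_simps)
    moreover have "mean_var s = (1 / real n) * ((\<Sum>j=1..n. z j * coeff_var s j) + (\<Sum>j=1..n. (1 - z j) * coeff_var s j))"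
      using coeff_var_sum[of s] n_pos by (simp add: left_diff_distrib sum_subtractf)
    ultimately show ?thesis by (simp add: algebra_simps add_divide_distrib diff_divide_distrib)
  qed
  have bound: "\<bar>var_hat n d (data s x) - mean_var s\<bar> \<le> t + 2 * \<bar>lin_part s x z\<bar>
      + (1 / real n) * \<bar>diag_part s x z\<bar> + (1 / real n) * \<bar>offdiag_part s x z\<bar> + 2 * real d * B / real n" for x
  proof -
    have "\<bar>(1 / real n) * (diag_part s x z + offdiag_part s x z - (\<Sum>j=1..n. (1 - z j) * coeff_var s j))\<bar>
        \<le> (1 / real n) * (\<bar>diag_part s x z\<bar> + \<bar>offdiag_part s x z\<bar> + 2 * real d * B)"
      unfolding abs_mult using low by (intro mult_mono) auto
    then show ?thesis unfolding dec using t signal_sq_nonneg[of z]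
      by (simp add: algebra_simps add_divide_distrib)
  qed
  have lin: "integrable M (\<lambda>\<omega>. \<bar>lin_part s (X \<omega>) z\<bar>)"
    "expectation (\<lambda>\<omega>. \<bar>lin_part s (X \<omega>) z\<bar>) \<le> sqrt (B * t / real n)"
  proof -
    have "B / real n * signal_sq z \<le> B / real n * t" using t B_pos by (intro mult_left_mono) auto
    then have "expectation (\<lambda>\<omega>. (lin_part s (X \<omega>) z)\<^sup>2) \<le> B * t / real n"
      using lin_part_sq(2)[of z] by simp
    then show "integrable M (\<lambda>\<omega>. \<bar>lin_part s (X \<omega>) z\<bar>)"
      "expectation (\<lambda>\<omega>. \<bar>lin_part s (X \<omega>) z\<bar>) \<le> sqrt (B * t / real n)"
      using expectation_abs_le_sqrt[OF _ lin_part_sq(1)] by simp_all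
  qed
  \<comment> \<open>Here the trivial bound \<open>n\<close> is enough: the form is divided by
    \<open>n\<close> and keeps its gain \<open>1 / sqrt n\<close>.\<close>
  have "\<bar>kernel z l l\<bar> \<le> real n" if "l \<in> {1..n}" for l
  proof -
    have "0 \<le> kernel z l l" using z01 by (auto simp: kernel_def intro!: sum_nonneg)
    moreover have "kernel z l l \<le> (\<Sum>j=1..n. (\<phi> j l)\<^sup>2)"
      unfolding kernel_def by (intro sum_mono) (auto simp: z_def power2_eq_square)
    ultimately show ?thesis using phi_sq_sum[OF that] by simp
  qed
  note diag = diag_part_abs[of z "real n", OF this]
  have offdiag: "integrable M (\<lambda>\<omega>. \<bar>offdiag_part s (X \<omega>) z\<bar>)"
    "expectation (\<lambda>\<omega>. \<bar>offdiag_part s (X \<omega>) z\<bar>) \<le> sqrt (4 * B\<^sup>2 * real n)"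
  proof -
    have "(\<Sum>j=1..n. (z j)\<^sup>2) \<le> (\<Sum>j=1..n. 1)" using z01 by (intro sum_mono) auto
    then have "penalty s z \<le> real n * B / real n"
      unfolding penalty_def using mean_var_bounds[of s B, OF s_bounded]
      by (intro divide_right_mono mult_mono) auto
    then have "4 * B * real n * penalty s z \<le> 4 * B * real n * B"
      using B_pos n_pos by (intro mult_left_mono) auto
    then have "expectation (\<lambda>\<omega>. (offdiag_part s (X \<omega>) z)\<^sup>2) \<le> 4 * B\<^sup>2 * real n"
      using offdiag_part_sq(2)[of z] by (simp add: power2_eq_square mult_ac)
    then show "integrable M (\<lambda>\<omega>. \<bar>offdiag_part s (X \<omega>) z\<bar>)"
      "expectation (\<lambda>\<omega>. \<bar>offdiag_part s (X \<omega>) z\<bar>) \<le> sqrt (4 * B\<^sup>2 * real n)"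
      using expectation_abs_le_sqrt[OF _ offdiag_part_sq(1)] by simp_all
  qed
  let ?R = "\<lambda>\<omega>. t + 2 * \<bar>lin_part s (X \<omega>) z\<bar>
      + (1 / real n) * \<bar>diag_part s (X \<omega>) z\<bar> + (1 / real n) * \<bar>offdiag_part s (X \<omega>) z\<bar> + 2 * real d * B / real n"
  have intR: "integrable M ?R"
    by (intro Bochner_Integration.integrable_add integrable_mult_right lin(1) diag(1) offdiag(1)) auto
  show int: "integrable M (\<lambda>\<omega>. \<bar>var_hat n d (data s (X \<omega>)) - mean_var s\<bar>)"
    by (rule Bochner_Integration.integrable_bound[OF intR]) (auto simp only: real_norm_def abs_abs intro!: AE_I2 order_trans[OF bound abs_ge_self], measurable)
  have "expectation (\<lambda>\<omega>. \<bar>var_hat n d (data s (X \<omega>)) - mean_var s\<bar>) \<le> expectation ?R"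
    by (intro integral_mono int intR bound)
  also have "\<dots> = t + 2 * expectation (\<lambda>\<omega>. \<bar>lin_part s (X \<omega>) z\<bar>)
      + (1 / real n) * expectation (\<lambda>\<omega>. \<bar>diag_part s (X \<omega>) z\<bar>)
      + (1 / real n) * expectation (\<lambda>\<omega>. \<bar>offdiag_part s (X \<omega>) z\<bar>) + 2 * real d * B / real n"
    using lin(1) diag(1) offdiag(1) by (simp add: prob_space)
  also have "\<dots> \<le> t + 2 * sqrt (B * t / real n) + (1 / real n) * (real n * B * (sqrt \<mu>4 / sqrt (real n)))
      + (1 / real n) * sqrt (4 * B\<^sup>2 * real n) + 2 * real d * B / real n"
    using lin(2) diag(2) offdiag(2) by (intro add_mono mult_left_mono) auto
  also have "(1 / real n) * (real n * B * (sqrt \<mu>4 / sqrt (real n))) = sqrt \<mu>4 * B / sqrt (real n)"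
    using n_pos by simp
  also have "(1 / real n) * sqrt (4 * B\<^sup>2 * real n) = 2 * B / sqrt (real n)"
  proof -
    have "sqrt (4 * B\<^sup>2 * real n) = 2 * B * sqrt (real n)"
      using B_pos by (simp add: real_sqrt_mult)
    moreover have "sqrt (real n) * sqrt (real n) = real n" by simp
    ultimately show ?thesis using n_pos by (simp add: field_simps del: real_sqrt_mult_self)
  qed
  finally show "expectation (\<lambda>\<omega>. \<bar>var_hat n d (data s (X \<omega>)) - mean_var s\<bar>)
      \<le> t + 2 * sqrt (B * t / real n) + 2 * real d * B / real n + (sqrt \<mu>4 + 2) * B / sqrt (real n)"
    by (simp add: algebra_simps add_divide_distrib)
qed

end

text \<open>The space \<open>N\<close> is arbitrary because two instances are required: the product
  of the coordinate spaces for the separation of levels and noise, and the square of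
  \<open>M\<close> for the measurability of the conditional risk.\<close>

lemma (in regression) measurable_loss_remainder:
  assumes [measurable]: "\<And>l. l \<in> {1..n} \<Longrightarrow> (\<lambda>z. a z l) \<in> borel_measurable N"
    "\<And>l. l \<in> {1..n} \<Longrightarrow> (\<lambda>z. b z l) \<in> borel_measurable N"
  shows "(\<lambda>z. loss (a z) (b z) w) \<in> borel_measurable N"
    and "(\<lambda>z. remainder d L B \<rho> w0 (a z) (b z)) \<in> borel_measurable N"
    and "(\<lambda>z. penalty (a z) w) \<in> borel_measurable N"
proof -
  have [measurable]: "(\<lambda>z. coeff_err (a z) (b z) j) \<in> borel_measurable N" for j
    unfolding coeff_err_def theta_hat_def by measurable
  show [measurable]: "(\<lambda>z. penalty (a z) w) \<in> borel_measurable N" for w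
    unfolding penalty_def mean_var_def by measurable
  have [measurable]: "(\<lambda>z. lin_part (a z) (b z) y) \<in> borel_measurable N"
    "(\<lambda>z. diag_part (a z) (b z) w) \<in> borel_measurable N"
    "(\<lambda>z. offdiag_part (a z) (b z) w) \<in> borel_measurable N"
    "(\<lambda>z. var_hat n d (data (a z) (b z))) \<in> borel_measurable N"
    "(\<lambda>z. mean_var (a z)) \<in> borel_measurable N" for y w
    unfolding lin_part_def diag_part_def offdiag_part_def var_hat_def theta_hat_data mean_var_def by measurable
  show "(\<lambda>z. loss (a z) (b z) w) \<in> borel_measurable N"
    unfolding loss_def theta_hat_data by measurable
  show "(\<lambda>z. remainder d L B \<rho> w0 (a z) (b z)) \<in> borel_measurable N"
    unfolding remainder_def by measurable
qed

lemma u_const_nonneg: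
  assumes "finite L" "L \<noteq> {}" "n \<ge> 1"
  shows "0 \<le> u_const i n L"
proof -
  obtain w where "w \<in> L" using assms by auto
  then show ?thesis using u_const_upper[OF assms(1), of w 1 n i] assms abs_ge_zero order_trans by fastforce
qed

text \<open>Mirrors \<open>remainder\<close> term by term, with \<open>q\<close> for the mean error
  of the variance estimator. The comparison with \<open>D_const\<close> is then purely
  numerical.\<close>

definition remainder_const ::
  "nat \<Rightarrow> (nat \<Rightarrow> real) set \<Rightarrow> real \<Rightarrow> real \<Rightarrow> real \<Rightarrow> real \<Rightarrow> real" where
  "remainder_const n L B \<mu> \<rho> q =
     real (card L) * (B / real n) / \<rho> + real (card L) * (B / real n) / (1 - \<rho>)
   + 4 * B * u_const 1 n L / real n
   + 4 / real n * (real (card L) * ((v_const n L + u_const 1 n L) * B * (sqrt \<mu> / sqrt (real n))))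
   + 2 / (\<rho> * (real n)\<^sup>2) * (real (card L) * (4 * B * real n))
   + 2 * (1 + \<rho>) * v_const n L / real n * q"

context noisy_regression
begin

text \<open>Every normalized square has a moment bound that does not depend on the weight, so a sum
  over \<open>L\<close> costs its cardinality. Where a normalizer is zero, the quotient is zero by
  convention.\<close>

lemma remainder_expectation:
  assumes L: "finite L" "\<And>v j. v \<in> L \<Longrightarrow> j \<in> {1..n} \<Longrightarrow> v j \<in> {0..1}"
    and w0: "w0 \<in> L" and \<rho>: "0 < \<rho>" "\<rho> < 1" and d: "d \<le> n" and tail: "(\<Sum>j=d+1..n. (\<theta> j)\<^sup>2) \<le> t"
    and q: "t + 2 * sqrt (B * t / real n) + 2 * real d * B / real n + (sqrt \<mu>4 + 2) * B / sqrt (real n) \<le> q"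
  shows "integrable M (\<lambda>\<omega>. remainder d L B \<rho> w0 s (X \<omega>))"
    and "\<And>\<omega>. 0 \<le> remainder d L B \<rho> w0 s (X \<omega>)"
    and "expectation (\<lambda>\<omega>. remainder d L B \<rho> w0 s (X \<omega>)) \<le> remainder_const n L B \<mu>4 \<rho> q"
proof -
  have u1: "0 \<le> u_const 1 n L" using w0 L n_pos by (intro u_const_nonneg) auto
  have v: "0 \<le> v_const n L"
    using weight_sums(1)[of w0] v_const_upper[OF L(1) w0, of n] L(2)[OF w0] by fastforce
  have pen: "0 \<le> penalty s v" for v
    using mean_var_bounds(1)[of s B, OF s_bounded] by (simp add: penalty_def sum_nonneg)
  have lin: "expectation (\<lambda>\<omega>. (lin_part s (X \<omega>) y)\<^sup>2 / signal_sq z) \<le> B / real n"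
    if "signal_sq y \<le> signal_sq z" for y z
  proof (cases "signal_sq z = 0")
    case True
    then show ?thesis using B_pos by simp
  next
    case False
    then have pos: "0 < signal_sq z" using signal_sq_nonneg[of z] by simp
    have "expectation (\<lambda>\<omega>. (lin_part s (X \<omega>) y)\<^sup>2 / signal_sq z) \<le> (B / real n * signal_sq z) / signal_sq z"
      unfolding integral_divide_zero
      using that B_pos pos by (intro divide_right_mono order_trans[OF lin_part_sq(2)] mult_left_mono) auto
    then show ?thesis using pos by simp
  qed
  have sig: "signal_sq (\<lambda>j. (v j - w0 j)\<^sup>2) \<le> signal_sq (\<lambda>j. v j - w0 j)" if "v \<in> L" for v
    \<comment> \<open>Weights in the unit interval differ by at most 1, so squaring the weight
      difference cannot increase the proxy. Both linear forms may therefore share one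
      normalizer.\<close>
    unfolding signal_sq_def
  proof (intro sum_mono mult_right_mono)
    fix j assume "j \<in> {1..n}"
    then have "\<bar>v j - w0 j\<bar> \<le> 1" using L(2)[OF that, of j] L(2)[OF w0, of j] by auto
    then have "(v j - w0 j)\<^sup>2 \<le> 1" by (simp add: abs_square_le_1)
    then have "(v j - w0 j)\<^sup>2 * (v j - w0 j)\<^sup>2 \<le> (v j - w0 j)\<^sup>2 * 1" by (intro mult_left_mono) auto
    then show "((v j - w0 j)\<^sup>2)\<^sup>2 \<le> (v j - w0 j)\<^sup>2" by (simp add: power2_eq_square)
  qed auto
  have ker: "\<bar>kernel v l l\<bar> \<le> v_const n L + u_const 1 n L" if "v \<in> L" "l \<in> {1..n}" for v l
  proof -
    have "kernel v l l = (\<Sum>j=1..n. v j) + (\<Sum>j=1..n. v j ^ 1 * ((trig_basis j (design n l))\<^sup>2 - 1))"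
      by (simp add: kernel_def \<phi>_def power2_eq_square right_diff_distrib sum_subtractf)
    then show ?thesis
      using u_const_upper[OF L(1) that, of 1] v_const_upper[OF L(1) that(1), of n] weight_sums(1)[of v] L(2)[OF that(1)]
      by fastforce
  qed
  have off: "expectation (\<lambda>\<omega>. (offdiag_part s (X \<omega>) v)\<^sup>2 / penalty s v) \<le> 4 * B * real n" for v
  proof (cases "penalty s v = 0")
    case True
    then show ?thesis using B_pos n_pos by simp
  next
    case False
    then have pos: "0 < penalty s v" using pen[of v] by simp
    have "expectation (\<lambda>\<omega>. (offdiag_part s (X \<omega>) v)\<^sup>2 / penalty s v) \<le> (4 * B * real n * penalty s v) / penalty s v"
      unfolding integral_divide_zero using pos by (intro divide_right_mono offdiag_part_sq) auto
    then show ?thesis using pos by simp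
  qed
  note ints = lin_part_sq(1) diag_part_abs(1)[OF ker] offdiag_part_sq(1) var_hat_error(1)[OF d tail]
  show "integrable M (\<lambda>\<omega>. remainder d L B \<rho> w0 s (X \<omega>))"
    unfolding remainder_def using u1 v
    by (intro Bochner_Integration.integrable_add Bochner_Integration.integrable_sum integrable_mult_right
        integrable_divide_zero ints) auto
  show "0 \<le> remainder d L B \<rho> w0 s (X \<omega>)" for \<omega>
    unfolding remainder_def using u1 v \<rho> pen B_pos signal_sq_nonneg
    by (intro add_nonneg_nonneg mult_nonneg_nonneg divide_nonneg_nonneg sum_nonneg) auto
  have "expectation (\<lambda>\<omega>. remainder d L B \<rho> w0 s (X \<omega>)) =
     (\<Sum>v\<in>L. expectation (\<lambda>\<omega>. (lin_part s (X \<omega>) (\<lambda>j. v j - w0 j))\<^sup>2 / signal_sq (\<lambda>j. v j - w0 j))) / \<rho>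
   + (\<Sum>v\<in>L. expectation (\<lambda>\<omega>. (lin_part s (X \<omega>) (\<lambda>j. (v j - w0 j)\<^sup>2))\<^sup>2 / signal_sq (\<lambda>j. v j - w0 j))) / (1 - \<rho>)
   + 4 * B * u_const 1 n L / real n
   + 4 / real n * (\<Sum>v\<in>L. expectation (\<lambda>\<omega>. \<bar>diag_part s (X \<omega>) v\<bar>))
   + 2 / (\<rho> * (real n)\<^sup>2) * (\<Sum>v\<in>L. expectation (\<lambda>\<omega>. (offdiag_part s (X \<omega>) v)\<^sup>2 / penalty s v))
   + 2 * (1 + \<rho>) * v_const n L / real n * expectation (\<lambda>\<omega>. \<bar>var_hat n d (data s (X \<omega>)) - mean_var s\<bar>)"
    (is "?E = ?R")
  proof -
    have i1: "integrable M (\<lambda>\<omega>. (\<Sum>v\<in>L. (lin_part s (X \<omega>) (\<lambda>j. v j - w0 j))\<^sup>2 / signal_sq (\<lambda>j. v j - w0 j)))"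
      by (intro Bochner_Integration.integrable_sum integrable_divide_zero ints)
    have i2: "integrable M (\<lambda>\<omega>. (\<Sum>v\<in>L. (lin_part s (X \<omega>) (\<lambda>j. (v j - w0 j)\<^sup>2))\<^sup>2 / signal_sq (\<lambda>j. v j - w0 j)))"
      by (intro Bochner_Integration.integrable_sum integrable_divide_zero ints)
    have i3: "integrable M (\<lambda>\<omega>. (\<Sum>v\<in>L. \<bar>diag_part s (X \<omega>) v\<bar>))"
      using u1 v by (intro Bochner_Integration.integrable_sum ints) auto
    have i4: "integrable M (\<lambda>\<omega>. (\<Sum>v\<in>L. (offdiag_part s (X \<omega>) v)\<^sup>2 / penalty s v))"
      by (intro Bochner_Integration.integrable_sum integrable_divide_zero ints)
    show ?thesis
      unfolding remainder_def using i1 i2 i3 i4 ints(4) u1 v ints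
      by (simp add: prob_space Bochner_Integration.integral_sum)
  qed
  also have "?R \<le> (\<Sum>v\<in>L. B / real n) / \<rho> + (\<Sum>v\<in>L. B / real n) / (1 - \<rho>) + 4 * B * u_const 1 n L / real n
   + 4 / real n * (\<Sum>v\<in>L. (v_const n L + u_const 1 n L) * B * (sqrt \<mu>4 / sqrt (real n)))
   + 2 / (\<rho> * (real n)\<^sup>2) * (\<Sum>v\<in>L. 4 * B * real n)
   + 2 * (1 + \<rho>) * v_const n L / real n * q"
    using \<rho> u1 v n_pos
    by (intro add_mono divide_right_mono mult_left_mono sum_mono lin sig order_refl off
        diag_part_abs(2)[OF ker] order_trans[OF var_hat_error(2)[OF d tail] q]) auto
  also have "\<dots> = remainder_const n L B \<mu>4 \<rho> q"
    by (simp add: remainder_const_def)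
  finally show "?E \<le> remainder_const n L B \<mu>4 \<rho> q" .
qed

end

lemma remainder_const_le_D_const:
  fixes r B \<mu> \<rho> :: real
  assumes n: "n > 0" and d: "1 \<le> d" and \<rho>: "0 < \<rho>" "\<rho> < 1 / 3" and pos: "0 < B" "0 < r" "0 \<le> \<mu>"
    and uv: "0 \<le> u_const 1 n L" "0 \<le> u_const 2 n L" "0 \<le> v_const n L"
  defines "t \<equiv> 4 * r / (real d)\<^sup>2"
  defines "q \<equiv> t + 2 * sqrt (B * t / real n) + 2 * real d * B / real n + (sqrt \<mu> + 2) * B / sqrt (real n)"
  shows "(1 - \<rho>) * (2 * \<rho> * (B * u_const 2 n L / real n) + remainder_const n L B \<mu> \<rho> q)
    \<le> (1 - 3 * \<rho>) * ((1 / real n) * D_const n d L \<mu> B \<rho> r)"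
proof -
  define N where "N = sqrt (real n)"
  have N: "0 < N" "real n = N * N" using n by (auto simp: N_def)
  define Q where "Q = 2 * (sqrt \<mu> + sqrt 2) * B + var_star n d B r"
  define c where "c = real (card L)"
  define u where "u = u_const 1 n L"
  define v where "v = v_const n L"
  \<comment> \<open>The factor 2 is the ratio of \<open>4 * (1 - \<rho>^2)\<close> in
    \<open>kappa\<close> to \<open>2 * (1 + \<rho>)\<close> in the remainder times
    \<open>1 - \<rho>\<close>. It pays for \<open>2 * d\<close> against \<open>2 + d\<close>; the
    other terms fit without it.\<close>
  have q: "q * N \<le> 2 * Q"
  proof -
    have "sqrt (B * t / real n) = 2 * sqrt (r * B) / (real d * N)"
      using d by (simp add: t_def N_def real_sqrt_mult real_sqrt_divide mult_ac)
    then have "q * N = 4 * r * N / (real d)\<^sup>2 + 4 * sqrt (r * B) / real d + 2 * real d * B / N + (sqrt \<mu> + 2) * B"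
      unfolding q_def t_def N(2) N_def[symmetric] using N(1) by (simp add: field_simps)
    moreover have "Q = 4 * r * N / (real d)\<^sup>2 + 4 * sqrt (r * B) / real d + (2 + real d) * B / N
        + 2 * (sqrt \<mu> + sqrt 2) * B"
      by (simp add: Q_def var_star_def N_def)
    moreover have "0 \<le> 4 * r * N / (real d)\<^sup>2" "0 \<le> 4 * sqrt (r * B) / real d"
      using N pos by auto
    moreover have "2 * real d * B / N \<le> 2 * ((2 + real d) * B / N)"
      using N pos by (simp add: field_simps)
    moreover have "(sqrt \<mu> + 2) * B \<le> 2 * (2 * (sqrt \<mu> + sqrt 2) * B)"
    proof -
      have gen: "m + 2 \<le> 2 * (2 * (m + x))" if "1 \<le> x" "0 \<le> m" for m x :: real
        using that by simp
      have "sqrt \<mu> + 2 \<le> 2 * (2 * (sqrt \<mu> + sqrt 2))"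
        by (rule gen) (use pos(3) in simp_all)
      from mult_right_mono[OF this, of B] show ?thesis using pos by simp
    qed
    moreover have "x \<le> 2 * y" if "x = a + b + c + e" "y = a + b + c' + e'" "0 \<le> a" "0 \<le> b"
      "c \<le> 2 * c'" "e \<le> 2 * e'" for x y a b c e c' e' :: real
      using that by linarith
    ultimately show ?thesis by blast
  qed
  have k: "(1 - 3 * \<rho>) * D_const n d L \<mu> B \<rho> r
     = (1 - \<rho>) * Upsilon_star n L \<mu> \<rho> * B + 2 * c * B / \<rho> + 2 * \<rho> * (1 - \<rho>) * u_const 2 n L * B
       + 4 * (1 - \<rho>\<^sup>2) * Q * (v / N)"
  proof -
    define K where "K = 1 - 3 * \<rho>"
    have "K \<noteq> 0" "\<rho> \<noteq> 0" using \<rho> by (auto simp: K_def)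
    then have "K * D_const n d L \<mu> B \<rho> r
     = (\<rho> * (1 - \<rho>) * Upsilon_star n L \<mu> \<rho> + 2 * c + 2 * \<rho>\<^sup>2 * (1 - \<rho>) * u_const 2 n L) / \<rho> * B
       + 4 * (1 - \<rho>\<^sup>2) * Q * (v / N)"
      unfolding D_const_def Psi_const_def kappa_def Q_def[symmetric] K_def[symmetric] v_def[symmetric] N_def[symmetric]
        c_def[symmetric] by (simp add: distrib_left)
    also have "(\<rho> * (1 - \<rho>) * Upsilon_star n L \<mu> \<rho> + 2 * c + 2 * \<rho>\<^sup>2 * (1 - \<rho>) * u_const 2 n L) / \<rho> * B
      = (1 - \<rho>) * Upsilon_star n L \<mu> \<rho> * B + 2 * c * B / \<rho> + 2 * \<rho> * (1 - \<rho>) * u_const 2 n L * B"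
      using \<open>\<rho> \<noteq> 0\<close> by (simp add: power2_eq_square add_divide_distrib distrib_right)
    finally show ?thesis by (simp add: K_def)
  qed
  have rc: "real n * remainder_const n L B \<mu> \<rho> q = c * B / \<rho> + c * B / (1 - \<rho>) + 4 * B * u
     + 4 * (c * ((v + u) * B * (sqrt \<mu> / N))) + 8 * (c * B) / \<rho> + 2 * (1 + \<rho>) * v * q"
  proof -
    have "\<rho> \<noteq> 0" "1 - \<rho> \<noteq> 0" using \<rho> by auto
    then show ?thesis
      unfolding remainder_const_def c_def[symmetric] u_def[symmetric] v_def[symmetric] N_def[symmetric]
      using n by (simp add: distrib_left power2_eq_square)
  qed
  have "(1 - \<rho>) * (2 * (1 + \<rho>) * v * q) \<le> 4 * (1 - \<rho>\<^sup>2) * Q * (v / N)"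
  proof -
    have "q \<le> 2 * Q / N" using q N by (simp add: field_simps)
    then have "(2 * (1 - \<rho>\<^sup>2) * v) * q \<le> (2 * (1 - \<rho>\<^sup>2) * v) * (2 * Q / N)"
      using uv \<rho> by (intro mult_left_mono) (auto simp: v_def abs_square_le_1)
    then show ?thesis by (simp add: power2_eq_square algebra_simps)
  qed
  moreover have "(1 - \<rho>) * (c * B / \<rho> + c * B / (1 - \<rho>) + 4 * B * u
     + 4 * (c * ((v + u) * B * (sqrt \<mu> / N))) + 8 * (c * B) / \<rho>)
     \<le> (1 - \<rho>) * Upsilon_star n L \<mu> \<rho> * B + 2 * c * B / \<rho>"
  proof -
    have U: "Upsilon_star n L \<mu> \<rho> * B = 16 * (c * B / \<rho>) + 4 * B * u + 4 * (c * ((v + u) * B * (sqrt \<mu> / N)))"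
      unfolding Upsilon_star_def c_def[symmetric] u_def[symmetric] v_def[symmetric] N_def[symmetric]
      by (simp add: algebra_simps)
    \<comment> \<open>One \<open>y\<close> comes from the first linear form and eight from the
      off-diagonal form, covered by the 16 in \<open>Upsilon_star\<close>. The second linear form
      becomes \<open>c * B\<close> and is paid by the summand \<open>2 * card L\<close> of
      \<open>Psi_const\<close>.\<close>
    define y where "y = c * B / \<rho>"
    define W where "W = 4 * B * u + 4 * (c * ((v + u) * B * (sqrt \<mu> / N)))"
    have cB: "0 \<le> y" using \<rho> pos by (simp add: y_def c_def)
    have "(1 - \<rho>) * (c * B / (1 - \<rho>)) = c * B" using \<rho> by simp
    also have "\<dots> \<le> c * B / \<rho>" using \<rho> pos mult_left_le[of \<rho> "c * B"] by (simp add: c_def pos_le_divide_eq)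
    finally have 1: "(1 - \<rho>) * (c * B / (1 - \<rho>)) \<le> y" by (simp add: y_def)
    have 2: "(1 - \<rho>) * (9 * y) \<le> (1 - \<rho>) * (16 * y)"
      using \<rho> by (intro mult_left_mono mult_right_mono[OF _ cB]) auto
    have "c * B / \<rho> + c * B / (1 - \<rho>) + 4 * B * u + 4 * (c * ((v + u) * B * (sqrt \<mu> / N))) + 8 * (c * B) / \<rho>
        = 9 * y + c * B / (1 - \<rho>) + W" by (simp add: y_def W_def)
    moreover have "(1 - \<rho>) * Upsilon_star n L \<mu> \<rho> * B + 2 * c * B / \<rho> = (1 - \<rho>) * (16 * y + W) + 2 * y"
      unfolding mult.assoc U by (simp add: y_def W_def)
    moreover have "(1 - \<rho>) * (9 * y + c * B / (1 - \<rho>) + W) \<le> (1 - \<rho>) * (16 * y + W) + 2 * y"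
      unfolding distrib_left using 1 2 cB by linarith
    ultimately show ?thesis by (simp only:)
  qed
  ultimately have "(1 - \<rho>) * (2 * \<rho> * (B * u_const 2 n L) + real n * remainder_const n L B \<mu> \<rho> q)
      \<le> (1 - 3 * \<rho>) * D_const n d L \<mu> B \<rho> r"
    unfolding k rc by (simp add: algebra_simps)
  then have "(1 - \<rho>) * (2 * \<rho> * (B * u_const 2 n L) + real n * remainder_const n L B \<mu> \<rho> q) / real n
      \<le> (1 - 3 * \<rho>) * D_const n d L \<mu> B \<rho> r / real n"
    by (rule divide_right_mono) simp
  then show ?thesis using n by (simp add: add_divide_distrib distrib_left)
qed

section \<open>The oracle inequality\<close>

lemma (in regression) penalty_le:
  assumes "\<And>l. l \<in> {1..n} \<Longrightarrow> (s l)\<^sup>2 \<le> B"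
  shows "0 \<le> penalty s w" "penalty s w \<le> (\<Sum>j=1..n. (w j)\<^sup>2) * B / real n"
  using mean_var_bounds[OF assms] unfolding penalty_def
  by (auto intro!: mult_nonneg_nonneg divide_nonneg_nonneg divide_right_mono mult_left_mono sum_nonneg)

text \<open>The comparator \<open>w0\<close> is nonrandom, so its loss and penalty can be averaged
  over the noise at frozen levels. The random choice \<open>w_hat\<close> enters only through the
  pathwise inequality, whose right-hand side no longer contains it.\<close>

lemma oracle_inequality:
  fixes M :: "'a measure" and \<sigma> \<xi> :: "nat \<Rightarrow> 'a \<Rightarrow> real" and L :: "(nat \<Rightarrow> real) set"
  assumes prob: "prob_space M"
    and xi_indep: "prob_space.indep_vars M (\<lambda>_. borel) \<xi> {1..}"
    and xi_ident: "\<And>j. 1 \<le> j \<Longrightarrow> distr M borel (\<xi> j) = distr M borel (\<xi> 1)"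
    and xi_mean: "integral\<^sup>L M (\<xi> 1) = 0"
    and xi_var: "integral\<^sup>L M (\<lambda>\<omega>. (\<xi> 1 \<omega>)\<^sup>2) = 1"
    and xi_fourth: "integrable M (\<lambda>\<omega>. (\<xi> 1 \<omega>) ^ 4)" "integral\<^sup>L M (\<lambda>\<omega>. (\<xi> 1 \<omega>) ^ 4) = \<mu>"
    and indep: "prob_space.indep_var M
        (Pi\<^sub>M {1..n} (\<lambda>_. borel)) (\<lambda>\<omega>. \<lambda>l\<in>{1..n}. \<sigma> l \<omega>)
        (Pi\<^sub>M {1..} (\<lambda>_. borel)) (\<lambda>\<omega>. \<lambda>j\<in>{1..}. \<xi> j \<omega>)"
    and B: "0 < B" "AE \<omega> in M. \<forall>l\<in>{1..n}. 0 < \<sigma> l \<omega> \<and> (\<sigma> l \<omega>)\<^sup>2 \<le> B"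
    and r: "0 < r" and S: "S \<in> sobolev_ball r"
    and L: "finite L" "L \<subseteq> {1..n} \<rightarrow>\<^sub>E {0..1}" and w0: "w0 \<in> L"
    and d: "1 \<le> d" "d \<le> n" and n: "odd n" and \<rho>: "0 < \<rho>" "\<rho> < 1 / 3"
    and w_hat: "\<And>\<omega>. \<omega> \<in> space M \<Longrightarrow>
        is_arg_min (cost n d \<rho> (observations n S \<sigma> \<xi> \<omega>)) (\<lambda>w. w \<in> L) (w_hat \<omega>)"
  shows "(\<integral>\<omega>. empirical_norm_sq n (\<lambda>x. S_hat n (observations n S \<sigma> \<xi> \<omega>) (w_hat \<omega>) x - S x) \<partial>M)
    \<le> (1 + 3 * \<rho> - 2 * \<rho>\<^sup>2) / (1 - 3 * \<rho>) *
        (\<integral>\<omega>. empirical_norm_sq n (\<lambda>x. S_hat n (observations n S \<sigma> \<xi> \<omega>) w0 x - S x) \<partial>M)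
      + (1 / real n) * D_const n d L \<mu> B \<rho> r"
proof -
  interpret prob_space M by (rule prob)
  define f where "f l = S (design n l)" for l
  interpret R: regression n f by unfold_locales (rule n)
  define A where "A \<omega> = (\<lambda>l\<in>{1..n}. \<sigma> l \<omega>)" for \<omega>
  define Y where "Y \<omega> = (\<lambda>j\<in>{1..}. \<xi> j \<omega>)" for \<omega>
  define t where "t = 4 * r / (real d)\<^sup>2"
  define q where "q = t + 2 * sqrt (B * t / real n) + 2 * real d * B / real n + (sqrt \<mu> + 2) * B / sqrt (real n)"
  define u2 where "u2 = u_const 2 n L"
  let ?c = "remainder_const n L B \<mu> \<rho> q"
  let ?PA = "Pi\<^sub>M {1..n} (\<lambda>_. borel) :: (nat \<Rightarrow> real) measure"
  let ?PY = "Pi\<^sub>M {1..} (\<lambda>_. borel) :: (nat \<Rightarrow> real) measure"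
  have unit: "v j \<in> {0..1}" if "v \<in> L" "j \<in> {1..n}" for v j
    using L(2) that by (auto simp: PiE_iff)
  have \<rho>1: "\<rho> < 1" using \<rho> by simp
  have n0: "n > 0" using n by (auto intro: Nat.gr0I)
  have indepAY: "indep_var ?PA A ?PY Y"
    using indep by (simp add: A_def[abs_def] Y_def[abs_def])
  have [measurable]: "A \<in> measurable M ?PA" "Y \<in> measurable M ?PY"
    using indepAY by (blast dest: indep_var_rv1 indep_var_rv2)+
  have comp[measurable]: "(\<lambda>z. fst z l) \<in> borel_measurable (?PA \<Otimes>\<^sub>M ?PY)"
    "(\<lambda>z. snd z l) \<in> borel_measurable (?PA \<Otimes>\<^sub>M ?PY)" if "l \<in> {1..n}" for l
    using that by (auto intro!: measurable_compose[OF measurable_fst] measurable_compose[OF measurable_snd] measurable_component_singleton)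
  have meas2: "(\<lambda>z. R.loss (fst z) (snd z) w) \<in> borel_measurable (?PA \<Otimes>\<^sub>M ?PY)"
    "(\<lambda>z. R.remainder d L B \<rho> w0 (fst z) (snd z)) \<in> borel_measurable (?PA \<Otimes>\<^sub>M ?PY)"
    "(\<lambda>z. R.penalty (fst z) w) \<in> borel_measurable (?PA \<Otimes>\<^sub>M ?PY)" for w
    by (rule R.measurable_loss_remainder[OF comp]; assumption)+
  have AY: "(\<lambda>\<omega>. (A \<omega>, Y \<omega>)) \<in> measurable M (?PA \<Otimes>\<^sub>M ?PY)" by measurable
  have [measurable]: "(\<lambda>\<omega>. R.loss (A \<omega>) (Y \<omega>) w) \<in> borel_measurable M"
    "(\<lambda>\<omega>. R.remainder d L B \<rho> w0 (A \<omega>) (Y \<omega>)) \<in> borel_measurable M"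
    "(\<lambda>\<omega>. R.penalty (A \<omega>) w) \<in> borel_measurable M" for w
    using measurable_compose[OF AY meas2(1)] measurable_compose[OF AY meas2(2)] measurable_compose[OF AY meas2(3)]
    by simp_all
  have theta: "theta_hat n (observations n S \<sigma> \<xi> \<omega>) j = theta_hat n (R.data (A \<omega>) (Y \<omega>)) j" for \<omega> j
    by (rule theta_hat_cong) (simp add: observations_def R.data_def f_def A_def Y_def)
  have loss: "empirical_norm_sq n (\<lambda>x. S_hat n (observations n S \<sigma> \<xi> \<omega>) w x - S x) = R.loss (A \<omega>) (Y \<omega>) w" for \<omega> w
    unfolding empirical_loss_eq[OF n] theta R.loss_def R.\<theta>_def by (simp only: f_def[abs_def])
  have cost: "cost n d \<rho> (observations n S \<sigma> \<xi> \<omega>) w = cost n d \<rho> (R.data (A \<omega>) (Y \<omega>)) w" for \<omega> w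
    unfolding cost_def theta_tilde_def penalty_hat_def var_hat_def theta ..
  have tail: "(\<Sum>j=d+1..n. (R.\<theta> j)\<^sup>2) \<le> t"
    unfolding R.\<theta>_def f_def t_def by (rule fourier_tail_bound[OF S n d(1)])
  have moments: "integrable M (\<lambda>\<omega>. \<xi> j \<omega> ^ m) \<longleftrightarrow> integrable M (\<lambda>\<omega>. \<xi> 1 \<omega> ^ m)"
    "expectation (\<lambda>\<omega>. \<xi> j \<omega> ^ m) = expectation (\<lambda>\<omega>. \<xi> 1 \<omega> ^ m)" if "1 \<le> j" for j m
  proof -
    have [measurable]: "\<xi> j \<in> borel_measurable M" "\<xi> 1 \<in> borel_measurable M"
      using xi_indep that by (auto simp: indep_vars_def)
    have p: "(\<lambda>x::real. x ^ m) \<in> borel_measurable borel" by measurable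
    show "integrable M (\<lambda>\<omega>. \<xi> j \<omega> ^ m) \<longleftrightarrow> integrable M (\<lambda>\<omega>. \<xi> 1 \<omega> ^ m)"
      using integrable_distr_eq[OF \<open>\<xi> j \<in> _\<close> p] integrable_distr_eq[OF \<open>\<xi> 1 \<in> _\<close> p] xi_ident[OF that] by simp
    show "expectation (\<lambda>\<omega>. \<xi> j \<omega> ^ m) = expectation (\<lambda>\<omega>. \<xi> 1 \<omega> ^ m)"
      using integral_distr[OF \<open>\<xi> j \<in> _\<close> p] integral_distr[OF \<open>\<xi> 1 \<in> _\<close> p] xi_ident[OF that] by simp
  qed
  have Yxi: "(\<lambda>\<omega>. Y \<omega> l) = \<xi> l" if "l \<in> {1..n}" for l
    using that by (auto simp: Y_def)
  have noise: "noise M {1..n} (\<lambda>l \<omega>. Y \<omega> l) \<mu>"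
  proof unfold_locales
    have "indep_vars (\<lambda>_. borel) \<xi> {1..n}" by (rule indep_vars_subset[OF xi_indep]) auto
    then show "indep_vars (\<lambda>_. borel) (\<lambda>l \<omega>. Y \<omega> l) {1..n}"
      by (rule indep_vars_cong[THEN iffD1, rotated -1]) (auto simp: Yxi)
    fix i assume i: "i \<in> {1..n}"
    then have i1: "1 \<le> i" by simp
    have Yi: "Y \<omega> i = \<xi> i \<omega>" for \<omega> using i by (simp add: Y_def)
    show "integrable M (\<lambda>\<omega>. Y \<omega> i ^ 4)" "expectation (\<lambda>\<omega>. Y \<omega> i) = 0"
      "expectation (\<lambda>\<omega>. (Y \<omega> i)\<^sup>2) = 1" "expectation (\<lambda>\<omega>. Y \<omega> i ^ 4) = \<mu>"
      unfolding Yi using moments(1)[OF i1, of 4] moments(2)[OF i1, of 1] moments(2)[OF i1, of 2]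
        moments(2)[OF i1, of 4] xi_mean xi_var xi_fourth by simp_all
  qed simp
  define good where "good \<omega> \<longleftrightarrow> (\<forall>l\<in>{1..n}. 0 < A \<omega> l \<and> (A \<omega> l)\<^sup>2 \<le> B)" for \<omega>
  have AE_good: "AE \<omega> in M. good \<omega>" using B(2) by (simp add: good_def A_def)
  have NR: "noisy_regression n M (\<lambda>l \<omega>. Y \<omega> l) \<mu> (A \<omega>) B" if "good \<omega>" for \<omega>
    using that noise R.regression_axioms B(1)
    by (intro noisy_regression.intro noisy_regression_axioms.intro) (auto simp: good_def)
  have loss_nonneg: "0 \<le> R.loss s x w" for s x w by (simp add: R.loss_def sum_nonneg)
  have u2: "\<bar>\<Sum>j=1..n. (w0 j)\<^sup>2 * ((R.\<phi> j l)\<^sup>2 - 1)\<bar> \<le> u2" if "l \<in> {1..n}" for l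
    using u_const_upper[OF L(1) w0 that, of 2] by (simp add: R.\<phi>_def u2_def)
  have \<mu>0: "0 \<le> \<mu>" using xi_fourth(2) by (auto intro!: integral_nonneg_AE)
  have "0 \<le> (\<Sum>j=1..n. w0 j)" by (rule R.weight_sums(1)) (rule unit[OF w0])
  then have uv: "0 \<le> u_const 1 n L" "0 \<le> u2" "0 \<le> v_const n L"
    using u_const_nonneg[OF L(1), of n] w0 n0 v_const_upper[OF L(1) w0, of n]
    by (auto simp: u2_def)

  \<comment> \<open>The conditional risk given the levels: \<open>\<omega>\<close> fixes the levels
    while the noise is averaged over \<open>\<omega>'\<close>.\<close>
  let ?E = "\<lambda>\<omega>. expectation (\<lambda>\<omega>'. R.loss (A \<omega>) (Y \<omega>') w0)"
  have E_loss: "(\<integral>\<^sup>+\<omega>'. ennreal (R.loss (A \<omega>) (Y \<omega>') w0) \<partial>M) = ennreal (?E \<omega>)"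
    "?E \<omega> \<le> (\<Sum>j=1..n. (w0 j - 1)\<^sup>2 * (R.\<theta> j)\<^sup>2) + (1 / real n) * (\<Sum>j=1..n. (w0 j)\<^sup>2 * (2 * B))"
    "R.penalty (A \<omega>) w0 \<le> ?E \<omega> + B * u2 / real n" if "good \<omega>" for \<omega>
  proof -
    interpret noisy_regression n f M "\<lambda>l \<omega>. Y \<omega> l" \<mu> "A \<omega>" B by (rule NR[OF that])
    show "(\<integral>\<^sup>+\<omega>'. ennreal (R.loss (A \<omega>) (Y \<omega>') w0) \<partial>M) = ennreal (?E \<omega>)"
      using loss_expectation(1)[of w0] by (intro nn_integral_eq_integral) (auto simp: loss_nonneg)
    have "?E \<omega> = (\<Sum>j=1..n. (w0 j - 1)\<^sup>2 * (R.\<theta> j)\<^sup>2) + (1 / real n) * (\<Sum>j=1..n. (w0 j)\<^sup>2 * R.coeff_var (A \<omega>) j)"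
      using loss_expectation(2)[of w0] by simp
    also have "\<dots> \<le> (\<Sum>j=1..n. (w0 j - 1)\<^sup>2 * (R.\<theta> j)\<^sup>2) + (1 / real n) * (\<Sum>j=1..n. (w0 j)\<^sup>2 * (2 * B))"
      using R.coeff_var_bounds(2)[of "A \<omega>" B, OF s_bounded]
      by (intro add_mono order_refl mult_left_mono sum_mono) auto
    finally show "?E \<omega> \<le> (\<Sum>j=1..n. (w0 j - 1)\<^sup>2 * (R.\<theta> j)\<^sup>2) + (1 / real n) * (\<Sum>j=1..n. (w0 j)\<^sup>2 * (2 * B))" .
    show "R.penalty (A \<omega>) w0 \<le> ?E \<omega> + B * u2 / real n"
      using penalty_le_loss[of w0 u2, OF u2] by simp
  qed
  have nn_loss: "(\<integral>\<^sup>+\<omega>. ennreal (R.loss (A \<omega>) (Y \<omega>) w0) \<partial>M) = (\<integral>\<^sup>+\<omega>. ennreal (?E \<omega>) \<partial>M)"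
  proof -
    have "(\<integral>\<^sup>+\<omega>. ennreal (R.loss (A \<omega>) (Y \<omega>) w0) \<partial>M)
        = (\<integral>\<^sup>+\<omega>. \<integral>\<^sup>+\<omega>'. ennreal (R.loss (A \<omega>) (Y \<omega>') w0) \<partial>M \<partial>M)"
      using nn_integral_indep_var[OF indepAY, of "\<lambda>z. ennreal (R.loss (fst z) (snd z) w0)"] meas2(1) by simp
    also have "\<dots> = (\<integral>\<^sup>+\<omega>. ennreal (?E \<omega>) \<partial>M)"
      using AE_good by (intro nn_integral_cong_AE) (auto simp: E_loss)
    finally show ?thesis .
  qed
  have int_loss: "integrable M (\<lambda>\<omega>. R.loss (A \<omega>) (Y \<omega>) w0)"
  proof (rule integrableI_nonneg)
    \<comment> \<open>Bounded levels give the conditional risk a nonrandom bound, whence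
      integrability of the unconditional loss.\<close>
    have "(\<integral>\<^sup>+\<omega>. ennreal (?E \<omega>) \<partial>M)
        \<le> (\<integral>\<^sup>+\<omega>. ennreal ((\<Sum>j=1..n. (w0 j - 1)\<^sup>2 * (R.\<theta> j)\<^sup>2) + (1 / real n) * (\<Sum>j=1..n. (w0 j)\<^sup>2 * (2 * B))) \<partial>M)"
      by (intro nn_integral_mono_AE eventually_mono[OF AE_good] ennreal_leI E_loss(2))
    also have "\<dots> < \<infinity>" by (simp add: emeasure_space_1)
    finally show "(\<integral>\<^sup>+\<omega>. ennreal (R.loss (A \<omega>) (Y \<omega>) w0) \<partial>M) < \<infinity>" unfolding nn_loss .
  qed (auto simp: loss_nonneg)
  let ?l0 = "expectation (\<lambda>\<omega>. R.loss (A \<omega>) (Y \<omega>) w0)"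
  have pen: "integrable M (\<lambda>\<omega>. R.penalty (A \<omega>) w0)" "expectation (\<lambda>\<omega>. R.penalty (A \<omega>) w0) \<le> ?l0 + B * u2 / real n"
  proof -
    have bd: "AE \<omega> in M. 0 \<le> R.penalty (A \<omega>) w0" "AE \<omega> in M. \<bar>R.penalty (A \<omega>) w0\<bar> \<le> (\<Sum>j=1..n. (w0 j)\<^sup>2) * B / real n"
      using AE_good R.penalty_le[of "A _" B w0] by (auto simp: good_def elim!: eventually_mono)
    show int: "integrable M (\<lambda>\<omega>. R.penalty (A \<omega>) w0)"
      using bd(2) by (intro integrable_const_bound[where B = "(\<Sum>j=1..n. (w0 j)\<^sup>2) * B / real n"]) auto
    have "ennreal (expectation (\<lambda>\<omega>. R.penalty (A \<omega>) w0)) = (\<integral>\<^sup>+\<omega>. ennreal (R.penalty (A \<omega>) w0) \<partial>M)"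
      by (rule nn_integral_eq_integral[symmetric]) (use int bd in auto)
    also have "\<dots> \<le> (\<integral>\<^sup>+\<omega>. ennreal (?E \<omega>) + ennreal (B * u2 / real n) \<partial>M)"
    proof (intro nn_integral_mono_AE, use AE_good in eventually_elim)
      fix \<omega> assume "good \<omega>"
      have "0 \<le> ?E \<omega>" by (intro integral_nonneg_AE) (simp add: loss_nonneg)
      then have "ennreal (?E \<omega>) + ennreal (B * u2 / real n) = ennreal (?E \<omega> + B * u2 / real n)"
        using B(1) uv by (intro ennreal_plus[symmetric]) auto
      then show "ennreal (R.penalty (A \<omega>) w0) \<le> ennreal (?E \<omega>) + ennreal (B * u2 / real n)"
        using E_loss(3)[OF \<open>good \<omega>\<close>] by (simp add: ennreal_leI)
    qed
    also have "\<dots> = (\<integral>\<^sup>+\<omega>. ennreal (?E \<omega>) \<partial>M) + ennreal (B * u2 / real n)"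
    proof (rule trans[OF nn_integral_add])
      have "(\<lambda>z. R.loss (A (fst z)) (Y (snd z)) w0) \<in> borel_measurable (M \<Otimes>\<^sub>M M)"
        by (rule R.measurable_loss_remainder)
          (auto intro!: measurable_compose[OF measurable_compose[OF measurable_fst \<open>A \<in> _\<close>]]
            measurable_compose[OF measurable_compose[OF measurable_snd \<open>Y \<in> _\<close>]] measurable_component_singleton)
      then have "(\<lambda>\<omega>. ?E \<omega>) \<in> borel_measurable M"
        by (intro borel_measurable_lebesgue_integral) (simp add: case_prod_unfold)
      then show "(\<lambda>\<omega>. ennreal (?E \<omega>)) \<in> borel_measurable M" by measurable
    qed (auto simp: emeasure_space_1)
    also have "(\<integral>\<^sup>+\<omega>. ennreal (?E \<omega>) \<partial>M) = ennreal ?l0"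
      unfolding nn_loss[symmetric] by (rule nn_integral_eq_integral[OF int_loss]) (simp add: loss_nonneg)
    also have "ennreal ?l0 + ennreal (B * u2 / real n) = ennreal (?l0 + B * u2 / real n)"
      using B(1) uv by (intro ennreal_plus[symmetric] integral_nonneg_AE) (auto simp: loss_nonneg)
    finally show "expectation (\<lambda>\<omega>. R.penalty (A \<omega>) w0) \<le> ?l0 + B * u2 / real n"
      using B(1) uv by (subst (asm) ennreal_le_iff) (auto intro!: add_nonneg_nonneg integral_nonneg_AE simp: loss_nonneg)
  qed
  have rem_good: "0 \<le> R.remainder d L B \<rho> w0 (A \<omega>) (Y \<omega>')"
    "(\<integral>\<^sup>+\<omega>'. ennreal (R.remainder d L B \<rho> w0 (A \<omega>) (Y \<omega>')) \<partial>M) \<le> ennreal ?c" if "good \<omega>" for \<omega> \<omega>'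
  proof -
    interpret noisy_regression n f M "\<lambda>l \<omega>. Y \<omega> l" \<mu> "A \<omega>" B by (rule NR[OF that])
    have q: "t + 2 * sqrt (B * t / real n) + 2 * real d * B / real n + (sqrt \<mu> + 2) * B / sqrt (real n) \<le> q"
      by (simp add: q_def)
    have re: "integrable M (\<lambda>\<omega>'. R.remainder d L B \<rho> w0 (A \<omega>) (Y \<omega>'))"
      "\<And>\<omega>'. 0 \<le> R.remainder d L B \<rho> w0 (A \<omega>) (Y \<omega>')"
      "expectation (\<lambda>\<omega>'. R.remainder d L B \<rho> w0 (A \<omega>) (Y \<omega>')) \<le> ?c"
      by (rule remainder_expectation[OF L(1) _ w0 \<rho>(1) \<rho>1 d(2) tail q]; erule (1) unit)+
    show "0 \<le> R.remainder d L B \<rho> w0 (A \<omega>) (Y \<omega>')" by (rule re(2))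
    have "(\<integral>\<^sup>+\<omega>'. ennreal (R.remainder d L B \<rho> w0 (A \<omega>) (Y \<omega>')) \<partial>M)
        = ennreal (expectation (\<lambda>\<omega>'. R.remainder d L B \<rho> w0 (A \<omega>) (Y \<omega>')))"
      using re(1,2) by (intro nn_integral_eq_integral) auto
    also have "\<dots> \<le> ennreal ?c" by (intro ennreal_leI re(3))
    finally show "(\<integral>\<^sup>+\<omega>'. ennreal (R.remainder d L B \<rho> w0 (A \<omega>) (Y \<omega>')) \<partial>M) \<le> ennreal ?c" .
  qed
  have nn_rem: "(\<integral>\<^sup>+\<omega>. ennreal (R.remainder d L B \<rho> w0 (A \<omega>) (Y \<omega>)) \<partial>M) \<le> ennreal ?c"
  proof -
    have "(\<integral>\<^sup>+\<omega>. ennreal (R.remainder d L B \<rho> w0 (A \<omega>) (Y \<omega>)) \<partial>M)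
        = (\<integral>\<^sup>+\<omega>. \<integral>\<^sup>+\<omega>'. ennreal (R.remainder d L B \<rho> w0 (A \<omega>) (Y \<omega>')) \<partial>M \<partial>M)"
      using nn_integral_indep_var[OF indepAY, of "\<lambda>z. ennreal (R.remainder d L B \<rho> w0 (fst z) (snd z))"] meas2(2) by simp
    also have "\<dots> \<le> (\<integral>\<^sup>+\<omega>. ennreal ?c \<partial>M)"
      using AE_good by (intro nn_integral_mono_AE) (auto intro: rem_good(2))
    finally show ?thesis by (simp add: emeasure_space_1)
  qed
  have rem_nonneg: "AE \<omega> in M. 0 \<le> R.remainder d L B \<rho> w0 (A \<omega>) (Y \<omega>)"
    using AE_good by eventually_elim (rule rem_good)
  have c: "0 \<le> ?c"
  proof -
    have "0 \<le> t" using r by (simp add: t_def)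
    then have "0 \<le> q" using B(1) \<mu>0 by (auto simp: q_def intro!: add_nonneg_nonneg)
    then show ?thesis unfolding remainder_const_def using B(1) uv \<rho> \<mu>0
      by (intro add_nonneg_nonneg mult_nonneg_nonneg divide_nonneg_nonneg) auto
  qed
  have int_rem: "integrable M (\<lambda>\<omega>. R.remainder d L B \<rho> w0 (A \<omega>) (Y \<omega>))"
    by (rule integrableI_nonneg) (use rem_nonneg nn_rem in \<open>auto simp: le_less_trans\<close>)
  have E_rem: "expectation (\<lambda>\<omega>. R.remainder d L B \<rho> w0 (A \<omega>) (Y \<omega>)) \<le> ?c"
  proof -
    have "ennreal (expectation (\<lambda>\<omega>. R.remainder d L B \<rho> w0 (A \<omega>) (Y \<omega>))) \<le> ennreal ?c"
      using nn_rem nn_integral_eq_integral[OF int_rem rem_nonneg] by simp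
    then show ?thesis using c by (simp add: ennreal_le_iff)
  qed
  define k where "k = 1 - 3 * \<rho>"
  have k: "0 < k" using \<rho> by (simp add: k_def)
  let ?R = "\<lambda>\<omega>. ((1 + \<rho>) * R.loss (A \<omega>) (Y \<omega>) w0
      + (1 - \<rho>) * (2 * \<rho> * R.penalty (A \<omega>) w0 + R.remainder d L B \<rho> w0 (A \<omega>) (Y \<omega>))) / k"
  have intR: "integrable M ?R"
    by (intro integrable_divide_zero Bochner_Integration.integrable_add integrable_mult_right int_loss pen int_rem)
  have path: "AE \<omega> in M. R.loss (A \<omega>) (Y \<omega>) (w_hat \<omega>) \<le> ?R \<omega>"
    using AE_good AE_space
  proof eventually_elim
    fix \<omega> assume g: "good \<omega>" and "\<omega> \<in> space M"
    then have am: "w_hat \<omega> \<in> L" "cost n d \<rho> (R.data (A \<omega>) (Y \<omega>)) (w_hat \<omega>) \<le> cost n d \<rho> (R.data (A \<omega>) (Y \<omega>)) w0"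
      using w_hat[of \<omega>] w0 by (auto simp: is_arg_min_linorder cost)
    have mv: "0 < R.mean_var (A \<omega>)"
      using g n0 unfolding R.mean_var_def good_def
      by (intro mult_pos_pos sum_pos) (auto simp: less_imp_neq[symmetric])
    have "(1 - 3 * \<rho>) * R.loss (A \<omega>) (Y \<omega>) (w_hat \<omega>) \<le> (1 + \<rho>) * R.loss (A \<omega>) (Y \<omega>) w0
      + (1 - \<rho>) * (2 * \<rho> * R.penalty (A \<omega>) w0 + R.remainder d L B \<rho> w0 (A \<omega>) (Y \<omega>))"
      using g by (intro R.oracle_pathwise[OF L(1) _ am(1) w0 \<rho>(1) \<rho>1 am(2) _ mv] unit) (auto simp: good_def)
    then show "R.loss (A \<omega>) (Y \<omega>) (w_hat \<omega>) \<le> ?R \<omega>"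
      using k unfolding k_def[symmetric] by (simp add: pos_le_divide_eq mult.commute)
  qed
  \<comment> \<open>\<open>integral_mono_AE'\<close> asks for integrability of the upper bound and
    its nonnegativity almost everywhere; the latter holds because \<open>?R\<close> dominates a
    loss.\<close>
  have "expectation (\<lambda>\<omega>. R.loss (A \<omega>) (Y \<omega>) (w_hat \<omega>)) \<le> expectation ?R"
    using path by (intro integral_mono_AE' intR) (auto elim!: eventually_mono intro: order_trans[OF loss_nonneg])
  also have "\<dots> = ((1 + \<rho>) * ?l0 + (1 - \<rho>) * (2 * \<rho> * expectation (\<lambda>\<omega>. R.penalty (A \<omega>) w0)
      + expectation (\<lambda>\<omega>. R.remainder d L B \<rho> w0 (A \<omega>) (Y \<omega>)))) / k"
    using int_loss pen(1) int_rem by simp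
  also have "\<dots> \<le> ((1 + \<rho>) * ?l0 + (1 - \<rho>) * (2 * \<rho> * (?l0 + B * u2 / real n) + ?c)) / k"
    using k \<rho> pen(2) E_rem by (intro divide_right_mono add_mono mult_left_mono) auto
  also have "\<dots> = ((1 + 3 * \<rho> - 2 * \<rho>\<^sup>2) * ?l0 + (1 - \<rho>) * (2 * \<rho> * (B * u2 / real n) + ?c)) / k"
    by (simp add: algebra_simps power2_eq_square)
  also have "\<dots> \<le> ((1 + 3 * \<rho> - 2 * \<rho>\<^sup>2) * ?l0 + k * ((1 / real n) * D_const n d L \<mu> B \<rho> r)) / k"
    using remainder_const_le_D_const[OF n0 d(1) \<rho> B(1) r \<mu>0 uv(1) _ uv(3)] uv(2) k
    by (intro divide_right_mono add_left_mono) (simp_all add: u2_def q_def t_def k_def)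
  also have "\<dots> = (1 + 3 * \<rho> - 2 * \<rho>\<^sup>2) / k * ?l0 + (1 / real n) * D_const n d L \<mu> B \<rho> r"
    using k by (simp add: add_divide_distrib)
  finally show ?thesis unfolding loss k_def .
qed

section \<open>Asymptotics of the remainder\<close>

lemma eventually_odd_sequentially:
  "eventually (\<lambda>n. odd n \<and> n \<ge> N) odd_sequentially"
  unfolding odd_sequentially_def eventually_inf_principal using eventually_ge_at_top[of N]
  by eventually_elim auto

lemma odd_sequentially_le: "odd_sequentially \<le> sequentially"
  by (simp add: odd_sequentially_def)

text \<open>\<open>\<rho> \<le> 1/6\<close> keeps \<open>1 - 3 * \<rho>\<close> at least 1/2, so
  dividing by it costs a factor 2 and \<open>kappa\<close> stays below 8, while
  \<open>1 / \<rho> \<le> 1 / m\<close>. The bound is free of \<open>\<rho>\<close>, hence uniform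
  on the interval; 18 is the 16 of \<open>Upsilon_star\<close> plus the 2 of
  \<open>Psi_const\<close>.\<close>

lemma D_const_bounds:
  assumes n: "n > 0" and d: "1 \<le> d" and \<rho>: "0 < m" "m \<le> \<rho>" "\<rho> \<le> 1 / 6"
    and pos: "0 < B" "0 < r" "0 \<le> \<mu>"
    and uv: "0 \<le> u_const 1 n L" "0 \<le> u_const 2 n L" "0 \<le> v_const n L"
  defines "c \<equiv> real (card L)" and "x \<equiv> sqrt \<mu> / sqrt (real n)"
  shows "0 \<le> D_const n d L \<mu> B \<rho> r"
    and "D_const n d L \<mu> B \<rho> r \<le> 2 * B * (18 * (c / m) + 4 * u_const 1 n L * (1 + c * x)
      + 4 * c * v_const n L * x + 2 * u_const 2 n L)
      + 8 * (2 * (sqrt \<mu> + sqrt 2) * B + var_star n d B r) * (v_const n L / sqrt (real n))"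
proof -
  define Q where "Q = 2 * (sqrt \<mu> + sqrt 2) * B + var_star n d B r"
  define k where "k = 1 - 3 * \<rho>"
  define U where "U = Upsilon_star n L \<mu> \<rho>"
  have \<rho>0: "0 < \<rho>" and k: "1 / 2 \<le> k" "0 < k" using \<rho> by (auto simp: k_def)
  have Q: "0 \<le> Q" using pos by (simp add: Q_def var_star_def)
  have c: "0 \<le> c" and x: "0 \<le> x" using pos by (auto simp: c_def x_def)
  have U: "0 \<le> U" using \<rho>0 pos uv by (simp add: U_def Upsilon_star_def)
  have D: "D_const n d L \<mu> B \<rho> r = ((1 - \<rho>) * U + 2 * (c / \<rho>) + 2 * \<rho> * (1 - \<rho>) * u_const 2 n L) / k * B
      + 4 * (1 - \<rho>\<^sup>2) / k * Q * (v_const n L / sqrt (real n))"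
    using \<rho>0 k unfolding D_const_def Psi_const_def kappa_def Q_def[symmetric] k_def[symmetric] U_def[symmetric] c_def[symmetric]
    by (simp add: power2_eq_square field_simps)
  have rho2: "0 \<le> 1 - \<rho>\<^sup>2" "1 - \<rho>\<^sup>2 \<le> 1" using \<rho> \<rho>0 by (auto simp: abs_square_le_1)
  have frac: "y / k \<le> 2 * y" if "0 \<le> y" for y
  proof -
    have "y / k \<le> y / (1 / 2)" using that k by (intro divide_left_mono) auto
    then show ?thesis by simp
  qed
  show "0 \<le> D_const n d L \<mu> B \<rho> r"
    unfolding D using \<rho> \<rho>0 k Q U c uv pos rho2
    by (intro add_nonneg_nonneg mult_nonneg_nonneg divide_nonneg_nonneg) auto
  have cm: "c / \<rho> \<le> c / m" using \<rho> c by (intro divide_left_mono) auto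
  have "U = 16 * (c / \<rho>) + 4 * u_const 1 n L * (1 + c * x) + 4 * c * v_const n L * x"
    by (simp add: U_def Upsilon_star_def c_def x_def)
  then have U': "U \<le> 16 * (c / m) + 4 * u_const 1 n L * (1 + c * x) + 4 * c * v_const n L * x"
    using cm by simp
  have y0: "0 \<le> (1 - \<rho>) * U + 2 * (c / \<rho>) + 2 * \<rho> * (1 - \<rho>) * u_const 2 n L"
    using \<rho> \<rho>0 U c uv by (intro add_nonneg_nonneg mult_nonneg_nonneg divide_nonneg_nonneg) auto
  have "((1 - \<rho>) * U + 2 * (c / \<rho>) + 2 * \<rho> * (1 - \<rho>) * u_const 2 n L)
     \<le> 1 * U + 2 * (c / m) + 2 * 1 * 1 * u_const 2 n L"
    using \<rho> \<rho>0 cm U uv c by (intro add_mono mult_mono) (auto intro: divide_nonneg_nonneg)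
  also have "\<dots> \<le> 18 * (c / m) + 4 * u_const 1 n L * (1 + c * x) + 4 * c * v_const n L * x + 2 * u_const 2 n L"
    using U' by simp
  finally have "((1 - \<rho>) * U + 2 * (c / \<rho>) + 2 * \<rho> * (1 - \<rho>) * u_const 2 n L) / k * B
     \<le> 2 * (18 * (c / m) + 4 * u_const 1 n L * (1 + c * x) + 4 * c * v_const n L * x + 2 * u_const 2 n L) * B"
    using order_trans[OF frac[OF y0]] pos by (intro mult_right_mono) auto
  moreover have "4 * (1 - \<rho>\<^sup>2) / k \<le> 8"
  proof -
    have "4 * e / k \<le> 8" if "0 \<le> e" "e \<le> 1" for e
      using frac[of "4 * e"] that by simp
    from this[OF rho2] show ?thesis .
  qed
  then have "4 * (1 - \<rho>\<^sup>2) / k * Q * (v_const n L / sqrt (real n)) \<le> 8 * Q * (v_const n L / sqrt (real n))"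
    using Q uv by (intro mult_right_mono) auto
  ultimately show "D_const n d L \<mu> B \<rho> r \<le> 2 * B * (18 * (c / m) + 4 * u_const 1 n L * (1 + c * x)
      + 4 * c * v_const n L * x + 2 * u_const 2 n L)
      + 8 * (2 * (sqrt \<mu> + sqrt 2) * B + var_star n d B r) * (v_const n L / sqrt (real n))"
    unfolding D Q_def by (simp add: mult_ac)
qed

lemma tendsto_bounded_div_powr:
  fixes a :: "nat \<Rightarrow> real"
  assumes "\<gamma> > 0" "eventually (\<lambda>n. \<bar>a n\<bar> \<le> K) odd_sequentially"
  shows "((\<lambda>n. a n / real n powr \<gamma>) \<longlongrightarrow> 0) odd_sequentially"
proof (rule Lim_null_comparison)
  show "eventually (\<lambda>n. norm (a n / real n powr \<gamma>) \<le> K / real n powr \<gamma>) odd_sequentially"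
    using assms(2) by eventually_elim (simp add: abs_divide divide_right_mono)
  have "((\<lambda>n. K / real n powr \<gamma>) \<longlongrightarrow> 0) sequentially" using assms(1) by real_asymp
  then show "((\<lambda>n. K / real n powr \<gamma>) \<longlongrightarrow> 0) odd_sequentially"
    by (rule tendsto_mono[OF odd_sequentially_le])
qed

text \<open>The uniform bound contains products such as \<open>card / m\<close> of two factors
  growing slower than any power of \<open>n\<close>; splitting \<open>n powr \<gamma>\<close> into
  two equal halves treats each factor separately. \<open>Psi_const\<close> is at least linear in the
  number of weights, which the conditions on \<open>u_const\<close> and \<open>v_const\<close> do
  not restrict; hence the separate growth condition on \<open>card\<close>.\<close>

lemma oracle_constant_limit:
  fixes \<Lambda> :: "nat \<Rightarrow> (nat \<Rightarrow> real) set" and d :: "nat \<Rightarrow> nat" and m :: "nat \<Rightarrow> real"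
  assumes Lambda: "\<And>n. odd n \<Longrightarrow> 3 \<le> n \<Longrightarrow>
      finite (\<Lambda> n) \<and> \<Lambda> n \<noteq> {} \<and> \<Lambda> n \<subseteq> {1..n} \<rightarrow>\<^sub>E {0..1}"
    and d_range: "\<And>n. odd n \<Longrightarrow> 3 \<le> n \<Longrightarrow> 1 \<le> d n \<and> d n \<le> n - 1"
    and d_small: "((\<lambda>n. real (d n) / sqrt (real n)) \<longlongrightarrow> 0) odd_sequentially"
    and d_large: "filterlim (\<lambda>n. (real (d n))\<^sup>2 / sqrt (real n)) at_top odd_sequentially"
    and pos: "0 < B" "0 < r" "0 \<le> \<mu>"
    and v: "Limsup odd_sequentially (\<lambda>n. ereal (v_const n (\<Lambda> n) / sqrt (real n))) < \<infinity>"
    and u: "\<And>\<gamma>. \<gamma> > 0 \<Longrightarrow> ((\<lambda>n. u_const 1 n (\<Lambda> n) / real n powr \<gamma>) \<longlongrightarrow> 0) odd_sequentially"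
      "\<And>\<gamma>. \<gamma> > 0 \<Longrightarrow> ((\<lambda>n. u_const 2 n (\<Lambda> n) / real n powr \<gamma>) \<longlongrightarrow> 0) odd_sequentially"
    and card: "\<And>\<gamma>. \<gamma> > 0 \<Longrightarrow> ((\<lambda>n. real (card (\<Lambda> n)) / real n powr \<gamma>) \<longlongrightarrow> 0) odd_sequentially"
    and m0: "(m \<longlongrightarrow> 0) odd_sequentially"
    and m_slow: "\<And>\<gamma>. \<gamma> > 0 \<Longrightarrow> filterlim (\<lambda>n. real n powr \<gamma> * m n) at_top odd_sequentially"
    and \<gamma>: "0 < \<gamma>"
  shows "((\<lambda>n. SUP \<rho>\<in>{m n..1 / 6}. ereal (D_const n (d n) (\<Lambda> n) \<mu> B \<rho> r / real n powr \<gamma>)) \<longlongrightarrow> 0) odd_sequentially"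
proof -
  let ?F = odd_sequentially
  define c where "c n = real (card (\<Lambda> n))" for n
  define x where "x n = sqrt \<mu> / sqrt (real n)" for n
  define vn where "vn n = v_const n (\<Lambda> n) / sqrt (real n)" for n
  define g where "g n = real n powr (\<gamma> / 2)" for n
  define h where "h n = 2 * B * (18 * (c n / m n) + 4 * u_const 1 n (\<Lambda> n) * (1 + c n * x n)
      + 4 * c n * v_const n (\<Lambda> n) * x n + 2 * u_const 2 n (\<Lambda> n))
      + 8 * (2 * (sqrt \<mu> + sqrt 2) * B + var_star n (d n) B r) * vn n" for n
  have g2: "a / real n powr \<gamma> = a / g n / g n" for a n
    by (simp add: g_def flip: powr_add)
  have ev3: "eventually (\<lambda>n. odd n \<and> n \<ge> 3) ?F" by (rule eventually_odd_sequentially)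
  have uv: "0 \<le> u_const 1 n (\<Lambda> n)" "0 \<le> u_const 2 n (\<Lambda> n)" "0 \<le> v_const n (\<Lambda> n)" if "odd n" "3 \<le> n" for n
  proof -
    from Lambda[OF that] obtain w where w: "w \<in> \<Lambda> n" by auto
    have "0 \<le> (\<Sum>j=1..n. w j)" using Lambda[OF that] w by (intro sum_nonneg) (auto simp: PiE_iff subset_iff)
    then show "0 \<le> v_const n (\<Lambda> n)" using v_const_upper[of "\<Lambda> n" w n] w Lambda[OF that] by simp
    show "0 \<le> u_const 1 n (\<Lambda> n)" "0 \<le> u_const 2 n (\<Lambda> n)"
      using Lambda[OF that] that by (auto intro!: u_const_nonneg)
  qed
  obtain K where K: "eventually (\<lambda>n. vn n < K) ?F"
  proof -
    obtain C where C: "Limsup ?F (\<lambda>n. ereal (vn n)) < ereal C"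
      using ereal_dense2[OF v] by (auto simp: vn_def)
    then have "eventually (\<lambda>n. ereal (vn n) < ereal C) ?F" by (rule Limsup_lessD)
    then show ?thesis using that by simp
  qed
  have vn_bdd: "eventually (\<lambda>n. \<bar>vn n\<bar> \<le> K) ?F"
    using K ev3 by eventually_elim (use uv in \<open>simp add: vn_def\<close>)
  \<comment> \<open>The interval has to be nonempty, since in \<open>ereal\<close> the supremum of
    the empty set is \<open>-\<infinity>\<close>. Positivity comes from the divergence of
    \<open>n * m n\<close>.\<close>
  have m_pos: "eventually (\<lambda>n. 0 < m n \<and> m n < 1 / 6) ?F"
  proof -
    have "eventually (\<lambda>n. real n powr 1 * m n > 0) ?F"
      using m_slow[of 1] by (simp add: filterlim_at_top_dense)
    moreover have "eventually (\<lambda>n. m n < 1 / 6) ?F" by (rule order_tendstoD(2)[OF m0]) simp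
    ultimately show ?thesis by eventually_elim (auto simp: zero_less_mult_iff)
  qed
  have x_lim: "(x \<longlongrightarrow> 0) ?F"
    unfolding x_def by (rule tendsto_mono[OF odd_sequentially_le]) real_asymp
  have half: "\<gamma> / 2 > 0" using \<gamma> by simp
  have cg: "((\<lambda>n. c n / g n) \<longlongrightarrow> 0) ?F" using card[OF half] by (simp add: c_def g_def)
  have ug: "((\<lambda>n. u_const 1 n (\<Lambda> n) / g n) \<longlongrightarrow> 0) ?F" using u(1)[OF half] by (simp add: g_def)
  have gm: "((\<lambda>n. 1 / (g n * m n)) \<longlongrightarrow> 0) ?F"
    using m_slow[OF half] tendsto_inverse_0_at_top unfolding g_def by (fastforce simp: field_simps inverse_eq_divide)
  have T1: "((\<lambda>n. c n / m n / real n powr \<gamma>) \<longlongrightarrow> 0) ?F"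
  proof -
    have "((\<lambda>n. (c n / g n) * (1 / (g n * m n))) \<longlongrightarrow> 0 * 0) ?F" by (intro tendsto_mult cg gm)
    then show ?thesis unfolding g2 by (simp add: mult_ac)
  qed
  have T2: "((\<lambda>n. u_const 1 n (\<Lambda> n) * (1 + c n * x n) / real n powr \<gamma>) \<longlongrightarrow> 0) ?F"
  proof -
    have "((\<lambda>n. u_const 1 n (\<Lambda> n) / real n powr \<gamma> + (u_const 1 n (\<Lambda> n) / g n) * (c n / g n) * x n) \<longlongrightarrow> 0 + 0 * 0 * 0) ?F"
      by (intro tendsto_add tendsto_mult cg ug x_lim u(1) \<gamma>)
    then show ?thesis unfolding g2 by (simp add: distrib_left add_divide_distrib mult_ac)
  qed
  \<comment> \<open>The factor \<open>1 / sqrt n\<close> in \<open>x n\<close> turns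
    \<open>v_const\<close> into the bounded quantity \<open>vn\<close>.\<close>
  have T3: "((\<lambda>n. c n * v_const n (\<Lambda> n) * x n / real n powr \<gamma>) \<longlongrightarrow> 0) ?F"
  proof -
    have "((\<lambda>n. sqrt \<mu> * ((c n / g n) * (vn n / g n))) \<longlongrightarrow> sqrt \<mu> * (0 * 0)) ?F"
      unfolding g_def by (intro tendsto_mult tendsto_const cg[unfolded g_def] tendsto_bounded_div_powr[OF half vn_bdd])
    then show ?thesis unfolding g2 by (simp add: vn_def x_def mult_ac)
  qed
  \<comment> \<open>The two growth conditions on \<open>d\<close> act on opposite ends of
    \<open>var_star\<close>: the lower one bounds its first term, the upper one its last.\<close>
  have var: "eventually (\<lambda>n. \<bar>(2 * (sqrt \<mu> + sqrt 2) * B + var_star n (d n) B r) * vn n\<bar>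
      \<le> (2 * (sqrt \<mu> + sqrt 2) * B + (4 * r + 4 * sqrt (r * B) + 3 * B)) * K) ?F"
  proof -
    have "eventually (\<lambda>n. (real (d n))\<^sup>2 / sqrt (real n) \<ge> 1) ?F"
      using d_large by (simp add: filterlim_at_top)
    moreover have "eventually (\<lambda>n. real (d n) / sqrt (real n) < 1) ?F"
      by (rule order_tendstoD(2)[OF d_small]) simp
    ultimately show ?thesis using vn_bdd ev3
    proof eventually_elim
      case (elim n)
      then have n: "1 \<le> sqrt (real n)" and d1: "1 \<le> real (d n)" using d_range[of n] by auto
      have "4 * r * sqrt (real n) / (real (d n))\<^sup>2 \<le> 4 * r"
        using elim(1) n d1 pos by (simp add: field_simps)
      moreover have "4 * sqrt (r * B) * (1 / real (d n)) \<le> 4 * sqrt (r * B) * 1"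
        using d1 pos by (intro mult_left_mono) auto
      moreover have "(2 + real (d n)) * B / sqrt (real n) \<le> 3 * B"
      proof -
        have "2 + a \<le> 3 * y" if "a < y" "1 \<le> y" for a y :: real using that by simp
        moreover have "real (d n) < sqrt (real n)" using elim(2,4) by (simp add: field_simps)
        ultimately have "2 + real (d n) \<le> 3 * sqrt (real n)" using n by blast
        then have "(2 + real (d n)) * B \<le> 3 * sqrt (real n) * B" using pos by (intro mult_right_mono) auto
        then show ?thesis using n by (simp add: field_simps)
      qed
      ultimately have "var_star n (d n) B r \<le> 4 * r + 4 * sqrt (r * B) + 3 * B"
        by (simp add: var_star_def)
      moreover have "0 \<le> var_star n (d n) B r" using pos by (simp add: var_star_def)
      ultimately show ?case unfolding abs_mult using elim(3) pos by (intro mult_mono) auto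
    qed
  qed
  have h_lim: "((\<lambda>n. h n / real n powr \<gamma>) \<longlongrightarrow> 0) ?F"
  proof -
    have "((\<lambda>n. 2 * B * (18 * (c n / m n / real n powr \<gamma>) + 4 * (u_const 1 n (\<Lambda> n) * (1 + c n * x n) / real n powr \<gamma>)
        + 4 * (c n * v_const n (\<Lambda> n) * x n / real n powr \<gamma>) + 2 * (u_const 2 n (\<Lambda> n) / real n powr \<gamma>))
        + 8 * ((2 * (sqrt \<mu> + sqrt 2) * B + var_star n (d n) B r) * vn n / real n powr \<gamma>))
        \<longlongrightarrow> 2 * B * (18 * 0 + 4 * 0 + 4 * 0 + 2 * 0) + 8 * 0) ?F"
      by (intro tendsto_add tendsto_mult tendsto_const T1 T2 T3 u(2) \<gamma> tendsto_bounded_div_powr[OF \<gamma> var])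
    moreover have "h n / N = 2 * B * (18 * (c n / m n / N) + 4 * (u_const 1 n (\<Lambda> n) * (1 + c n * x n) / N)
        + 4 * (c n * v_const n (\<Lambda> n) * x n / N) + 2 * (u_const 2 n (\<Lambda> n) / N))
        + 8 * ((2 * (sqrt \<mu> + sqrt 2) * B + var_star n (d n) B r) * vn n / N)" for n and N :: real
      unfolding h_def by (simp add: add_divide_distrib distrib_left mult.assoc)
    ultimately show ?thesis by simp
  qed
  have bounds: "eventually (\<lambda>n. 0 \<le> (SUP \<rho>\<in>{m n..1 / 6}. ereal (D_const n (d n) (\<Lambda> n) \<mu> B \<rho> r / real n powr \<gamma>))
      \<and> (SUP \<rho>\<in>{m n..1 / 6}. ereal (D_const n (d n) (\<Lambda> n) \<mu> B \<rho> r / real n powr \<gamma>)) \<le> ereal (h n / real n powr \<gamma>)) ?F"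
    using m_pos ev3
  proof eventually_elim
    case (elim n)
    then have n: "n > 0" and d1: "1 \<le> d n" using d_range[of n] by auto
    have D: "0 \<le> D_const n (d n) (\<Lambda> n) \<mu> B \<rho> r" "D_const n (d n) (\<Lambda> n) \<mu> B \<rho> r \<le> h n" if "m n \<le> \<rho>" "\<rho> \<le> 1 / 6" for \<rho>
      using D_const_bounds[OF n d1 _ that pos uv] elim unfolding h_def vn_def c_def x_def by auto
    have "0 \<le> ereal (D_const n (d n) (\<Lambda> n) \<mu> B (1 / 6) r / real n powr \<gamma>)" using D(1)[of "1 / 6"] elim by simp
    also have "\<dots> \<le> (SUP \<rho>\<in>{m n..1 / 6}. ereal (D_const n (d n) (\<Lambda> n) \<mu> B \<rho> r / real n powr \<gamma>))"
      using elim by (intro SUP_upper) auto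
    finally show ?case by (auto intro!: SUP_least divide_right_mono D(2))
  qed
  show ?thesis
  proof (rule tendsto_sandwich)
    show "eventually (\<lambda>n. ereal 0 \<le> (SUP \<rho>\<in>{m n..1 / 6}. ereal (D_const n (d n) (\<Lambda> n) \<mu> B \<rho> r / real n powr \<gamma>))) ?F"
      using bounds by eventually_elim (simp add: zero_ereal_def)
    show "eventually (\<lambda>n. (SUP \<rho>\<in>{m n..1 / 6}. ereal (D_const n (d n) (\<Lambda> n) \<mu> B \<rho> r / real n powr \<gamma>)) \<le> ereal (h n / real n powr \<gamma>)) ?F"
      using bounds by eventually_elim simp
    show "((\<lambda>n. ereal (h n / real n powr \<gamma>)) \<longlongrightarrow> 0) ?F"
      using tendsto_ereal[OF h_lim] by (simp add: zero_ereal_def)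
  qed (simp add: zero_ereal_def)
qed

text \<open>Extensionality fixes the weights off \<open>{1..n}\<close>, so each vector of the cube
  is a single element of \<open>\<Lambda> n\<close> and \<open>card\<close> is the number \<nu>. The
  noise is one sequence for all \<open>n\<close>, while the levels form a triangular array.\<close>

theorem theorem3p2:
  fixes M :: "'a measure"
    and \<xi> :: "nat \<Rightarrow> 'a \<Rightarrow> real"
    and \<sigma> :: "nat \<Rightarrow> nat \<Rightarrow> 'a \<Rightarrow> real"
    and \<sigma>s \<xi>s r :: real
    and S :: "real \<Rightarrow> real"
    and \<Lambda> :: "nat \<Rightarrow> (nat \<Rightarrow> real) set"
    and d :: "nat \<Rightarrow> nat"
  assumes prob: "prob_space M"
    and xi_indep: "prob_space.indep_vars M (\<lambda>_. borel) \<xi> {1..}"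
    and xi_ident: "\<And>j. 1 \<le> j \<Longrightarrow> distr M borel (\<xi> j) = distr M borel (\<xi> 1)"
    and xi_mean: "integral\<^sup>L M (\<xi> 1) = 0"
    and xi_var: "integral\<^sup>L M (\<lambda>\<omega>. (\<xi> 1 \<omega>)\<^sup>2) = 1"
    and xi_fourth: "integrable M (\<lambda>\<omega>. (\<xi> 1 \<omega>) ^ 4)"
      "integral\<^sup>L M (\<lambda>\<omega>. (\<xi> 1 \<omega>) ^ 4) = \<xi>s"
    and sigma_meas: "\<And>n l. odd n \<Longrightarrow> 3 \<le> n \<Longrightarrow> l \<in> {1..n} \<Longrightarrow> \<sigma> n l \<in> borel_measurable M"
    and sigma_xi_indep: "\<And>n. odd n \<Longrightarrow> 3 \<le> n \<Longrightarrow>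
      prob_space.indep_var M
        (Pi\<^sub>M {1..n} (\<lambda>_. borel)) (\<lambda>\<omega>. \<lambda>l\<in>{1..n}. \<sigma> n l \<omega>)
        (Pi\<^sub>M {1..} (\<lambda>_. borel)) (\<lambda>\<omega>. \<lambda>j\<in>{1..}. \<xi> j \<omega>)"
    and sigma_star_pos: "0 < \<sigma>s"
    and sigma_bounds: "\<And>n. odd n \<Longrightarrow> 3 \<le> n \<Longrightarrow>
      (AE \<omega> in M. \<forall>l\<in>{1..n}. 0 < \<sigma> n l \<omega> \<and> (\<sigma> n l \<omega>)\<^sup>2 \<le> \<sigma>s)"
    and r_pos: "0 < r"
    and S_in: "S \<in> sobolev_ball r"
    and Lambda: "\<And>n. odd n \<Longrightarrow> 3 \<le> n \<Longrightarrow>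
      finite (\<Lambda> n) \<and> \<Lambda> n \<noteq> {} \<and> \<Lambda> n \<subseteq> {1..n} \<rightarrow>\<^sub>E {0..1}"
    and d_range: "\<And>n. odd n \<Longrightarrow> 3 \<le> n \<Longrightarrow> 1 \<le> d n \<and> d n \<le> n - 1"
    and d_small: "((\<lambda>n. real (d n) / sqrt (real n)) \<longlongrightarrow> 0) odd_sequentially"
    and d_large: "filterlim (\<lambda>n. (real (d n))\<^sup>2 / sqrt (real n)) at_top odd_sequentially"
  shows
    "(\<forall>n \<rho> w_hat. odd n \<longrightarrow> 3 \<le> n \<longrightarrow> 0 < \<rho> \<longrightarrow> \<rho> < 1 / 3 \<longrightarrow>
        w_hat \<in> M \<rightarrow>\<^sub>M count_space (\<Lambda> n) \<longrightarrow>
        (\<forall>\<omega>\<in>space M. is_arg_min (cost n (d n) \<rho> (observations n S (\<sigma> n) \<xi> \<omega>))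
            (\<lambda>w. w \<in> \<Lambda> n) (w_hat \<omega>)) \<longrightarrow>
        (\<integral>\<omega>. empirical_norm_sq n
            (\<lambda>x. S_hat n (observations n S (\<sigma> n) \<xi> \<omega>) (w_hat \<omega>) x - S x) \<partial>M)
        \<le> (1 + 3 * \<rho> - 2 * \<rho>\<^sup>2) / (1 - 3 * \<rho>) *
            (MIN w\<in>\<Lambda> n. \<integral>\<omega>. empirical_norm_sq n
              (\<lambda>x. S_hat n (observations n S (\<sigma> n) \<xi> \<omega>) w x - S x) \<partial>M)
          + (1 / real n) * D_const n (d n) (\<Lambda> n) \<xi>s \<sigma>s \<rho> r)
     \<and>
     (Limsup odd_sequentially (\<lambda>n. ereal (v_const n (\<Lambda> n) / sqrt (real n))) < \<infinity> \<longrightarrow>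
      (\<forall>\<gamma>>0. ((\<lambda>n. u_const 1 n (\<Lambda> n) / real n powr \<gamma>) \<longlongrightarrow> 0) odd_sequentially) \<longrightarrow>
      (\<forall>\<gamma>>0. ((\<lambda>n. u_const 2 n (\<Lambda> n) / real n powr \<gamma>) \<longlongrightarrow> 0) odd_sequentially) \<longrightarrow>
      (\<forall>\<gamma>>0. ((\<lambda>n. real (card (\<Lambda> n)) / real n powr \<gamma>) \<longlongrightarrow> 0) odd_sequentially) \<longrightarrow>
      (\<forall>\<rho>min :: nat \<Rightarrow> real.
        (\<rho>min \<longlongrightarrow> 0) odd_sequentially \<longrightarrow>
        (\<forall>\<gamma>>0. filterlim (\<lambda>n. real n powr \<gamma> * \<rho>min n) at_top odd_sequentially) \<longrightarrow>
        (\<forall>\<gamma>>0. ((\<lambda>n. SUP \<rho>\<in>{\<rho>min n..1 / 6}.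
            ereal (D_const n (d n) (\<Lambda> n) \<xi>s \<sigma>s \<rho> r / real n powr \<gamma>)) \<longlongrightarrow> 0) odd_sequentially)))"
proof -
  interpret prob_space M by (rule prob)
  have \<xi>s_nonneg: "0 \<le> \<xi>s" using xi_fourth(2) by (auto intro!: integral_nonneg_AE)
  have risk_bound: "(\<integral>\<omega>. empirical_norm_sq n
            (\<lambda>x. S_hat n (observations n S (\<sigma> n) \<xi> \<omega>) (w_hat \<omega>) x - S x) \<partial>M)
        \<le> (1 + 3 * \<rho> - 2 * \<rho>\<^sup>2) / (1 - 3 * \<rho>) *
            (MIN w\<in>\<Lambda> n. \<integral>\<omega>. empirical_norm_sq n
              (\<lambda>x. S_hat n (observations n S (\<sigma> n) \<xi> \<omega>) w x - S x) \<partial>M)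
          + (1 / real n) * D_const n (d n) (\<Lambda> n) \<xi>s \<sigma>s \<rho> r"
    if n: "odd n" "3 \<le> n" and \<rho>: "0 < \<rho>" "\<rho> < 1 / 3"
      and w_hat: "\<forall>\<omega>\<in>space M. is_arg_min (cost n (d n) \<rho> (observations n S (\<sigma> n) \<xi> \<omega>))
            (\<lambda>w. w \<in> \<Lambda> n) (w_hat \<omega>)" for n \<rho> w_hat
  proof -
    let ?risk = "\<lambda>w. \<integral>\<omega>. empirical_norm_sq n
              (\<lambda>x. S_hat n (observations n S (\<sigma> n) \<xi> \<omega>) w x - S x) \<partial>M"
    have L: "finite (\<Lambda> n)" "\<Lambda> n \<noteq> {}" "\<Lambda> n \<subseteq> {1..n} \<rightarrow>\<^sub>E {0..1}" using Lambda[OF n] by auto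
    \<comment> \<open>A minimizer of the risk over the finite set is nonrandom, so it may serve as
      the comparator.\<close>
    then have "(MIN w\<in>\<Lambda> n. ?risk w) \<in> ?risk ` \<Lambda> n" by (intro Min_in) auto
    then obtain w0 where w0: "w0 \<in> \<Lambda> n" "(MIN w\<in>\<Lambda> n. ?risk w) = ?risk w0" by blast
    have d: "1 \<le> d n" "d n \<le> n" using d_range[OF n] by auto
    show ?thesis unfolding w0(2)
      by (rule oracle_inequality[OF prob xi_indep xi_ident xi_mean xi_var xi_fourth sigma_xi_indep[OF n]
        sigma_star_pos sigma_bounds[OF n] r_pos S_in L(1,3) w0(1) d n(1) \<rho>]) (use w_hat in auto)
  qed
  show ?thesis
    by (intro conjI allI impI risk_bound oracle_constant_limit[OF Lambda d_range d_small d_large sigma_star_pos r_pos \<xi>s_nonneg]) auto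
qed

end
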